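(* Let $L_n$, $D_n$ and $L_{n,r}$ ($1\le r\le n-1$) be the edge-height, the time-height and the number of size-$r$ decrements associated with a uniformly chosen leaf of a critical beta-splitting tree with $n$ leaves, as defined in the context. Let $W^\ast=(W^\ast(u))_{u\in[0,1]}$ be a standard Brownian motion. (i) As $n\to\infty$, $$\Big(\frac{L_n-(2\zeta(2))^{-1}(\log n)^2}{(2\zeta(3)(\zeta(2))^{-3}(\log n)^3)^{1/2}},\ \frac{D_n-(\zeta(2))^{-1}\log n}{(2\zeta(3)(\zeta(2))^{-3}\log n)^{1/2}}\Big)\ \overset{\mathrm d}{\to}\ \Big(\int_0^1 W^\ast(u)\,\mathrm du,\ W^\ast(1)\Big).$$ (ii) For any fixed $j\in\mathbb N$, as $n\to\infty$, $$\Big(\frac{L_{n,r}-(\zeta(2)r)^{-1}\log n}{(\log n)^{1/2}}\Big)_{1\le r\le j}\ \overset{\mathrm d}{\to}\ \Big((2\zeta(3)(\zeta(2))^{-3})^{1/2}r^{-1}W^\ast(1)+(r\zeta(2))^{-1/2}Y_r\Big)_{1\le r\le j},$$ with the same Brownian motion $W^\ast$ as in (i), where $Y_1,\ldots,Y_j$ are independent standard normal random variables which are independent of $W^\ast$. Moreover, the limit relations (i) and (ii) hold jointly; that is, for each fixed $j\in\mathbb N$, the $(j+2)$-dimensional random vector formed by all the normalized quantities in (i) and (ii) converges in distribution, as $n\to\infty$, to the vector formed by the corresponding limits, built from the same $W^\ast$ and $Y_1,\ldots,Y_j$.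
   Context: Notation: $\mathbb N=\{1,2,\ldots\}$; $\zeta(s)=\sum_{n\ge1}n^{-s}$ for $s>1$; $h_m:=\sum_{i=1}^m 1/i$; $\overset{\mathrm d}{\to}$ denotes convergence in distribution. Critical beta-splitting tree. For integer $m\ge2$ let $q(m,\cdot)$ be the probability distribution on $\{1,\ldots,m-1\}$ given by $q(m,i)=\frac{m}{2h_{m-1}}\frac{1}{i(m-i)}$, $i=1,\ldots,m-1$. The critical beta-splitting tree with $n$ leaves is the random rooted tree obtained by recursively splitting the set $\{1,\ldots,n\}$: a set of $m\ge2$ consecutive elements is split into a left subset (consisting of its first $G$ elements) and a right subset (the remaining $m-G$ elements), where $G$ has distribution $q(m,\cdot)$; different splits are conditionally independent given the set sizes. There is an edge from the set to each of its two subsets. The procedure stops once all sets are singletons (leaves). Discrete and continuous versions. In the discrete version all edges have length $1$. In the continuous version, built on the same tree, the edge emanating from a set of size $m\ge2$ has a random length having the exponential distribution with mean $1/h_{m-1}$; the lengths of the edges along a path from the root to a leaf are conditionally independent given the sizes of the sets on that path. Choose a leaf uniformly at random, independently of everything else. $L_n$ and $D_n$ denote the height (sum of the edge lengths on the path from the root) of this leaf in the discrete and the continuous version, respectively (same tree and same leaf for both). Along the splitting procedure the sizes of the sets containing the chosen leaf decrease from $n$ to $1$; for $1\le r\le n-1$, $L_{n,r}$ denotes the number of decrements of size exactly $r$ in this sequence of sizes. Thus $L_n=\sum_{r=1}^{n-1}L_{n,r}$. *)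

theory Defs
  imports "HOL-Probability.Probability"
begin

definition zeta :: "real \<Rightarrow> real" where
  "zeta s = (\<Sum>n. real (Suc n) powr (- s))"


section \<open>The critical beta-splitting tree\<close>

definition split_weight :: "nat \<Rightarrow> nat \<Rightarrow> real" where
  "split_weight m i =
     (if i \<in> {1..m - 1} then real m / (2 * harm (m - 1)) * (1 / (real i * real (m - i))) else 0)"

text \<open>The distribution \<open>q(m,\<cdot>)\<close> of the size of the left subset; meaningful for \<open>m \<ge> 2\<close> only.\<close>
definition split_pmf :: "nat \<Rightarrow> nat pmf" where
  "split_pmf m = embed_pmf (split_weight m)"

lemma split_weight_nonneg: "0 \<le> split_weight m i"
  by (auto simp: split_weight_def intro!: mult_nonneg_nonneg divide_nonneg_nonneg harm_nonneg)

lemma divide_times_eq_1: "0 < c \<Longrightarrow> 1 / (2 * c) * (2 * c) = (1::real)"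
  by simp

lemma sum_split_weight:
  assumes "2 \<le> m"
  shows "(\<Sum>i\<in>{1..m - 1}. split_weight m i) = 1"
proof -
  have pos: "harm (m - 1) > (0::real)"
    using assms by (intro harm_pos) auto
  have refl_sum: "(\<Sum>i\<in>{1..m - 1}. 1 / real (m - i)) = (\<Sum>i\<in>{1..m - 1}. 1 / real i)"
    by (rule sum.reindex_bij_witness[of _ "\<lambda>i. m - i" "\<lambda>i. m - i"]) (use assms in auto)
  have "(\<Sum>i\<in>{1..m - 1}. split_weight m i) =
      (\<Sum>i\<in>{1..m - 1}. 1 / (2 * harm (m - 1)) * (1 / real i + 1 / real (m - i)))"
  proof (rule sum.cong[OF refl])
    fix i assume i: "i \<in> {1..m - 1}"
    have split: "(x + y) / (2 * c) * (1 / (x * y)) = 1 / (2 * c) * (1 / x + 1 / y)"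
      if "x > 0" "y > 0" for c x y :: real
      using that by (simp add: add_divide_distrib algebra_simps)
    have "real m = real i + real (m - i)" "real i > 0" "real (m - i) > 0"
      using i assms by auto
    then show "split_weight m i = 1 / (2 * harm (m - 1)) * (1 / real i + 1 / real (m - i))"
      unfolding split_weight_def using i split[of "real i" "real (m - i)" "harm (m - 1)"] by presburger
  qed
  also have "\<dots> = 1 / (2 * harm (m - 1)) * (2 * harm (m - 1))"
    unfolding sum_distrib_left[symmetric] sum.distrib refl_sum
    by (simp add: harm_def inverse_eq_divide)
  also have "\<dots> = 1"
    by (rule divide_times_eq_1) (rule pos)
  finally show ?thesis .
qed

lemma nn_integral_split_weight:
  assumes "2 \<le> m"
  shows "(\<integral>\<^sup>+i. ennreal (split_weight m i) \<partial>count_space UNIV) = 1"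
proof -
  have "(\<integral>\<^sup>+i. ennreal (split_weight m i) \<partial>count_space UNIV) =
      (\<Sum>i\<in>{1..m - 1}. ennreal (split_weight m i))"
    by (rule nn_integral_count_space') (auto simp: split_weight_def)
  also have "\<dots> = ennreal (\<Sum>i\<in>{1..m - 1}. split_weight m i)"
    by (rule sum_ennreal) (rule split_weight_nonneg)
  finally show ?thesis using sum_split_weight[OF assms] by simp
qed

lemma pmf_split_pmf: "2 \<le> m \<Longrightarrow> pmf (split_pmf m) i = split_weight m i"
  unfolding split_pmf_def
  by (rule pmf_embed_pmf) (auto simp: split_weight_nonneg nn_integral_split_weight)

lemma set_split_pmf: "2 \<le> m \<Longrightarrow> i \<in> set_pmf (split_pmf m) \<Longrightarrow> 1 \<le> i \<and> i < m"
proof -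
  assume m: "2 \<le> m" and "i \<in> set_pmf (split_pmf m)"
  then have "split_weight m i \<noteq> 0"
    by (simp add: set_pmf_iff pmf_split_pmf[OF m])
  then have "i \<in> {1..m - 1}"
    unfolding split_weight_def by presburger
  then show ?thesis using m by auto
qed

text \<open>The leaf \<open>Leaf k\<close> is the singleton \<open>{k}\<close>; an inner vertex is the union of its left and
  right subsets.\<close>
datatype split_tree = Leaf nat | Node split_tree split_tree

fun elems :: "split_tree \<Rightarrow> nat set" where
  "elems (Leaf k) = {k}"
| "elems (Node l r) = elems l \<union> elems r"

text \<open>Random splitting of the \<open>m\<close> consecutive elements \<open>a, \<dots>, a + m - 1\<close>.\<close>
function split_consecutive :: "nat \<Rightarrow> nat \<Rightarrow> split_tree pmf" where
  "split_consecutive a m =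
     (if m < 2 then return_pmf (Leaf a)
      else bind_pmf (split_pmf m) (\<lambda>G.
           bind_pmf (split_consecutive a G) (\<lambda>l.
           bind_pmf (split_consecutive (a + G) (m - G)) (\<lambda>r.
           return_pmf (Node l r)))))"
  by pat_completeness auto
termination
proof (relation "inv_image less_than snd")
  show "((a, G), (a, m)) \<in> inv_image less_than snd"
    if "\<not> m < 2" "G \<in> set_pmf (split_pmf m)" for a m G
    using set_split_pmf[of m G] that by simp
  show "((a + G, m - G), (a, m)) \<in> inv_image less_than snd"
    if "\<not> m < 2" "G \<in> set_pmf (split_pmf m)" for a m G
    using set_split_pmf[of m G] that by simp
qed simp

declare split_consecutive.simps [simp del]

definition critical_beta_splitting :: "nat \<Rightarrow> split_tree pmf" where
  "critical_beta_splitting n = split_consecutive 1 n"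

text \<open>The vertices on the path from the root to the leaf \<open>{k}\<close>, each given as a set of elements.\<close>
fun path_sets :: "nat \<Rightarrow> split_tree \<Rightarrow> nat set list" where
  "path_sets k (Leaf i) = [{i}]"
| "path_sets k (Node l r) =
     elems (Node l r) # (if k \<in> elems l then path_sets k l else path_sets k r)"

definition path_sizes :: "nat \<Rightarrow> split_tree \<Rightarrow> nat list" where
  "path_sizes k t = map card (path_sets k t)"

text \<open>Edges are pairs consisting of a set and one of its two subsets.\<close>
type_synonym edge = "nat set \<times> nat set"

definition path_edges :: "nat \<Rightarrow> split_tree \<Rightarrow> edge list" where
  "path_edges k t = zip (path_sets k t) (tl (path_sets k t))"

definition leaf_height :: "(edge \<Rightarrow> real) \<Rightarrow> nat \<Rightarrow> split_tree \<Rightarrow> real" where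
  "leaf_height len k t = (\<Sum>e\<leftarrow>path_edges k t. len e)"

definition leaf_decrements :: "nat \<Rightarrow> nat \<Rightarrow> split_tree \<Rightarrow> nat" where
  "leaf_decrements r k t = length (filter (\<lambda>(s, s'). card s - card s' = r) (path_edges k t))"

text \<open>
  A critical beta-splitting tree \<open>T\<close> with \<open>n\<close> leaves and edge lengths \<open>len\<close> of its continuous
  version, together with a uniformly chosen leaf \<open>U\<close>. Probabilities conditional on the event
  that the path to the leaf \<open>k\<close> has the sizes \<open>ms\<close> are given by \<^const>\<open>uniform_measure\<close>. The
  joint law of edge lengths on different paths is left unspecified, and so are the values of
  \<open>len\<close> at pairs which are not edges of \<open>T\<close>.
\<close>
locale beta_splitting_model = prob_space M
  for M :: "'a measure" +
  fixes n :: nat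
    and T :: "'a \<Rightarrow> split_tree"
    and len :: "'a \<Rightarrow> edge \<Rightarrow> real"
    and U :: "'a \<Rightarrow> nat"
  assumes T_measurable: "T \<in> measurable M (count_space UNIV)"
    and T_distr: "distr M (count_space UNIV) T = measure_pmf (critical_beta_splitting n)"
    and len_measurable: "\<And>e. (\<lambda>\<omega>. len \<omega> e) \<in> borel_measurable M"
    and len_path:
      "\<And>k ms A. \<lbrakk>k \<in> {1..n}; A = {\<omega> \<in> space M. path_sizes k (T \<omega>) = ms}; prob A > 0\<rbrakk> \<Longrightarrow>
         prob_space.indep_vars (uniform_measure M A) (\<lambda>_. borel)
           (\<lambda>i \<omega>. len \<omega> (path_edges k (T \<omega>) ! i)) {..<length ms - 1} \<and>
         (\<forall>i<length ms - 1.
            distributed (uniform_measure M A) lborel (\<lambda>\<omega>. len \<omega> (path_edges k (T \<omega>) ! i))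
              (exponential_density (harm (ms ! i - 1))))"
    and U_measurable: "U \<in> measurable M (count_space UNIV)"
    and U_distr: "distr M (count_space UNIV) U = measure_pmf (pmf_of_set {1..n})"
    and U_indep:
      "indep_set (sets (vimage_algebra (space M) U (count_space UNIV)))
         (sets (vimage_algebra (space M) (\<lambda>\<omega>. (T \<omega>, len \<omega>))
            (count_space UNIV \<Otimes>\<^sub>M PiM UNIV (\<lambda>_. borel))))"

definition edge_height :: "('a \<Rightarrow> split_tree) \<Rightarrow> ('a \<Rightarrow> nat) \<Rightarrow> 'a \<Rightarrow> real" where
  "edge_height T U \<omega> = leaf_height (\<lambda>_. 1) (U \<omega>) (T \<omega>)"

definition time_height ::
  "('a \<Rightarrow> split_tree) \<Rightarrow> ('a \<Rightarrow> edge \<Rightarrow> real) \<Rightarrow> ('a \<Rightarrow> nat) \<Rightarrow> 'a \<Rightarrow> real" where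
  "time_height T len U \<omega> = leaf_height (len \<omega>) (U \<omega>) (T \<omega>)"

definition decrement_count :: "('a \<Rightarrow> split_tree) \<Rightarrow> ('a \<Rightarrow> nat) \<Rightarrow> nat \<Rightarrow> 'a \<Rightarrow> real" where
  "decrement_count T U r \<omega> = real (leaf_decrements r (U \<omega>) (T \<omega>))"


section \<open>Brownian motion and convergence in distribution\<close>

text \<open>Standard Brownian motion on \<open>[0,1]\<close>; the values \<open>W u\<close> for \<open>u \<notin> [0,1]\<close> are irrelevant.\<close>
locale std_brownian_motion = prob_space N
  for N :: "'a measure" +
  fixes W :: "real \<Rightarrow> 'a \<Rightarrow> real"
  assumes W_measurable: "\<And>u. u \<in> {0..1} \<Longrightarrow> W u \<in> borel_measurable N"
    and W_zero: "AE \<omega> in N. W 0 \<omega> = 0"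
    and W_continuous: "\<And>\<omega>. \<omega> \<in> space N \<Longrightarrow> continuous_on {0..1} (\<lambda>u. W u \<omega>)"
    and W_normal_increments:
      "\<And>s t. \<lbrakk>0 \<le> s; s < t; t \<le> 1\<rbrakk> \<Longrightarrow>
         distributed N lborel (\<lambda>\<omega>. W t \<omega> - W s \<omega>) (normal_density 0 (sqrt (t - s)))"
    and W_indep_increments:
      "\<And>(t :: nat \<Rightarrow> real) k. \<lbrakk>0 \<le> t 0; t k \<le> 1; \<And>i. i < k \<Longrightarrow> t i < t (Suc i)\<rbrakk> \<Longrightarrow>
         indep_vars (\<lambda>_. borel) (\<lambda>i \<omega>. W (t (Suc i)) \<omega> - W (t i) \<omega>) {..<k}"

text \<open>
  \<open>X n\<close>, defined on the probability space \<open>M n\<close>, converges in distribution to \<open>Z\<close>, defined on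
  \<open>N\<close>. Measurability is part of the definition, since the Bochner integral of a non-measurable
  function is \<open>0\<close>.
\<close>
definition converges_in_distribution ::
  "(nat \<Rightarrow> 'a measure) \<Rightarrow> (nat \<Rightarrow> 'a \<Rightarrow> 'c::topological_space) \<Rightarrow> 'b measure \<Rightarrow> ('b \<Rightarrow> 'c) \<Rightarrow> bool" where
  "converges_in_distribution M X N Z \<longleftrightarrow>
     (\<forall>\<^sub>F n in sequentially. X n \<in> borel_measurable (M n)) \<and> Z \<in> borel_measurable N \<and>
     (\<forall>f :: 'c \<Rightarrow> real. continuous_on UNIV f \<and> bounded (range f) \<longrightarrow>
        (\<lambda>n. \<integral>\<omega>. f (X n \<omega>) \<partial>M n) \<longlonglongrightarrow> (\<integral>\<omega>. f (Z \<omega>) \<partial>N))"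

end

theory Submission
  imports Defs "HOL-Real_Asymp.Real_Asymp"
begin

text \<open>
  Along the path to a uniformly chosen leaf the set sizes form a Markov chain. The choice of the
  leaf size-biases the split law, so that a set of size \<open>m\<close> loses \<open>r\<close> elements with probability
  \<open>1 / (h\<^bsub>m-1\<^esub> r)\<close>; as edges have rate \<open>h\<^bsub>m-1\<^esub>\<close>, a set of \<open>N + 1\<close> elements loses \<open>r\<close> elements at
  rate \<open>1 / r\<close>, for \<open>1 \<le> r \<le> N\<close>. On the scale of the harmonic numbers, which up to a bounded
  error is the logarithmic scale, this is a jump from \<open>h\<^bsub>N\<^esub>\<close> to \<open>h\<^bsub>N-r\<^esub>\<close>. Under the rates \<open>1 / r\<close>
  the jumps have first and second moments close to \<open>\<zeta>(2)\<close> and \<open>2 \<zeta>(3)\<close>: the logarithm of the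
  size comes down with speed \<open>\<zeta>(2)\<close> and variance \<open>2 \<zeta>(3)\<close> per unit of time. Hence the time
  \<open>D\<^bsub>n\<^esub>\<close> for coming down from \<open>log n\<close> is asymptotically normal. The number \<open>L\<^bsub>n\<^esub>\<close> of jumps, which
  occur at rate \<open>h\<^bsub>N\<^esub>\<close>, is to first order the integral of the logarithm of the size over time,
  whence the integral of the Brownian motion. Jumps of a fixed size \<open>r\<close> are almost a Poisson
  process of rate \<open>1 / r\<close>; they hardly move the logarithm of the size, and so their fluctuations
  \<open>Y\<^bsub>r\<^esub>\<close> are independent of those of \<open>D\<^bsub>n\<^esub>\<close>.

  The proof is a calculation with characteristic functions. The joint transform of all heights
  satisfies a linear recursion in \<open>N\<close>, solved by \<open>path_transform\<close> (lemmas
  \<open>uniform_leaf_transform\<close> and \<open>joint_transform\<close>). The function \<open>exp (\<Phi> (h\<^bsub>N\<^esub>))\<close>, with \<open>\<Phi>\<close>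
  given by \<open>limit_exponent\<close>, is an approximate solution: the derivative of \<open>\<Phi>\<close> is chosen such
  that the recursion, expanded to second order, cancels (\<open>quadratic_expansion\<close>,
  \<open>residual_le\<close>). The errors are controlled by three exact identities for the rates \<open>1 / r\<close>:
  the first moment is a partial sum of \<open>\<zeta>(2)\<close> (\<open>jump_first_moment\<close>), the second moment is a
  partial sum of Euler's series for \<open>2 \<zeta>(3)\<close> (\<open>jump_second_moment\<close>, \<open>euler_sum_limit\<close>), and
  \<open>jump_sum_reciprocal\<close> shows that errors of order \<open>h\<^bsub>N\<^esub> / (N + 1)\<close> have bounded total effect
  along a path. They enter through a comparison principle (\<open>jump_comparison\<close>), which bounds the
  distance from the approximate to the true solution. This yields the limit of the
  characteristic functions (\<open>path_transform_limit\<close>).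

  For the limiting vector the characteristic function is computed from Riemann sums of the
  Brownian path (\<open>char_limit\<close>); it is the exponential of the same quadratic form. Convergence
  of characteristic functions implies convergence in distribution in every Euclidean space
  (locale \<open>char_convergence\<close>): Levy's theorem on the line gives tightness of the coordinates,
  and on a cube a continuous function is, by the theorem of Stone and Weierstrass, nearly a
  polynomial in the sines of the scaled coordinates, that is, a trigonometric polynomial.
\<close>

section \<open>Moments of the jumps on the harmonic scale\<close>

text \<open>
  Sizes are written as \<open>N + 1\<close>, so that \<open>h\<^bsub>N\<^esub>\<close> is the total jump rate and \<open>N = 0\<close> is the end of
  the path. \<open>gap N r\<close> is the length of the jump which removes \<open>r\<close> elements, and \<open>jump_sum N\<close> is
  the integral against the jump rates.
\<close>
abbreviation gap :: "nat \<Rightarrow> nat \<Rightarrow> real" where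
  "gap N r \<equiv> harm N - harm (N - r)"

abbreviation jump_sum :: "nat \<Rightarrow> (nat \<Rightarrow> real) \<Rightarrow> real" where
  "jump_sum N f \<equiv> \<Sum>r=1..N. (1 / real r) * f r"

abbreviation cjump_sum :: "nat \<Rightarrow> (nat \<Rightarrow> complex) \<Rightarrow> complex" where
  "cjump_sum N f \<equiv> \<Sum>r=1..N. of_real (1 / real r) * f r"

abbreviation zeta2_sum :: "nat \<Rightarrow> real" where
  "zeta2_sum N \<equiv> \<Sum>k=1..N. 1 / real k ^ 2"

abbreviation euler_sum :: "nat \<Rightarrow> real" where
  "euler_sum N \<equiv> \<Sum>k=1..N. harm k / real k ^ 2"

lemma harm_diff_Suc: "r \<le> N \<Longrightarrow> harm (Suc N) - harm (Suc N - r) =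
   gap N r + 1 / real (Suc N) - (1 / real (Suc N - r) :: real)"
  by (simp add: Suc_diff_le harm_Suc inverse_eq_divide)

lemma sum_reflect: "(\<Sum>r=1..N. f (Suc N - r)) = (\<Sum>r=1..N. f r :: real)"
  by (rule sum.reindex_bij_witness[of _ "\<lambda>i. Suc N - i" "\<lambda>i. Suc N - i"]) auto

lemma sum_reciprocal: "(\<Sum>r=1..N. 1 / real r) = harm N"
  by (simp add: harm_def inverse_eq_divide)

lemma sum_reciprocal_reflect: "(\<Sum>r=1..N. 1 / real (Suc N - r)) = harm N"
  using sum_reflect[of "\<lambda>r. 1 / real r" N] sum_reciprocal by simp

lemma sum_reciprocal_product:
  "(\<Sum>r=1..N. 1 / (real r * real (Suc N - r))) = 2 * harm N / real (Suc N)"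
proof -
  have "(\<Sum>r=1..N. 1 / (real r * real (Suc N - r))) =
     (\<Sum>r=1..N. (1 / real (Suc N)) * (1 / real r + 1 / real (Suc N - r)))"
  proof (rule sum.cong[OF refl])
    fix r assume "r \<in> {1..N}"
    then have *: "real (Suc N) = real r + real (Suc N - r)" "real r > 0" "real (Suc N - r) > 0"
      by auto
    show "1 / (real r * real (Suc N - r)) = (1 / real (Suc N)) * (1 / real r + 1 / real (Suc N - r))"
      unfolding *(1) using *(2,3) by (simp add: field_simps)
  qed
  also have "\<dots> = 2 * harm N / real (Suc N)"
    unfolding sum_distrib_left[symmetric] sum.distrib sum_reciprocal sum_reciprocal_reflect
    by (simp del: of_nat_Suc)
  finally show ?thesis .
qed

text \<open>
  The function \<open>1 - 1 / (N + 1)\<close> decreases at rate \<open>h\<^bsub>N\<^esub> / (N + 1)\<close> under the chain. As it stays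
  in \<open>[0, 1]\<close>, every quantity of this size has a bounded integral along a path; this is what makes
  the corrections near the leaf harmless.
\<close>
lemma jump_sum_reciprocal:
  "jump_sum N (\<lambda>r. 1 / real (Suc N - r) - 1 / real (Suc N)) = harm N / real (Suc N)"
proof -
  have "jump_sum N (\<lambda>r. 1 / real (Suc N - r) - 1 / real (Suc N)) =
     (\<Sum>r=1..N. 1 / (real r * real (Suc N - r))) - (\<Sum>r=1..N. 1 / real r) / real (Suc N)"
    by (simp add: right_diff_distrib sum_subtractf sum_divide_distrib)
  then show ?thesis by (simp only: sum_reciprocal_product sum_reciprocal)
qed

text \<open>
  By induction on \<open>N\<close>: each length \<open>gap N r\<close> changes by \<open>1 / (N + 1) - 1 / (N + 1 - r)\<close>, so
  the sum loses \<open>h\<^bsub>N\<^esub> / (N + 1)\<close> by the previous lemma, while the new jump of all \<open>N + 1\<close> elements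
  contributes \<open>h\<^bsub>N+1\<^esub> / (N + 1)\<close>.
\<close>
lemma jump_first_moment:
  "jump_sum N (gap N) = zeta2_sum N"
proof (induction N)
  case 0
  show ?case by simp
next
  case (Suc N)
  have "(\<Sum>r=1..Suc N. (1 / real r) * (harm (Suc N) - harm (Suc N - r))) =
     jump_sum N (\<lambda>r. gap N r + 1 / real (Suc N) - 1 / real (Suc N - r))
       + harm (Suc N) / real (Suc N)"
    by (auto simp: harm_diff_Suc harm_expand simp del: of_nat_Suc intro!: sum.cong)
  also have "jump_sum N (\<lambda>r. gap N r + 1 / real (Suc N) - 1 / real (Suc N - r))
     = jump_sum N (gap N)
        - jump_sum N (\<lambda>r. 1 / real (Suc N - r) - 1 / real (Suc N))"
    by (simp add: sum_subtractf[symmetric] algebra_simps)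
  also have "\<dots> = zeta2_sum N - harm N / real (Suc N)"
    by (simp only: Suc.IH jump_sum_reciprocal)
  finally show ?case
    by (simp add: harm_Suc inverse_eq_divide power2_eq_square add_divide_distrib del: of_nat_Suc)
qed

lemma sum_harm_diff_over:
  "(\<Sum>k=1..N. (harm N - harm (k - 1)) / real k) = (harm N ^ 2 + zeta2_sum N) / (2::real)"
proof (induction N)
  case 0
  show ?case by (simp add: harm_expand)
next
  case (Suc N)
  have "(\<Sum>k=1..Suc N. (harm (Suc N) - harm (k - 1)) / real k) =
     (\<Sum>k=1..N. (harm N - harm (k - 1)) / real k + (1 / real (Suc N)) * (1 / real k))
        + (1 / real (Suc N)) / real (Suc N)"
    by (auto simp: harm_Suc inverse_eq_divide add_divide_distrib diff_divide_distrib
          simp del: of_nat_Suc intro!: sum.cong)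
  also have "\<dots> = (harm N ^ 2 + zeta2_sum N) / 2 + harm N / real (Suc N)
       + (1 / real (Suc N)) / real (Suc N)"
    unfolding sum.distrib sum_distrib_left[symmetric] Suc.IH sum_reciprocal by simp
  also have "\<dots> = (harm (Suc N) ^ 2 + zeta2_sum (Suc N)) / 2"
  proof -
    define c where "c = 1 / real (Suc N)"
    have "harm (Suc N) = harm N + c" "1 / real (Suc N) ^ 2 = c ^ 2"
      by (auto simp: harm_Suc c_def inverse_eq_divide power_divide simp del: of_nat_Suc)
    moreover have "harm N / real (Suc N) = harm N * c" "1 / real (Suc N) / real (Suc N) = c * c"
      by (auto simp: c_def simp del: of_nat_Suc)
    ultimately show ?thesis
      by (simp add: power2_eq_square algebra_simps add_divide_distrib del: of_nat_Suc)
  qed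
  finally show ?case .
qed

text \<open>
  The same induction. The cross terms \<open>D r / (N + 1 - r)\<close> are summed after the reflection
  \<open>r \<mapsto> N + 1 - r\<close> by \<open>sum_harm_diff_over\<close>.
\<close>
lemma jump_second_moment:
  "jump_sum N (\<lambda>r. gap N r ^ 2) = euler_sum N"
proof (induction N)
  case 0
  show ?case by simp
next
  case (Suc N)
  define D where "D r = (harm N - harm (N - r) :: real)" for r
  have step: "(1 / real r) * (D r + 1 / real (Suc N) - 1 / real (Suc N - r)) ^ 2 =
      (1 / real r) * D r ^ 2 - (2 / real (Suc N)) * (D r / real (Suc N - r))
      + (1 / real (Suc N) ^ 2) * (real (Suc N) * (1 / real (Suc N - r) ^ 2) - 1 / real (Suc N - r))"
    if "r \<in> {1..N}" for r
  proof -
    define k where "k = real (Suc N - r)"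
    have *: "real (Suc N) = real r + k" "real r > 0" "k > 0"
      using that by (auto simp: k_def)
    define s where "s = real r + k"
    have s: "s > 0" "real r = s - k" using * by (auto simp: s_def)
    have "1 / s - 1 / k = - ((s - k) / (k * s))"
      using \<open>k > 0\<close> \<open>s > 0\<close> by (simp add: field_simps)
    then have diff: "D r + 1 / s - 1 / k = D r - real r / (k * s)"
      unfolding s(2) by linarith
    have "(1 / real r) * (D r - real r / (k * s)) ^ 2 =
        (1 / real r) * D r ^ 2 - (2 / s) * (D r / k) + real r / (k ^ 2 * s ^ 2)"
      using * s(1) by (simp add: field_simps power2_eq_square)
    also have "real r / (k ^ 2 * s ^ 2) = (1 / s ^ 2) * (s * (1 / k ^ 2) - 1 / k)"
      unfolding s(2) using * s(1) by (simp add: field_simps power2_eq_square)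
    finally show ?thesis
      unfolding k_def[symmetric] *(1) s_def[symmetric] diff .
  qed
  have D_reflect: "(\<Sum>r=1..N. D r / real (Suc N - r)) = (harm N ^ 2 + zeta2_sum N) / 2"
  proof -
    have "(\<Sum>r=1..N. D r / real (Suc N - r)) =
       (\<Sum>r=1..N. (\<lambda>k. (harm N - harm (k - 1)) / real k) (Suc N - r))"
      by (intro sum.cong refl) (auto simp: D_def)
    also have "\<dots> = (\<Sum>k=1..N. (harm N - harm (k - 1)) / real k)"
      by (rule sum_reflect)
    finally show ?thesis by (simp only: sum_harm_diff_over)
  qed
  have "(\<Sum>r=1..Suc N. (1 / real r) * (harm (Suc N) - harm (Suc N - r)) ^ 2) =
     jump_sum N (\<lambda>r. (D r + 1 / real (Suc N) - 1 / real (Suc N - r)) ^ 2)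
       + harm (Suc N) ^ 2 / real (Suc N)"
    by (auto simp: harm_diff_Suc D_def harm_expand simp del: of_nat_Suc intro!: sum.cong)
  also have "jump_sum N (\<lambda>r. (D r + 1 / real (Suc N) - 1 / real (Suc N - r)) ^ 2) =
     jump_sum N (\<lambda>r. D r ^ 2) - (2 / real (Suc N)) * (\<Sum>r=1..N. D r / real (Suc N - r))
      + (1 / real (Suc N) ^ 2) * (real (Suc N) * (\<Sum>r=1..N. 1 / real (Suc N - r) ^ 2)
      - (\<Sum>r=1..N. 1 / real (Suc N - r)))"
    by (simp only: sum.cong[OF refl step] sum.distrib sum_subtractf sum_distrib_left right_diff_distrib)
  also have "jump_sum N (\<lambda>r. D r ^ 2) = euler_sum N"
    using Suc.IH by (simp only: D_def)
  also have "(\<Sum>r=1..N. 1 / real (Suc N - r) ^ 2) = zeta2_sum N"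
    by (rule sum_reflect)
  finally show ?case
    unfolding D_reflect sum_reciprocal_reflect
  proof -
    define c S where "c = 1 / real (Suc N)" and "S = zeta2_sum N"
    have c: "harm (Suc N) = harm N + c" "1 / real (Suc N) ^ 2 = c ^ 2" "2 / real (Suc N) = 2 * c"
      "harm (Suc N) ^ 2 / real (Suc N) = harm (Suc N) ^ 2 * c"
      "harm (Suc N) / real (Suc N) ^ 2 = harm (Suc N) * c ^ 2"
      "c ^ 2 * (real (Suc N) * S) = c * S"
      by (auto simp: harm_Suc c_def inverse_eq_divide power_divide power2_eq_square simp del: of_nat_Suc)
    assume "(\<Sum>r=1..Suc N. (1 / real r) * (harm (Suc N) - harm (Suc N - r)) ^ 2) =
      euler_sum N -
      2 / real (Suc N) * ((harm N ^ 2 + zeta2_sum N) / 2) +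
      1 / real (Suc N) ^ 2 * (real (Suc N) * zeta2_sum N - harm N) +
      harm (Suc N) ^ 2 / real (Suc N)"
    also have "\<dots> = euler_sum N - c * (harm N ^ 2 + S) + (c * S - c ^ 2 * harm N)
        + (harm N + c) ^ 2 * c"
      unfolding S_def[symmetric] c(2,3,4) right_diff_distrib c(6)
      unfolding c(1) by simp
    also have "\<dots> = euler_sum N + harm (Suc N) * c ^ 2"
      unfolding c(1) by (simp add: power2_eq_square algebra_simps)
    also have "\<dots> = euler_sum (Suc N)"
      by (simp add: c(5) del: of_nat_Suc)
    finally show ?thesis .
  qed
qed

text \<open>
  The next bounds say that, for \<open>k\<close> uniform on \<open>{1..N}\<close>, the moments of \<open>h\<^bsub>N\<^esub> - h\<^bsub>k-1\<^esub>\<close> are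
  bounded in \<open>N\<close>, as for the limiting exponential variable \<open>- log (k / N)\<close>.
\<close>
lemma sum_harm_diff: "(\<Sum>k=1..N. harm N - harm (k - 1)) = (real N :: real)"
proof (induction N)
  case (Suc N)
  have "(\<Sum>k=1..Suc N. harm (Suc N) - harm (k - 1)) =
     (\<Sum>k=1..N. (harm N - harm (k - 1)) + 1 / real (Suc N)) + 1 / real (Suc N)"
    by (auto simp: harm_Suc inverse_eq_divide simp del: of_nat_Suc intro!: sum.cong)
  moreover have "real N * (1 / real (Suc N)) + 1 / real (Suc N) = 1"
    by (simp add: field_simps)
  ultimately show ?case
    unfolding sum.distrib Suc.IH by simp
qed simp

lemma sum_harm_diff_power2: "(\<Sum>k=1..N. (harm N - harm (k - 1)) ^ 2) \<le> (2 * real N :: real)"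
proof (induction N)
  case (Suc N)
  define c where "c = 1 / real (Suc N)"
  have c: "c \<ge> 0" "c * real N + c = 1" by (auto simp: c_def field_simps)
  have "(\<Sum>k=1..Suc N. (harm (Suc N) - harm (k - 1)) ^ 2) =
     (\<Sum>k=1..N. ((harm N - harm (k - 1)) + c) ^ 2) + c ^ 2"
    by (auto simp: harm_Suc inverse_eq_divide c_def algebra_simps simp del: of_nat_Suc
          intro!: sum.cong)
  also have "\<dots> = (\<Sum>k=1..N. (harm N - harm (k - 1)) ^ 2)
      + 2 * c * (\<Sum>k=1..N. harm N - harm (k - 1)) + real N * c ^ 2 + c ^ 2"
    by (simp add: power2_sum sum.distrib sum_distrib_left mult_ac)
  also have "\<dots> \<le> 2 * real N + 2 * c * real N + (c * real N + c) * c"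
    unfolding sum_harm_diff using Suc.IH by (simp add: algebra_simps power2_eq_square)
  also have "\<dots> = 2 * real N + (2 - 2 * c) + c"
    using c(2) by (simp add: algebra_simps)
  also have "\<dots> \<le> 2 * real (Suc N)"
    using c(1) by simp
  finally show ?case .
qed simp

lemma sum_harm_diff_power3: "(\<Sum>k=1..N. (harm N - harm (k - 1)) ^ 3) \<le> (6 * real N :: real)"
proof (induction N)
  case (Suc N)
  define c where "c = 1 / real (Suc N)"
  have c: "c \<ge> 0" "c * real N = 1 - c" "c \<le> 1" by (auto simp: c_def field_simps)
  have cube: "(x + c) ^ 3 = x ^ 3 + 3 * c * x ^ 2 + 3 * c ^ 2 * x + c ^ 3" for x
    by (simp add: power3_eq_cube power2_eq_square algebra_simps)
  have "(\<Sum>k=1..Suc N. (harm (Suc N) - harm (k - 1)) ^ 3) =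
     (\<Sum>k=1..N. ((harm N - harm (k - 1)) + c) ^ 3) + c ^ 3"
    by (auto simp: harm_Suc inverse_eq_divide c_def algebra_simps simp del: of_nat_Suc
          intro!: sum.cong)
  also have "\<dots> = (\<Sum>k=1..N. (harm N - harm (k - 1)) ^ 3)
      + 3 * c * (\<Sum>k=1..N. (harm N - harm (k - 1)) ^ 2)
      + 3 * c ^ 2 * (\<Sum>k=1..N. harm N - harm (k - 1)) + real N * c ^ 3 + c ^ 3"
    unfolding cube by (simp only: sum.distrib sum_distrib_left) simp
  also have "\<dots> \<le> 6 * real N + 3 * c * (2 * real N) + 3 * c ^ 2 * real N + real N * c ^ 3 + c ^ 3"
    unfolding sum_harm_diff using Suc.IH sum_harm_diff_power2[of N] c(1)
    by (intro add_mono mult_left_mono) auto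
  also have "\<dots> = 6 * real N + 6 * (c * real N) + 3 * c * (c * real N) + (c * real N) * c ^ 2 + c ^ 3"
    by (simp add: power2_eq_square power3_eq_cube algebra_simps)
  also have "\<dots> = 6 * real N + 6 - 3 * c - 2 * c ^ 2"
    unfolding c(2) by (simp add: power2_eq_square power3_eq_cube algebra_simps)
  also have "\<dots> \<le> 6 * real (Suc N)"
    using c by (simp add: algebra_simps)
  finally show ?case .
qed simp

lemma harm_diff_nonneg: "(0::real) \<le> harm N - harm (N - r)"
  by (simp add: harm_mono)

lemma harm_diff_le: "r \<le> N \<Longrightarrow> harm N - harm (N - r) \<le> real r / real (Suc N - r)"
proof (induction r)
  case (Suc r)
  have "harm (N - r) = harm (N - Suc r) + 1 / real (Suc (N - Suc r))"
    using Suc.prems by (metis Suc_diff_Suc Suc_le_lessD harm_Suc inverse_eq_divide)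
  then have "harm N - harm (N - Suc r) = harm N - harm (N - r) + 1 / real (Suc N - Suc r)"
    using Suc.prems by (simp add: Suc_diff_Suc)
  also have "\<dots> \<le> real r / real (Suc N - r) + 1 / real (Suc N - Suc r)"
    using Suc by simp
  also have "\<dots> \<le> real r / real (Suc N - Suc r) + 1 / real (Suc N - Suc r)"
    using Suc.prems by (intro add_mono divide_left_mono mult_pos_pos) auto
  also have "\<dots> = real (Suc r) / real (Suc N - Suc r)"
    by (simp add: add_divide_distrib)
  finally show ?case .
qed simp

text \<open>
  Split \<open>1 / r = 1 / (N + 1) + (N + 1 - r) / (r (N + 1))\<close>. Together with
  \<open>gap N r \<le> r / (N + 1 - r)\<close> this replaces the rates \<open>1 / r\<close> by the uniform weights
  \<open>1 / (N + 1)\<close>, at the price of one moment less.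
\<close>
lemma jump_moment_le:
  "jump_sum N (\<lambda>r. gap N r ^ Suc p) \<le>
   ((\<Sum>k=1..N. (harm N - harm (k - 1)) ^ Suc p) + (\<Sum>k=1..N. (harm N - harm (k - 1)) ^ p)) / real (Suc N)"
proof -
  have "(1 / real r) * gap N r ^ Suc p \<le>
     (gap N r ^ Suc p + gap N r ^ p) / real (Suc N)"
    if r: "r \<in> {1..N}" for r
  proof -
    define D where "D = (harm N - harm (N - r) :: real)"
    define k where "k = real (Suc N - r)"
    have k: "k > 0" "real r > 0" "real (Suc N) = real r + k" using r by (auto simp: k_def)
    have "D \<ge> 0" "D \<le> real r / k"
      using harm_diff_nonneg[of N r] harm_diff_le[of r N] r by (auto simp: D_def k_def)
    then have "D * k \<le> real r" using k by (simp add: field_simps)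
    then have "D ^ p * (D * (real r + k)) \<le> D ^ p * (D * real r + real r)"
      using \<open>D \<ge> 0\<close> by (intro mult_left_mono) (auto simp: algebra_simps)
    then have "(1 / real r) * D ^ Suc p \<le> (D ^ Suc p + D ^ p) / (real r + k)"
      using k by (simp add: field_simps)
    then show ?thesis by (simp only: D_def k(3))
  qed
  then have "jump_sum N (\<lambda>r. gap N r ^ Suc p) \<le>
     (\<Sum>r=1..N. (gap N r ^ Suc p + gap N r ^ p) / real (Suc N))"
    by (intro sum_mono)
  also have "\<dots> = ((\<Sum>r=1..N. gap N r ^ Suc p) + (\<Sum>r=1..N. gap N r ^ p)) / real (Suc N)"
    by (simp only: sum.distrib sum_divide_distrib[symmetric])
  also have pow: "(\<Sum>r=1..N. gap N r ^ q) = (\<Sum>k=1..N. (harm N - harm (k - 1)) ^ q :: real)" for q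
    using sum_reflect[of "\<lambda>k. (harm N - harm (k - 1)) ^ q" N] by simp
  finally show ?thesis unfolding pow .
qed

lemma jump_second_moment_le: "jump_sum N (\<lambda>r. gap N r ^ 2) \<le> (3::real)"
proof -
  have "jump_sum N (\<lambda>r. gap N r ^ Suc 1) \<le> (2 * real N + real N) / real (Suc N)"
    by (rule order_trans[OF jump_moment_le divide_right_mono[OF add_mono]])
       (use sum_harm_diff_power2[of N] in \<open>simp_all only: power_one_right sum_harm_diff Suc_1 of_nat_0_le_iff order_refl\<close>)
  also have "\<dots> \<le> 3" by (simp add: divide_simps)
  finally show ?thesis by (simp only: numeral_2_eq_2 One_nat_def)
qed

lemma jump_third_moment_le: "jump_sum N (\<lambda>r. gap N r ^ 3) \<le> (8::real)"
proof -
  have "jump_sum N (\<lambda>r. gap N r ^ Suc 2) \<le> (6 * real N + 2 * real N) / real (Suc N)"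
    by (rule order_trans[OF jump_moment_le divide_right_mono[OF add_mono]])
       (use sum_harm_diff_power2[of N] sum_harm_diff_power3[of N] in
         \<open>simp_all only: numeral_3_eq_3 numeral_2_eq_2 of_nat_0_le_iff\<close>)
  also have "\<dots> \<le> 8" by (simp add: divide_simps)
  finally show ?thesis by (simp only: numeral_3_eq_3 numeral_2_eq_2)
qed

lemma zeta_sums:
  assumes "p \<ge> 2"
  shows "(\<lambda>N. \<Sum>k=1..N. 1 / real k ^ p) \<longlonglongrightarrow> zeta (real p)"
proof -
  have eq: "(\<lambda>n. real (Suc n) powr (- real p)) = (\<lambda>n. 1 / real (Suc n) ^ p)"
    by (simp add: powr_minus powr_realpow inverse_eq_divide del: of_nat_Suc)
  have "summable (\<lambda>n. inverse (real (Suc n) ^ p))"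
    using inverse_power_summable[OF assms, where ?'a=real] summable_Suc_iff[of "\<lambda>n. inverse (real n ^ p)"]
    by simp
  then have "(\<lambda>n. 1 / real (Suc n) ^ p) sums zeta (real p)"
    unfolding zeta_def eq by (simp add: summable_sums inverse_eq_divide)
  moreover have "(\<Sum>n<N. 1 / real (Suc n) ^ p) = (\<Sum>k=1..N. 1 / real k ^ p)" for N
    by (rule sum.reindex_bij_witness[of _ "\<lambda>k. k - 1" Suc]) auto
  ultimately show ?thesis by (simp add: sums_def)
qed

text \<open>
  The bound \<open>2 / (N + 1)\<close> is of the form \<open>h\<^bsub>N\<^esub> / (N + 1)\<close> up to a constant, which is how the
  error of the first moment will be absorbed.
\<close>
lemma zeta_tail:
  assumes "N \<ge> 1"
  shows "\<bar>zeta2_sum N - zeta 2\<bar> \<le> 2 / real (Suc N)"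
proof -
  define S where "S N = zeta2_sum N" for N
  have lim: "S \<longlonglongrightarrow> zeta 2" using zeta_sums[of 2] by (simp add: S_def[abs_def])
  have "incseq S" by (rule incseq_SucI) (simp add: S_def)
  then have 1: "S N \<le> zeta 2" using incseq_le lim by blast
  have step: "S (Suc n) + 1 / real (Suc n) \<le> S n + 1 / real n" if "n \<ge> 1" for n
  proof -
    have "1 / real (Suc n) ^ 2 \<le> 1 / (real n * real (Suc n))"
      using that by (intro divide_left_mono) (auto simp: power2_eq_square)
    also have "\<dots> = 1 / real n - 1 / real (Suc n)" using that by (simp add: field_simps)
    finally show ?thesis by (simp add: S_def del: of_nat_Suc)
  qed
  have le: "S (N + m) + 1 / real (N + m) \<le> S N + 1 / real N" for m
  proof (induction m)
    case (Suc m)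
    then show ?case using step[of "N + m"] assms by (auto simp del: of_nat_Suc)
  qed simp
  have "S (N + m) \<le> S N + 1 / real N" for m
    using le[of m] by (smt (verit) divide_nonneg_nonneg of_nat_0_le_iff)
  moreover have "(\<lambda>m. S (N + m)) \<longlonglongrightarrow> zeta 2"
    using LIMSEQ_ignore_initial_segment[OF lim, of N] by (simp add: add.commute)
  ultimately have "zeta 2 \<le> S N + 1 / real N" by (intro LIMSEQ_le_const2) auto
  also have "1 / real N \<le> 2 / real (Suc N)" using assms by (simp add: field_simps)
  finally show ?thesis using 1 by (simp add: S_def)
qed

lemma euler_sum_converges:
  obtains E where "(\<lambda>N. \<Sum>k=1..N. harm k / real k ^ 2) \<longlonglongrightarrow> (E::real)"
proof -
  have "incseq (\<lambda>N. \<Sum>k=1..N. harm k / real k ^ 2 :: real)"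
    by (rule incseq_SucI) (simp add: harm_nonneg)
  moreover have "euler_sum N \<le> 3" for N
    using jump_second_moment_le[of N] by (simp only: jump_second_moment)
  ultimately show ?thesis
    using incseq_convergent that by blast
qed

lemma sum_reciprocal_shifted:
  assumes "k \<ge> 1"
  shows "(\<Sum>r=1..N. 1 / (real r * real k * real (r + k))) = (harm N - (harm (N + k) - harm k)) / real k ^ 2"
proof -
  have "(\<Sum>r=1..N. 1 / (real r * real k * real (r + k))) =
     (\<Sum>r=1..N. (1 / real k ^ 2) * (1 / real r - 1 / real (r + k)))"
    using assms by (intro sum.cong refl) (auto simp: field_simps power2_eq_square)
  also have "\<dots> = (harm N - (\<Sum>r=1..N. 1 / real (r + k))) / real k ^ 2"
    unfolding sum_distrib_left[symmetric] sum_subtractf sum_reciprocal by simp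
  also have "(\<Sum>r=1..N. 1 / real (r + k)) = harm (N + k) - harm k"
    by (induction N) (auto simp: harm_Suc inverse_eq_divide add_ac)
  finally show ?thesis .
qed

text \<open>
  Euler's evaluation. The double series of \<open>1 / (r k (r + k))\<close> is summed over squares, which gives
  the left-hand side \<open>E\<close>, and over triangles \<open>r + k \<le> N + 1\<close>, which gives
  \<open>2 (E - \<zeta>(3))\<close>; squares and triangles interlace, so both values agree.
\<close>
lemma euler_sum_limit:
  "(\<lambda>N. \<Sum>k=1..N. harm k / real k ^ 2) \<longlonglongrightarrow> 2 * zeta 3"
proof -
  obtain E where E: "(\<lambda>N. \<Sum>k=1..N. harm k / real k ^ 2) \<longlonglongrightarrow> (E::real)"
    by (rule euler_sum_converges)
  define f where "f = (\<lambda>(k, r). 1 / (real r * real k * real (r + k)))"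
  define P where "P N = sum f ({1..N} \<times> {1..N})" for N
  define A where "A N = (SIGMA n:{1..N}. {1..n})" for N :: nat
  define tri where "tri = (\<lambda>(n, r). (Suc n - r, r :: nat))"
  define Q where "Q N = sum f (tri ` A N)" for N
  have inj: "inj_on tri (A N)" for N
    by (auto simp: inj_on_def tri_def A_def)
  have Q_eq: "Q N = 2 * (euler_sum (Suc N) - (\<Sum>k=1..Suc N. 1 / real k ^ 3))" for N
  proof -
    have "Q N = (\<Sum>(n, r)\<in>A N. 1 / real (Suc n) * (1 / (real r * real (Suc n - r))))"
      unfolding Q_def sum.reindex[OF inj] by (intro sum.cong) (auto simp: f_def tri_def A_def mult_ac)
    also have "\<dots> = (\<Sum>n=1..N. \<Sum>r=1..n. 1 / real (Suc n) * (1 / (real r * real (Suc n - r))))"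
      unfolding A_def by (rule sum.Sigma[symmetric]) auto
    also have "\<dots> = (\<Sum>n=1..N. 2 * (harm n / real (Suc n) ^ 2))"
      unfolding sum_distrib_left[symmetric] sum_reciprocal_product
      by (simp add: power2_eq_square sum_distrib_left)
    also have "\<dots> = 2 * (\<Sum>n=1..N. harm n / real (Suc n) ^ 2)"
      by (rule sum_distrib_left[symmetric])
    also have "(\<Sum>n=1..N. harm n / real (Suc n) ^ 2) =
        euler_sum (Suc N) - (\<Sum>k=1..Suc N. 1 / real k ^ 3)"
    proof (induction N)
      case (Suc N)
      have "harm (Suc (Suc N)) / real (Suc (Suc N)) ^ 2 - 1 / real (Suc (Suc N)) ^ 3
         = harm (Suc N) / real (Suc (Suc N)) ^ 2"
        by (simp add: harm_Suc[of "Suc N"] add_divide_distrib inverse_eq_divide power3_eq_cube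
              power2_eq_square del: of_nat_Suc)
      then show ?case using Suc by simp
    qed (simp add: harm_expand)
    finally show ?thesis .
  qed
  have Q_lim: "Q \<longlonglongrightarrow> 2 * (E - zeta 3)"
    unfolding Q_eq[abs_def] using LIMSEQ_Suc[OF E] LIMSEQ_Suc[OF zeta_sums[of 3]]
    by (auto intro!: tendsto_intros simp del: sum.cl_ivl_Suc)
  have f_nonneg: "f x \<ge> 0" for x by (auto simp: f_def split: prod.split)
  have "Q N \<le> P N" for N
    unfolding Q_def P_def by (rule sum_mono2) (auto simp: f_nonneg tri_def A_def)
  moreover have "P N \<le> Q (2 * N)" for N
    unfolding Q_def P_def
  proof (rule sum_mono2)
    show "{1..N} \<times> {1..N} \<subseteq> tri ` A (2 * N)"
    proof
      fix x assume "x \<in> {1..N} \<times> {1..N}"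
      then show "x \<in> tri ` A (2 * N)"
        by (intro image_eqI[of _ _ "(fst x + snd x - 1, snd x)"]) (auto simp: tri_def A_def)
    qed
  qed (auto simp: f_nonneg A_def)
  moreover have "(\<lambda>N. Q (2 * N)) \<longlonglongrightarrow> 2 * (E - zeta 3)"
    using LIMSEQ_subseq_LIMSEQ[OF Q_lim, of "\<lambda>n. 2 * n"] by (simp add: strict_mono_def o_def)
  ultimately have P_lim: "P \<longlonglongrightarrow> 2 * (E - zeta 3)"
    using Q_lim by (intro tendsto_sandwich[of Q P sequentially "\<lambda>N. Q (2 * N)"]) auto
  have P_eq: "P N = euler_sum N - (\<Sum>k=1..N. (harm (N + k) - harm N) / real k ^ 2)" for N
  proof -
    have "P N = (\<Sum>k=1..N. \<Sum>r=1..N. 1 / (real r * real k * real (r + k)))"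
      unfolding P_def f_def by (simp add: sum.cartesian_product)
    also have "\<dots> = (\<Sum>k=1..N. harm k / real k ^ 2 - (harm (N + k) - harm N) / real k ^ 2)"
      by (intro sum.cong refl) (simp add: sum_reciprocal_shifted[simplified] diff_divide_distrib)
    finally show ?thesis by (simp only: sum_subtractf)
  qed
  have rest: "(\<lambda>N. \<Sum>k=1..N. (harm (N + k) - harm N) / real k ^ 2 :: real) \<longlonglongrightarrow> 0"
  proof (rule tendsto_sandwich[of "\<lambda>_. 0"])
    show "\<forall>\<^sub>F N in sequentially. (0::real) \<le> (\<Sum>k=1..N. (harm (N + k) - harm N) / real k ^ 2)"
      by (intro always_eventually allI sum_nonneg divide_nonneg_nonneg) (auto simp: harm_mono)
    have le: "harm (N + k) - harm N \<le> real k / real N" if "N \<ge> 1" for N k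
    proof (induction k)
      case (Suc k)
      have "1 / real (Suc (N + k)) \<le> 1 / real N" using that by (intro divide_left_mono) auto
      then show ?case using Suc by (simp add: harm_Suc add_divide_distrib inverse_eq_divide)
    qed simp
    have "(\<Sum>k=1..N. (harm (N + k) - harm N) / real k ^ 2) \<le> harm N / real N" if "N \<ge> 1" for N
    proof -
      have "(\<Sum>k=1..N. (harm (N + k) - harm N) / real k ^ 2) \<le> (\<Sum>k=1..N. (real k / real N) / real k ^ 2)"
        using le[OF that] by (intro sum_mono divide_right_mono) auto
      also have "\<dots> = (\<Sum>k=1..N. 1 / real k) / real N"
        unfolding sum_divide_distrib by (intro sum.cong) (auto simp: power2_eq_square)
      finally show ?thesis by (simp only: sum_reciprocal)
    qed
    then show "\<forall>\<^sub>F N in sequentially. (\<Sum>k=1..N. (harm (N + k) - harm N) / real k ^ 2) \<le> harm N / real N"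
      by (rule eventually_sequentiallyI)
    have "(\<lambda>N. (harm N - ln (real N)) * (1 / real N) + ln (real N) / real N) \<longlonglongrightarrow> euler_mascheroni * 0 + (0::real)"
      by (intro tendsto_add tendsto_mult euler_mascheroni_LIMSEQ lim_1_over_n) (real_asymp)
    then show "(\<lambda>N. harm N / real N) \<longlonglongrightarrow> (0::real)"
      by (simp add: diff_divide_distrib)
  qed simp
  have "P \<longlonglongrightarrow> E - 0"
    unfolding P_eq[abs_def] by (intro tendsto_diff E rest)
  then have "E - 0 = 2 * (E - zeta 3)" using P_lim by (rule LIMSEQ_unique)
  then show ?thesis using E by simp
qed

section \<open>A comparison principle for the jump chain\<close>

text \<open>
  The right-hand side \<open>a h\<^bsub>N\<^esub> + b (1 - 1 / (N + 1))\<close> is a supersolution: under the chain its first part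
  decreases at rate at least \<open>a\<close> and its second part at rate \<open>b h\<^bsub>N\<^esub> / (N + 1)\<close>. Probabilistically,
  \<open>h\<^bsub>n\<^esub>\<close> bounds the expected duration of a path.
\<close>
lemma jump_comparison:
  fixes e :: "nat \<Rightarrow> real"
  assumes e0: "e 0 \<le> 0" and ab: "a \<ge> 0" "b \<ge> 0"
    and le: "\<And>N. 1 \<le> N \<Longrightarrow> N \<le> n \<Longrightarrow>
      harm N * e N \<le> jump_sum N (\<lambda>r. e (N - r)) + a + b * (harm N / real (Suc N))"
  shows "e n \<le> a * harm n + b"
proof -
  define \<psi> where "\<psi> N = a * harm N + b * (1 - 1 / real (Suc N))" for N
  have "e N \<le> \<psi> N" if "N \<le> n" for N
    using that
  proof (induction N rule: less_induct)
    case (less N)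
    show ?case
    proof (cases "N = 0")
      case True
      then show ?thesis using e0 by (simp add: \<psi>_def harm_expand)
    next
      case False
      have "jump_sum N (\<lambda>r. \<psi> N - \<psi> (N - r)) =
        a * jump_sum N (gap N)
        + b * jump_sum N (\<lambda>r. 1 / real (Suc N - r) - 1 / real (Suc N))"
        unfolding sum_distrib_left sum.distrib[symmetric]
        by (intro sum.cong refl) (auto simp: \<psi>_def Suc_diff_le algebra_simps)
      also have "\<dots> = a * zeta2_sum N + b * (harm N / real (Suc N))"
        by (simp only: jump_first_moment jump_sum_reciprocal)
      also have "\<dots> \<ge> a + b * (harm N / real (Suc N))"
      proof -
        have "zeta2_sum N \<ge> (\<Sum>k\<in>{1}. 1 / real k ^ 2)"
          using False by (intro sum_mono2) auto
        then show ?thesis using ab mult_left_mono[of 1 "\<Sum>k=1..N. 1 / real k ^ 2" a] by simp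
      qed
      finally have \<psi>: "a + b * (harm N / real (Suc N)) \<le> jump_sum N (\<lambda>r. \<psi> N - \<psi> (N - r))" .
      have "harm N * e N \<le> jump_sum N (\<lambda>r. e (N - r)) + a + b * (harm N / real (Suc N))"
        using le[of N] less.prems False by simp
      also have "\<dots> \<le> jump_sum N (\<lambda>r. \<psi> (N - r)) + jump_sum N (\<lambda>r. \<psi> N - \<psi> (N - r))"
        unfolding add.assoc
        using less.IH less.prems False by (intro add_mono sum_mono mult_left_mono \<psi>) auto
      also have "\<dots> = jump_sum N (\<lambda>r. \<psi> N)"
        unfolding sum.distrib[symmetric] by (intro sum.cong refl) (simp add: algebra_simps diff_divide_distrib)
      also have "\<dots> = harm N * \<psi> N"
        unfolding sum_distrib_right[symmetric] sum_reciprocal ..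
      finally show ?thesis
        using harm_pos[of N, where ?'a=real] False by simp
    qed
  qed
  from this[of n] have "e n \<le> a * harm n + b * (1 - 1 / real (Suc n))" by (simp add: \<psi>_def)
  also have "\<dots> \<le> a * harm n + b" using ab by (simp add: mult_left_le field_simps)
  finally show ?thesis .
qed

section \<open>The approximate solution of the recursion\<close>
lemma norm_exp_second_order:
  assumes "0 \<le> Re z"
  shows "norm (exp z - 1 - z - z ^ 2 / 2) \<le> exp (Re z) * norm z ^ 3 / 2"
proof -
  have "(\<Sum>k\<le>2. z ^ k / fact k) = 1 + z + z ^ 2 / 2"
    by (simp add: numeral_2_eq_2)
  then show ?thesis
    using Taylor_exp[of z 2] assms by (simp add: algebra_simps eval_nat_numeral)
qed

lemma power3_add_le: "a \<ge> 0 \<Longrightarrow> b \<ge> 0 \<Longrightarrow> (a + b) ^ 3 \<le> 4 * (a ^ 3 + b ^ 3)" for a b :: real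
proof -
  assume ab: "a \<ge> 0" "b \<ge> 0"
  have "4 * (a ^ 3 + b ^ 3) - (a + b) ^ 3 = 3 * (a + b) * (a - b) ^ 2"
    by (simp add: power3_eq_cube power2_eq_square algebra_simps)
  also have "\<dots> \<ge> 0" using ab by simp
  finally show ?thesis by simp
qed

lemma zeta_ge_1:
  assumes "p \<ge> 2"
  shows "zeta (real p) \<ge> 1"
proof (rule LIMSEQ_le_const[OF zeta_sums[OF assms]])
  have "(\<Sum>k=1..N. 1 / real k ^ p) \<ge> (\<Sum>k\<in>{1}. 1 / real k ^ p)" if "N \<ge> 1" for N :: nat
    using that by (intro sum_mono2) auto
  then show "\<exists>N. \<forall>n\<ge>N. 1 \<le> (\<Sum>k=1..n. 1 / real k ^ p)" by (intro exI[of _ 1]) auto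
qed

lemma zeta_2_ge_1: "zeta 2 \<ge> 1" and zeta_3_ge_1: "zeta 3 \<ge> 1"
  using zeta_ge_1[of 2] zeta_ge_1[of 3] by simp_all

lemma zeta_3_ge_0: "zeta 3 \<ge> 0"
  using zeta_3_ge_1 by simp

lemma zeta_3_le_2: "zeta 3 \<le> 2"
proof -
  have "2 * zeta 3 \<le> 3"
    using jump_second_moment_le unfolding jump_second_moment
    by (intro LIMSEQ_le_const2[OF euler_sum_limit]) auto
  then show ?thesis by simp
qed

lemma zeta_2_sum_le: "zeta2_sum N \<le> zeta 2"
  using zeta_sums[of 2] by (intro incseq_le) (auto intro!: incseq_SucI)

text \<open>
  The logarithm of the approximate characteristic function as a function of \<open>x = h\<^bsub>N\<^esub>\<close>, for the
  frequency \<open>s\<close> of the number of jumps. The frequencies \<open>d\<close> of the duration and \<open>t r\<close> of the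
  jumps of size \<open>r\<close> enter through \<open>\<kappa> = d + \<Sum> t r / r\<close> and \<open>v = \<Sum> (t r)\<^sup>2 / r\<close>. The cubic
  polynomial in brackets is the integral of \<open>(s u + \<kappa>)\<^sup>2\<close> over \<open>u \<in> [0, x]\<close>.
\<close>
definition limit_exponent :: "real \<Rightarrow> real \<Rightarrow> real \<Rightarrow> real \<Rightarrow> complex" where
  "limit_exponent s \<kappa> v x =
     \<i> * of_real ((s * x ^ 2 / 2 + \<kappa> * x) / zeta 2)
     - of_real (v * x / (2 * zeta 2)
         + zeta 3 / zeta 2 ^ 3 * (s ^ 2 * x ^ 3 / 3 + s * \<kappa> * x ^ 2 + \<kappa> ^ 2 * x))"

lemma zeta_2_le_2: "zeta 2 \<le> 2"
  using zeta_tail[of 1] by simp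

text \<open>
  The scaling regime: \<open>\<eta>\<close> stands for \<open>(log n)\<^sup>-\<^sup>1\<^sup>/\<^sup>2\<close> and \<open>X\<close> for the initial value \<open>h\<^bsub>n-1\<^esub>\<close>, of
  order \<open>\<eta>\<^sup>-\<^sup>2\<close>. A path lasts for a time of order \<open>\<eta>\<^sup>-\<^sup>2\<close>, so errors of order \<open>\<eta>\<^sup>3\<close> in the recursion
  are negligible and those of order \<open>\<eta>\<^sup>2\<close> are not.
\<close>
locale small_frequencies =
  fixes s d :: real and t :: "nat \<Rightarrow> real" and j :: nat and A \<eta> X :: real
  fixes \<kappa> v :: real
  defines "\<kappa> \<equiv> d + (\<Sum>r=1..j. t r / real r)" and "v \<equiv> (\<Sum>r=1..j. t r ^ 2 / real r)"
  assumes A: "1 \<le> A" and eta: "0 < \<eta>" "\<eta> \<le> 1"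
    and s_le: "\<bar>s\<bar> \<le> A * \<eta> ^ 3" and sX_le: "\<bar>s\<bar> * X \<le> A * \<eta>"
    and kappa_le: "\<bar>\<kappa>\<bar> \<le> A * \<eta>" and t_le: "\<And>r. r \<in> {1..j} \<Longrightarrow> \<bar>t r\<bar> \<le> A * \<eta>"
begin

text \<open>
  \<open>p\<close> is the derivative of the exponent \<open>\<Phi>\<close>, \<open>rem\<close> is the remainder of the first-order
  expansion of \<open>\<Phi>\<close>, and \<open>B\<close> is a common bound for all coefficients.
\<close>
definition tt :: "nat \<Rightarrow> real" where "tt r = (if r \<in> {1..j} then t r else 0)"
definition c :: real where "c = 1 / zeta 2"
definition e :: real where "e = zeta 3 / zeta 2 ^ 3"
definition q :: "real \<Rightarrow> real" where "q x = s * x + \<kappa>"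
definition g :: "real \<Rightarrow> real" where "g x = v * c / 2 + e * q x ^ 2"
definition p :: "real \<Rightarrow> complex" where "p x = \<i> * of_real (q x * c) - of_real (g x)"
definition B :: real where "B = 16 * (real j + 1) * A ^ 2"
definition rem :: "real \<Rightarrow> real \<Rightarrow> complex" where
  "rem x D = \<i> * of_real (s * D ^ 2 * c / 2)
     - of_real (e * (q x * s * D ^ 2 - s ^ 2 * D ^ 3 / 3))"
abbreviation "\<Phi> \<equiv> limit_exponent s \<kappa> v"

lemma c: "0 \<le> c" "c \<le> 1" "c * zeta 2 = 1"
  using zeta_2_ge_1 by (auto simp: c_def)

lemma e: "0 \<le> e" "e \<le> 2" "e * zeta 2 = zeta 3 * c ^ 2"
proof -
  have *: "1 \<le> zeta 2 ^ 3" using zeta_2_ge_1 by simp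
  show "0 \<le> e" unfolding e_def using zeta_3_ge_0 * by (intro divide_nonneg_nonneg) linarith+
  have "zeta 3 / zeta 2 ^ 3 \<le> zeta 3 / 1"
    by (rule divide_left_mono) (use zeta_3_ge_0 * in linarith)+
  then show "e \<le> 2" using zeta_3_le_2 by (simp add: e_def)
  show "e * zeta 2 = zeta 3 * c ^ 2"
    using zeta_2_ge_1 by (simp add: e_def c_def power2_eq_square power3_eq_cube)
qed

lemma Re_\<Phi>: "Re (\<Phi> x) = - (v * x * c / 2 + e * (s ^ 2 * x ^ 3 / 3 + s * \<kappa> * x ^ 2 + \<kappa> ^ 2 * x))"
  by (simp add: limit_exponent_def c_def e_def)

lemma Im_\<Phi>: "Im (\<Phi> x) = (s * x ^ 2 / 2 + \<kappa> * x) * c"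
  by (simp add: limit_exponent_def c_def)

lemma v_nonneg: "0 \<le> v" by (auto simp: v_def intro!: sum_nonneg)

lemma A_power: "A \<le> A ^ 2" "1 \<le> A ^ 2"
  using A mult_mono[of 1 A 1 A] by (auto simp: power2_eq_square)

lemma eta_powers: "\<eta> ^ 2 \<le> \<eta>" "\<eta> ^ 3 \<le> \<eta>" "\<eta> ^ 4 \<le> \<eta> ^ 3" "\<eta> ^ 3 \<le> 1" "\<eta> ^ 2 \<le> 1"
  using eta power_decreasing[of 1 2 \<eta>] power_decreasing[of 1 3 \<eta>] power_decreasing[of 3 4 \<eta>]
  by (auto simp: power_le_one)

lemma increment:
  "\<Phi> (x - D) - \<Phi> x = - p x * of_real D + rem x D"
  by (rule complex_eqI)
     (simp_all add: Re_\<Phi> Im_\<Phi> p_def rem_def g_def q_def algebra_simps power2_eq_square power3_eq_cube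
        diff_divide_distrib add_divide_distrib)

text \<open>
  The modulus of \<open>exp \<circ> \<Phi>\<close> decreases from its value \<open>1\<close> at \<open>0\<close>. Hence the factor
  \<open>exp (Re z)\<close> in the Taylor remainder, where \<open>z\<close> is an increment of \<open>\<Phi>\<close>, is always compensated
  by \<open>exp (\<Phi> x)\<close>, however long the jump is.
\<close>
lemma Re_increment_nonneg:
  assumes "0 \<le> D"
  shows "0 \<le> Re (\<Phi> (x - D) - \<Phi> x)"
proof -
  have "Re (\<Phi> (x - D) - \<Phi> x) = v * D * c / 2
      + e * (D * ((q x - s * D / 2) ^ 2 + (s * D) ^ 2 / 12))"
    by (simp add: Re_\<Phi> q_def algebra_simps power2_eq_square power3_eq_cube
          diff_divide_distrib add_divide_distrib)
  also have "\<dots> \<ge> 0"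
    using assms v_nonneg c(1) e(1) by simp
  finally show ?thesis .
qed

lemma \<Phi>_0: "\<Phi> 0 = 0"
  by (simp add: limit_exponent_def)

lemma Re_\<Phi>_nonpos: "0 \<le> x \<Longrightarrow> Re (\<Phi> x) \<le> 0"
  using Re_increment_nonneg[of x x] by (simp add: \<Phi>_0)

lemma q_le: "0 \<le> x \<Longrightarrow> x \<le> X \<Longrightarrow> \<bar>q x\<bar> \<le> 2 * A * \<eta>"
proof -
  assume x: "0 \<le> x" "x \<le> X"
  have "\<bar>q x\<bar> \<le> \<bar>s\<bar> * x + \<bar>\<kappa>\<bar>"
    using x abs_triangle_ineq[of "s * x" \<kappa>] by (simp add: q_def abs_mult)
  also have "\<bar>s\<bar> * x \<le> \<bar>s\<bar> * X" using x by (intro mult_left_mono) auto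
  finally show ?thesis using sX_le kappa_le by simp
qed

lemma v_le: "v \<le> real j * A ^ 2 * \<eta> ^ 2"
proof -
  have "t r ^ 2 / real r \<le> A ^ 2 * \<eta> ^ 2" if "r \<in> {1..j}" for r
  proof -
    have "t r ^ 2 / real r \<le> t r ^ 2 / 1" using that by (intro divide_left_mono) auto
    also have "\<dots> \<le> (A * \<eta>) ^ 2" using power_mono[OF t_le[OF that], of 2] by simp
    finally show ?thesis by (simp add: power_mult_distrib)
  qed
  then have "v \<le> (\<Sum>r=1..j. A ^ 2 * \<eta> ^ 2)" unfolding v_def by (intro sum_mono)
  then show ?thesis by simp
qed

lemma B_ge: "A \<le> B" "1 \<le> B" "0 \<le> B"
proof -
  have "A ^ 2 * 1 \<le> A ^ 2 * (16 * (real j + 1))" by (intro mult_left_mono) auto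
  then have "A ^ 2 \<le> B" by (simp add: B_def mult_ac)
  then show "A \<le> B" "1 \<le> B" "0 \<le> B" using A_power by linarith+
qed

lemma g_le: "0 \<le> x \<Longrightarrow> x \<le> X \<Longrightarrow> 0 \<le> g x \<and> g x \<le> (real j / 2 + 8) * A ^ 2 * \<eta> ^ 2"
proof
  assume x: "0 \<le> x" "x \<le> X"
  show "0 \<le> g x" using v_nonneg c(1) e(1) by (simp add: g_def)
  have "q x ^ 2 \<le> (2 * A * \<eta>) ^ 2" using power_mono[OF q_le[OF x], of 2] by simp
  then have "e * q x ^ 2 \<le> 2 * (2 * A * \<eta>) ^ 2"
    using e(1,2) by (intro mult_mono) auto
  moreover have "v * c \<le> v"
    using v_nonneg c by (intro mult_left_le) auto
  ultimately show "g x \<le> (real j / 2 + 8) * A ^ 2 * \<eta> ^ 2"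
    using v_le by (simp add: g_def power_mult_distrib algebra_simps)
qed

lemma g_le_B: "0 \<le> x \<Longrightarrow> x \<le> X \<Longrightarrow> g x \<le> B * \<eta> ^ 2"
proof -
  assume x: "0 \<le> x" "x \<le> X"
  have "(real j / 2 + 8) * (A ^ 2 * \<eta> ^ 2) \<le> (16 * (real j + 1)) * (A ^ 2 * \<eta> ^ 2)"
    by (intro mult_right_mono) auto
  then show ?thesis using g_le[OF x] by (simp add: B_def mult_ac)
qed

lemma qc_le: "0 \<le> x \<Longrightarrow> x \<le> X \<Longrightarrow> \<bar>q x * c\<bar> \<le> 2 * A * \<eta>"
proof -
  assume x: "0 \<le> x" "x \<le> X"
  have "\<bar>q x * c\<bar> \<le> \<bar>q x\<bar>" using c(1,2) by (simp add: abs_mult mult_left_le)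
  then show ?thesis using q_le[OF x] by simp
qed

lemma p_le: "0 \<le> x \<Longrightarrow> x \<le> X \<Longrightarrow> norm (p x) \<le> B * \<eta>"
proof -
  assume x: "0 \<le> x" "x \<le> X"
  have "norm (p x) \<le> norm (\<i> * of_real (q x * c)) + norm (of_real (g x) :: complex)"
    unfolding p_def by (rule norm_triangle_ineq4)
  also have "\<dots> = \<bar>q x * c\<bar> + \<bar>g x\<bar>" by (simp only: norm_mult norm_of_real norm_ii mult_1_left)
  also have "\<dots> \<le> 2 * A * \<eta> + (real j / 2 + 8) * A ^ 2 * \<eta> ^ 2"
    using qc_le[OF x] g_le[OF x] by simp
  also have "\<dots> \<le> 2 * A ^ 2 * \<eta> + (real j / 2 + 8) * A ^ 2 * \<eta>"
    using A_power eta_powers(1) eta(1) by (intro add_mono mult_right_mono mult_left_mono) auto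
  also have "\<dots> = (real j / 2 + 10) * (A ^ 2 * \<eta>)" by (simp add: algebra_simps)
  also have "\<dots> \<le> (16 * (real j + 1)) * (A ^ 2 * \<eta>)" using eta by (intro mult_right_mono) auto
  finally show ?thesis by (simp add: B_def mult_ac)
qed

text \<open>
  Both bounds are needed: the first is of order \<open>\<eta>\<^sup>3\<close>, the second makes \<open>rem\<close> comparable to the
  linear term \<open>p x D\<close> for long jumps.
\<close>
lemma rem_le:
  assumes x: "0 \<le> x" "x \<le> X" and D: "0 \<le> D" "D \<le> x"
  shows "norm (rem x D) \<le> B * \<eta> ^ 3 * D ^ 2" "norm (rem x D) \<le> B * \<eta> * D"
proof -
  have "\<bar>s\<bar> * D \<le> \<bar>s\<bar> * X" using D x by (intro mult_left_mono) auto
  then have sD: "\<bar>s\<bar> * D \<le> A * \<eta>" using sX_le by linarith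
  have eq: "q x * s * D ^ 2 - s ^ 2 * D ^ 3 / 3 = (s * D ^ 2) * (q x - s * D / 3)"
    by (simp add: power2_eq_square power3_eq_cube algebra_simps)
  have "\<bar>q x - s * D / 3\<bar> \<le> \<bar>q x\<bar> + \<bar>s\<bar> * D / 3"
    using abs_triangle_ineq4[of "q x" "s * D / 3"] D by (simp add: abs_mult)
  also have "\<dots> \<le> (7/3) * (A * \<eta>)" using q_le[OF x] sD by simp
  also have "\<dots> \<le> (7/3) * A" using A eta by (simp add: mult_left_le)
  finally have qs: "\<bar>q x - s * D / 3\<bar> \<le> (7/3) * A" .
  have "norm (rem x D) \<le> norm (\<i> * of_real (s * D ^ 2 * c / 2))
      + norm (of_real (e * ((s * D ^ 2) * (q x - s * D / 3))) :: complex)"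
    unfolding rem_def eq by (rule norm_triangle_ineq4)
  also have "\<dots> = (\<bar>s\<bar> * D ^ 2 / 2) * c + e * ((\<bar>s\<bar> * D ^ 2) * \<bar>q x - s * D / 3\<bar>)"
    unfolding norm_mult norm_of_real norm_ii abs_mult using c(1) e(1) by (simp add: abs_mult)
  also have "\<dots> \<le> (\<bar>s\<bar> * D ^ 2 / 2) * 1 + 2 * ((\<bar>s\<bar> * D ^ 2) * ((7/3) * A))"
    using c e qs by (intro add_mono mult_mono) auto
  also have "\<dots> = (1 / 2 + (14/3) * A) * (\<bar>s\<bar> * D ^ 2)" by (simp add: algebra_simps)
  also have "\<dots> \<le> (6 * A) * (\<bar>s\<bar> * D ^ 2)" using A by (intro mult_right_mono) auto
  finally have 1: "norm (rem x D) \<le> 6 * A * (\<bar>s\<bar> * D ^ 2)" .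
  have B6: "6 * A * A \<le> B"
  proof -
    have "6 * A ^ 2 \<le> 16 * (real j + 1) * A ^ 2" by (intro mult_right_mono) auto
    then show ?thesis by (simp add: B_def power2_eq_square)
  qed
  have "6 * A * (\<bar>s\<bar> * D ^ 2) \<le> 6 * A * (A * \<eta> ^ 3 * D ^ 2)"
    using A s_le by (intro mult_left_mono mult_right_mono) auto
  also have "\<dots> = (6 * A * A) * (\<eta> ^ 3 * D ^ 2)" by simp
  also have "\<dots> \<le> B * (\<eta> ^ 3 * D ^ 2)" using B6 eta by (intro mult_right_mono) auto
  finally show "norm (rem x D) \<le> B * \<eta> ^ 3 * D ^ 2" using 1 by (simp add: mult_ac)
  have "6 * A * (\<bar>s\<bar> * D ^ 2) = 6 * A * ((\<bar>s\<bar> * D) * D)" by (simp add: power2_eq_square)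
  also have "\<dots> \<le> 6 * A * ((A * \<eta>) * D)"
    using A sD D by (intro mult_left_mono mult_right_mono) auto
  also have "\<dots> = (6 * A * A) * (\<eta> * D)" by simp
  also have "\<dots> \<le> B * (\<eta> * D)" using B6 eta D by (intro mult_right_mono) auto
  finally show "norm (rem x D) \<le> B * \<eta> * D" using 1 by (simp add: mult_ac)
qed

lemma tt_le: "\<bar>tt r\<bar> \<le> A * \<eta>" using t_le A eta by (auto simp: tt_def)

text \<open>
  The three brackets bound the cubic Taylor remainders, the effect of \<open>rem\<close>, and the quadratic
  expansion.
\<close>
definition err_const :: real where
  "err_const = (8 * A ^ 3 * (1 + real j) + 128 * B ^ 3) + (3 * B + B * (6 * A + 12 * B))
    + (2 * B + A * real j * real j + A ^ 2 * real j * real j + A ^ 2 + A ^ 2 * real j + 2 * A * B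
       + A * B * real j * (real j + 1) + B ^ 2 + 2 * (B ^ 2 + 4 * A * B))"

text \<open>
  For a jump of length \<open>D\<close> with \<open>r\<close> elements, \<open>y\<close> is the linearised and \<open>y + rem x D\<close> the exact
  exponent of the factor by which the summand of the recursion differs from \<open>exp (\<Phi> x)\<close>.
\<close>
lemma exp_expansion_le:
  fixes r :: nat and x D :: real
  assumes x: "0 \<le> x" "x \<le> X" and D: "0 \<le> D" "D \<le> x"
  defines "y \<equiv> \<i> * of_real (s + tt r) - p x * of_real D"
  shows "norm (exp (\<Phi> x) * (exp (y + rem x D) - 1 - (y + rem x D) - (y + rem x D) ^ 2 / 2))
      \<le> (\<bar>s\<bar> + \<bar>tt r\<bar> + 2 * B * \<eta> * D) ^ 3 / 2"
    and "norm (rem x D + ((y + rem x D) ^ 2 - y ^ 2) / 2)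
      \<le> B * \<eta> ^ 3 * D ^ 2 + B * \<eta> ^ 3 * D ^ 2 * (4 * A + 3 * B * D) / 2"
proof -
  define z where "z = y + rem x D"
  have z: "z = \<i> * of_real (s + tt r) + (\<Phi> (x - D) - \<Phi> x)"
    by (simp add: z_def y_def increment)
  have "norm (p x * of_real D) \<le> B * \<eta> * D"
    using p_le[OF x] D by (simp add: norm_mult mult_right_mono)
  moreover have "norm (\<i> * of_real (s + tt r)) \<le> \<bar>s\<bar> + \<bar>tt r\<bar>"
    by (simp only: norm_mult norm_of_real norm_ii mult_1_left abs_triangle_ineq)
  ultimately have y: "norm y \<le> \<bar>s\<bar> + \<bar>tt r\<bar> + B * \<eta> * D"
    unfolding y_def by (smt (verit) norm_triangle_ineq4)
  have z_le: "norm z \<le> \<bar>s\<bar> + \<bar>tt r\<bar> + 2 * B * \<eta> * D"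
    unfolding z_def using norm_triangle_ineq[of y "rem x D"] rem_le(2)[OF x D] y by simp
  have Re_z: "Re z = Re (\<Phi> (x - D) - \<Phi> x)" unfolding z by simp
  then have "0 \<le> Re z" using Re_increment_nonneg[of D x] D by simp
  then have "norm (exp (\<Phi> x)) * norm (exp z - 1 - z - z ^ 2 / 2) \<le> norm (exp (\<Phi> x)) * (exp (Re z) * norm z ^ 3 / 2)"
    by (intro mult_left_mono norm_exp_second_order) auto
  also have "\<dots> = exp (Re (\<Phi> (x - D))) * (norm z ^ 3 / 2)"
    by (simp add: Re_z exp_diff)
  also have "\<dots> \<le> 1 * (norm z ^ 3 / 2)"
    using Re_\<Phi>_nonpos[of "x - D"] D by (intro mult_right_mono) auto
  also have "\<dots> \<le> (\<bar>s\<bar> + \<bar>tt r\<bar> + 2 * B * \<eta> * D) ^ 3 / 2"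
    using z_le by (auto intro!: power_mono divide_right_mono)
  finally show "norm (exp (\<Phi> x) * (exp (y + rem x D) - 1 - (y + rem x D) - (y + rem x D) ^ 2 / 2))
      \<le> (\<bar>s\<bar> + \<bar>tt r\<bar> + 2 * B * \<eta> * D) ^ 3 / 2"
    by (simp add: norm_mult z_def)
  have "z ^ 2 - y ^ 2 = rem x D * (y + z)"
    by (simp add: z_def power2_eq_square algebra_simps)
  then have "norm ((z ^ 2 - y ^ 2) / 2) = norm (rem x D) * norm (y + z) / 2"
    by (simp add: norm_mult norm_divide)
  also have "\<dots> \<le> norm (rem x D) * (4 * A + 3 * B * D) / 2"
  proof -
    have "norm (y + z) \<le> 2 * (\<bar>s\<bar> + \<bar>tt r\<bar>) + \<eta> * (3 * B * D)"
      using norm_triangle_ineq[of y z] y z_le by (simp add: algebra_simps)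
    also have "\<bar>s\<bar> \<le> A * 1" using s_le eta_powers(4) A by (meson mult_left_mono order_trans zero_le_one)
    also have "\<bar>tt r\<bar> \<le> A * 1" using tt_le[of r] eta(2) A by (meson mult_left_mono order_trans zero_le_one)
    also have "\<eta> * (3 * B * D) \<le> 3 * B * D" using eta B_ge D by (intro mult_left_le_one_le) auto
    finally have "norm (y + z) \<le> 4 * A + 3 * B * D" by simp
    then show ?thesis by (intro divide_right_mono mult_left_mono) auto
  qed
  also have "\<dots> \<le> B * \<eta> ^ 3 * D ^ 2 * (4 * A + 3 * B * D) / 2"
    using rem_le(1)[OF x D] A B_ge D by (intro divide_right_mono mult_right_mono) auto
  finally have "norm ((z ^ 2 - y ^ 2) / 2) \<le> B * \<eta> ^ 3 * D ^ 2 * (4 * A + 3 * B * D) / 2" .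
  then show "norm (rem x D + ((y + rem x D) ^ 2 - y ^ 2) / 2)
      \<le> B * \<eta> ^ 3 * D ^ 2 + B * \<eta> ^ 3 * D ^ 2 * (4 * A + 3 * B * D) / 2"
    using norm_triangle_ineq[of "rem x D" "(z ^ 2 - y ^ 2) / 2"] rem_le(1)[OF x D]
    unfolding z_def by linarith
qed

text \<open>
  A set of \<open>N + 1\<close> elements cannot lose more than \<open>N\<close> of them, so a sum over the sizes
  \<open>r \<le> j\<close> is cut off at \<open>N\<close>. This only matters if \<open>N < j\<close>, where \<open>h\<^bsub>N\<^esub> / (N + 1)\<close> is bounded
  from below.
\<close>
lemma truncated_sum_diff_le:
  assumes "1 \<le> N" and f: "\<And>r. r \<in> {1..j} \<Longrightarrow> \<bar>f r\<bar> \<le> K" and K: "0 \<le> K"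
  shows "\<bar>(\<Sum>r=1..j. f r) - (\<Sum>r=1..N. if r \<in> {1..j} then f r else 0)\<bar>
    \<le> K * real j * real j * (harm N / real (Suc N))"
proof (cases "N < j")
  case False
  have "(\<Sum>r=1..N. if r \<in> {1..j} then f r else 0) = (\<Sum>r=1..j. f r)"
    using False by (subst sum.inter_restrict[symmetric]) (auto intro!: sum.cong)
  then show ?thesis using K by (simp add: harm_nonneg)
next
  case True
  have "harm N \<ge> (harm 1 :: real)" using assms by (intro harm_mono)
  then have h1: "harm N \<ge> (1::real)" by (simp add: harm_expand)
  have u: "1 \<le> real j * (harm N / real (Suc N))"
  proof -
    have "real (Suc N) * 1 \<le> real j * harm N" using True h1 by (intro mult_mono) auto
    then show ?thesis by (simp add: field_simps)
  qed
  have 1: "(\<Sum>r=1..N. if r \<in> {1..j} then f r else 0) = (\<Sum>r=1..N. f r)"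
    using True by (intro sum.cong) auto
  have 2: "(\<Sum>r=1..j. f r) - (\<Sum>r=1..N. f r) = (\<Sum>r\<in>{1..j} - {1..N}. f r)"
    using True by (subst sum_diff) auto
  have "\<bar>\<Sum>r\<in>{1..j} - {1..N}. f r\<bar> \<le> (\<Sum>r\<in>{1..j} - {1..N}. \<bar>f r\<bar>)"
    by (rule sum_abs)
  also have "(\<Sum>r\<in>{1..j} - {1..N}. \<bar>f r\<bar>) \<le> (\<Sum>r\<in>{1..j} - {1..N}. K)"
    using f by (intro sum_mono) auto
  also have "(\<Sum>r\<in>{1..j} - {1..N}. K) \<le> (\<Sum>r\<in>{1..j}. K)"
    using K by (intro sum_mono2) auto
  finally have "\<bar>(\<Sum>r=1..j. f r) - (\<Sum>r=1..N. if r \<in> {1..j} then f r else 0)\<bar> \<le> K * real j"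
    unfolding 1 2 by (simp add: mult.commute)
  also have "\<dots> \<le> K * real j * (real j * (harm N / real (Suc N)))"
    using mult_left_mono[OF u, of "K * real j"] K by simp
  finally show ?thesis by (simp only: mult.assoc)
qed

text \<open>
  The covariance of the number of jumps of size \<open>r \<le> j\<close> with the displacement. Such jumps
  have length of order \<open>1 / (N + 1)\<close>, so the covariance is negligible; this is the reason why the
  limits \<open>Y\<^bsub>r\<^esub>\<close> are independent of the Brownian motion.
\<close>
lemma marked_jump_le:
  "\<bar>\<Sum>r=1..N. (1 / real r) * (tt r * gap N r)\<bar>
    \<le> A * \<eta> * real j * (real j + 1) * (harm N / real (Suc N))"
proof (cases "N = 0")
  case False
  then have "harm N \<ge> (harm 1 :: real)" by (intro harm_mono) auto
  then have h1: "harm N \<ge> (1::real)" by (simp add: harm_expand)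
  have bound: "\<bar>(1 / real r) * (tt r * gap N r)\<bar>
      \<le> (if r \<in> {1..j} then A * \<eta> * (real j + 1) * (harm N / real (Suc N)) else 0)"
    if r: "r \<in> {1..N}" for r
  proof (cases "r \<in> {1..j}")
    case True
    have k: "real (Suc N - r) > 0" using r by auto
    have "(1 / real r) * gap N r \<le> (1 / real r) * (real r / real (Suc N - r))"
      using harm_diff_le[of r N] r by (intro mult_left_mono) auto
    also have "\<dots> = 1 / real (Suc N - r)" using r by simp
    also have "\<dots> \<le> (real j + 1) / real (Suc N)"
    proof -
      have "Suc N \<le> (j + 1) * (Suc N - r)"
      proof -
        obtain k where k: "Suc N = r + k" "k \<ge> 1" using r by (metis Suc_diff_le atLeastAtMost_iff le_add_diff_inverse le_SucI le_add1 plus_1_eq_Suc)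
        have "r * 1 \<le> j * k" using True k by (intro mult_mono) auto
        then show ?thesis using k by simp
      qed
      then have "real (Suc N) \<le> (real j + 1) * real (Suc N - r)"
        by (metis Suc_eq_plus1 of_nat_Suc of_nat_le_iff of_nat_mult add.commute)
      then show ?thesis using k by (simp add: field_simps)
    qed
    also have "\<dots> \<le> (real j + 1) * (harm N / real (Suc N))"
      using h1 by (simp add: divide_right_mono mult_left_mono)
    finally have *: "(1 / real r) * gap N r \<le> (real j + 1) * (harm N / real (Suc N))" .
    have "\<bar>(1 / real r) * (tt r * gap N r)\<bar> = \<bar>tt r\<bar> * ((1 / real r) * gap N r)"
      using harm_diff_nonneg[of N r] by (simp add: abs_mult)
    also have "\<dots> \<le> (A * \<eta>) * ((real j + 1) * (harm N / real (Suc N)))"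
      by (rule mult_mono) (use * tt_le[of r] harm_diff_nonneg[of N r] A eta in auto)
    finally show ?thesis using True by simp
  qed (auto simp: tt_def)
  have "\<bar>\<Sum>r=1..N. (1 / real r) * (tt r * gap N r)\<bar>
      \<le> (\<Sum>r=1..N. \<bar>(1 / real r) * (tt r * gap N r)\<bar>)" by (rule sum_abs)
  also have "\<dots> \<le> (\<Sum>r=1..N. if r \<in> {1..j} then A * \<eta> * (real j + 1) * (harm N / real (Suc N)) else 0)"
    by (intro sum_mono bound)
  also have "\<dots> = (\<Sum>r\<in>{1..N} \<inter> {1..j}. A * \<eta> * (real j + 1) * (harm N / real (Suc N)))"
    by (rule sum.inter_restrict[symmetric]) simp
  also have "\<dots> \<le> (\<Sum>r\<in>{1..j}. A * \<eta> * (real j + 1) * (harm N / real (Suc N)))"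
    using A eta by (intro sum_mono2) (auto intro!: mult_nonneg_nonneg divide_nonneg_nonneg harm_nonneg)
  finally show ?thesis by (simp add: mult_ac)
qed (simp add: harm_expand)

lemma marked_sum_le:
  assumes "\<And>r. f r = (if r \<in> {1..j} then f' r else 0)" "\<And>r. r \<in> {1..j} \<Longrightarrow> \<bar>f' r\<bar> \<le> K" "0 \<le> K"
  shows "\<bar>\<Sum>r=1..N. (1 / real r) * f r\<bar> \<le> K * real j"
proof -
  have "\<bar>\<Sum>r=1..N. (1 / real r) * f r\<bar> \<le> (\<Sum>r=1..N. \<bar>(1 / real r) * f r\<bar>)" by (rule sum_abs)
  also have "\<dots> \<le> (\<Sum>r=1..N. if r \<in> {1..j} then K else 0)"
  proof (rule sum_mono)
    fix r assume r: "r \<in> {1..N}"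
    have "\<bar>(1 / real r) * f r\<bar> = \<bar>f r\<bar> / real r" by (simp add: abs_mult)
    also have "\<dots> \<le> \<bar>f r\<bar> / 1" using r by (intro divide_left_mono) auto
    finally have "\<bar>(1 / real r) * f r\<bar> \<le> \<bar>f r\<bar>" by simp
    then show "\<bar>(1 / real r) * f r\<bar> \<le> (if r \<in> {1..j} then K else 0)"
      using assms(1)[of r] assms(2)[of r] by (auto split: if_splits)
  qed
  also have "\<dots> = (\<Sum>r\<in>{1..N} \<inter> {1..j}. K)"
    by (rule sum.inter_restrict[symmetric]) simp
  also have "\<dots> \<le> (\<Sum>r\<in>{1..j}. K)" using assms(3) by (intro sum_mono2) auto
  finally show ?thesis by (simp add: mult_ac)
qed

text \<open>
  The sum of the linearised exponents and half their squares under the jump rates. The terms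
  of orders \<open>\<eta>\<close> and \<open>\<eta>\<^sup>2\<close> have cancelled by the choice of \<open>p\<close>, except for those with a
  factor that vanishes as \<open>N\<close> grows.
\<close>
lemma quadratic_expansion:
  fixes N :: nat
  defines "x \<equiv> harm N"
  defines "y \<equiv> \<lambda>r. \<i> * of_real (s + tt r) - p x * of_real (gap N r)"
    and "S \<equiv> \<Sum>k=1..N. 1 / real k ^ 2" and "b \<equiv> \<Sum>k=1..N. harm k / real k ^ 2"
    and "\<tau>1 \<equiv> \<Sum>r=1..N. (1 / real r) * tt r" and "\<tau>2 \<equiv> \<Sum>r=1..N. (1 / real r) * tt r ^ 2"
    and "\<mu> \<equiv> \<Sum>r=1..N. (1 / real r) * (tt r * gap N r)"
  shows "cjump_sum N (\<lambda>r. y r + y r ^ 2 / 2) + \<i> * of_real d =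
    p x * of_real (zeta 2 - S) - \<i> * of_real ((\<Sum>r=1..j. t r / real r) - \<tau>1) + of_real ((v - \<tau>2) / 2)
    - of_real (s ^ 2 * x / 2) - of_real (s * \<tau>1) - \<i> * p x * of_real (s * S) - \<i> * p x * of_real \<mu>
    + p x ^ 2 * of_real (b - 2 * zeta 3) / 2
    + of_real (zeta 3) * (of_real (g x ^ 2) - 2 * \<i> * of_real ((q x * c) * g x))"
proof -
  define D where "D r = (harm N - harm (N - r) :: real)" for r
  have S: "jump_sum N (\<lambda>r. D r) = S"
    unfolding S_def D_def by (rule jump_first_moment)
  have b: "jump_sum N (\<lambda>r. D r ^ 2) = b"
    unfolding b_def D_def by (rule jump_second_moment)
  have "cjump_sum N (\<lambda>r. y r) =
     (\<Sum>r=1..N. \<i> * of_real (s * (1 / real r) + (1 / real r) * tt r) - p x * of_real ((1 / real r) * D r))"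
    by (intro sum.cong refl) (simp add: y_def D_def algebra_simps add_divide_distrib diff_divide_distrib)
  also have "\<dots> = \<i> * of_real (\<Sum>r=1..N. s * (1 / real r) + (1 / real r) * tt r) - p x * of_real (jump_sum N (\<lambda>r. D r))"
    by (simp only: sum_subtractf of_real_sum sum_distrib_left)
  also have "\<dots> = \<i> * of_real (s * x + \<tau>1) - p x * of_real S"
    by (simp only: sum.distrib sum_distrib_left[symmetric] sum_reciprocal S \<tau>1_def x_def)
  finally have Y1: "cjump_sum N (\<lambda>r. y r) = \<i> * of_real (s * x + \<tau>1) - p x * of_real S" .
  have "cjump_sum N (\<lambda>r. y r ^ 2) =
     (\<Sum>r=1..N. p x ^ 2 * of_real ((1 / real r) * D r ^ 2)
        - of_real (s ^ 2 * (1 / real r) + 2 * s * ((1 / real r) * tt r) + (1 / real r) * tt r ^ 2)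
        - 2 * \<i> * p x * of_real (s * ((1 / real r) * D r) + (1 / real r) * (tt r * D r)))"
    by (intro sum.cong refl)
       (simp add: y_def D_def[symmetric] power2_eq_square algebra_simps add_divide_distrib diff_divide_distrib)
  also have "\<dots> = p x ^ 2 * of_real (jump_sum N (\<lambda>r. D r ^ 2))
        - of_real (\<Sum>r=1..N. s ^ 2 * (1 / real r) + 2 * s * ((1 / real r) * tt r) + (1 / real r) * tt r ^ 2)
        - 2 * \<i> * p x * of_real (\<Sum>r=1..N. s * ((1 / real r) * D r) + (1 / real r) * (tt r * D r))"
    by (simp only: sum_subtractf of_real_sum sum_distrib_left)
  also have "\<dots> = p x ^ 2 * of_real b - of_real (s ^ 2 * x + 2 * s * \<tau>1 + \<tau>2) - 2 * \<i> * p x * of_real (s * S + \<mu>)"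
    by (simp only: sum.distrib sum_distrib_left[symmetric] sum_reciprocal S b \<tau>1_def \<tau>2_def \<mu>_def x_def D_def[symmetric])
  finally have Y2: "cjump_sum N (\<lambda>r. y r ^ 2) =
      p x ^ 2 * of_real b - of_real (s ^ 2 * x + 2 * s * \<tau>1 + \<tau>2) - 2 * \<i> * p x * of_real (s * S + \<mu>)" .
  have "cjump_sum N (\<lambda>r. y r + y r ^ 2 / 2) =
      cjump_sum N (\<lambda>r. y r) + cjump_sum N (\<lambda>r. y r ^ 2) / 2"
    by (simp only: distrib_left sum.distrib times_divide_eq_right sum_divide_distrib)
  note sums = this[unfolded Y1 Y2]
  \<comment> \<open>the equation which determines \<open>p\<close> up to terms of third order, with \<open>\<zeta>(3) p\<^sup>2\<close> replaced by its leading part\<close>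
  have cancel: "\<i> * of_real (q x) - p x * of_real (zeta 2) =
      of_real (v / 2) + of_real (zeta 3 * (q x * c) ^ 2)"
  proof -
    have "q x * c * zeta 2 = q x" "g x * zeta 2 = v / 2 + zeta 3 * (q x * c) ^ 2"
    proof -
      show "q x * c * zeta 2 = q x" using c(3) by simp
      have "g x * zeta 2 = v * (c * zeta 2) / 2 + (e * zeta 2) * q x ^ 2"
        by (simp add: g_def algebra_simps)
      then show "g x * zeta 2 = v / 2 + zeta 3 * (q x * c) ^ 2"
        unfolding e(3) c(3) by (simp add: power_mult_distrib)
    qed
    moreover have "complex_of_real c * complex_of_real (zeta 2) = 1"
      using c(3) by (metis of_real_1 of_real_mult)
    ultimately show ?thesis
      unfolding p_def left_diff_distrib mult.assoc of_real_mult[symmetric] of_real_add[symmetric]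
      by simp
  qed
  have p2: "p x ^ 2 = - of_real ((q x * c) ^ 2) + of_real (g x ^ 2) - 2 * \<i> * of_real ((q x * c) * g x)"
    by (simp add: p_def power2_eq_square algebra_simps)
  have d: "d = \<kappa> - (\<Sum>r=1..j. t r / real r)" by (simp add: \<kappa>_def)
  have qx: "s * x = q x - \<kappa>" by (simp add: q_def)
  have "cjump_sum N (\<lambda>r. y r + y r ^ 2 / 2) + \<i> * of_real d =
     (\<i> * of_real (q x) - p x * of_real (zeta 2)) + p x * of_real (zeta 2 - S)
     - \<i> * of_real ((\<Sum>r=1..j. t r / real r) - \<tau>1) - of_real (\<tau>2 / 2)
     - of_real (s ^ 2 * x / 2) - of_real (s * \<tau>1) - \<i> * p x * of_real (s * S) - \<i> * p x * of_real \<mu>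
     + p x ^ 2 * of_real (b - 2 * zeta 3) / 2 + of_real (zeta 3) * p x ^ 2"
    unfolding sums d qx by (simp add: field_simps)
  also have "\<dots> = p x * of_real (zeta 2 - S) - \<i> * of_real ((\<Sum>r=1..j. t r / real r) - \<tau>1) + of_real ((v - \<tau>2) / 2)
    - of_real (s ^ 2 * x / 2) - of_real (s * \<tau>1) - \<i> * p x * of_real (s * S) - \<i> * p x * of_real \<mu>
    + p x ^ 2 * of_real (b - 2 * zeta 3) / 2
    + (of_real (zeta 3 * (q x * c) ^ 2) + of_real (zeta 3) * p x ^ 2)"
    unfolding cancel by (simp add: field_simps)
  also have "of_real (zeta 3 * (q x * c) ^ 2) + of_real (zeta 3) * p x ^ 2 =
     of_real (zeta 3) * (of_real (g x ^ 2) - 2 * \<i> * of_real ((q x * c) * g x))"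
    unfolding p2 by (simp add: algebra_simps)
  finally show ?thesis .
qed

lemma quadratic_expansion_le:
  fixes N :: nat
  assumes N: "1 \<le> N" "harm N \<le> X"
  defines "x \<equiv> harm N"
  defines "y \<equiv> \<lambda>r. \<i> * of_real (s + tt r) - p x * of_real (gap N r)"
    and "b \<equiv> \<Sum>k=1..N. harm k / real k ^ 2"
    and "u \<equiv> harm N / real (Suc N)"
  shows "norm (cjump_sum N (\<lambda>r. y r + y r ^ 2 / 2) + \<i> * of_real d) \<le>
    (2 * B + A * real j * real j + A ^ 2 * real j * real j + A ^ 2 + A ^ 2 * real j + 2 * A * B
       + A * B * real j * (real j + 1) + B ^ 2 + 2 * (B ^ 2 + 4 * A * B))
    * (\<eta> ^ 3 + \<eta> ^ 2 * \<bar>b - 2 * zeta 3\<bar> + \<eta> * u)"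
proof -
  define S where "S = zeta2_sum N"
  define \<tau>1 where "\<tau>1 = jump_sum N (\<lambda>r. tt r)"
  define \<tau>2 where "\<tau>2 = jump_sum N (\<lambda>r. tt r ^ 2)"
  define \<mu> where "\<mu> = jump_sum N (\<lambda>r. tt r * gap N r)"
  have x: "0 \<le> x" "x \<le> X" using N by (auto simp: x_def harm_nonneg)
  have u: "0 \<le> u" by (simp add: u_def harm_nonneg)
  have p: "norm (p x) \<le> B * \<eta>" using p_le[OF x] .
  have S2: "\<bar>zeta 2 - S\<bar> \<le> 2 * u" "\<bar>S\<bar> \<le> 2"
  proof -
    have "harm N \<ge> (harm 1 :: real)" using N by (intro harm_mono) auto
    then have "2 / real (Suc N) \<le> 2 * u" by (simp add: u_def harm_expand divide_right_mono)
    then show "\<bar>zeta 2 - S\<bar> \<le> 2 * u" using zeta_tail[OF N(1)] by (simp add: S_def abs_minus_commute)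
    have "0 \<le> S" by (auto simp: S_def intro: sum_nonneg)
    then show "\<bar>S\<bar> \<le> 2" using zeta_2_sum_le[of N] zeta_2_le_2 by (simp add: S_def)
  qed
  have t2: "\<bar>t r ^ 2\<bar> \<le> A ^ 2 * \<eta> ^ 2" if "r \<in> {1..j}" for r
    using power_mono[OF t_le[OF that], of 2] by (simp add: power_mult_distrib)
  have n1: "norm (p x * of_real (zeta 2 - S)) \<le> 2 * B * (\<eta> * u)"
  proof -
    have "norm (p x * of_real (zeta 2 - S)) \<le> (B * \<eta>) * (2 * u)"
      unfolding norm_mult norm_of_real by (intro mult_mono p S2) (use B_ge eta in auto)
    then show ?thesis by simp
  qed
  have n2: "norm (\<i> * of_real ((\<Sum>r=1..j. t r / real r) - \<tau>1)) \<le> A * real j * real j * (\<eta> * u)"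
  proof -
    have "\<tau>1 = (\<Sum>r=1..N. if r \<in> {1..j} then t r / real r else 0)"
      unfolding \<tau>1_def by (intro sum.cong) (auto simp: tt_def)
    moreover have "\<bar>t r / real r\<bar> \<le> A * \<eta>" if "r \<in> {1..j}" for r
    proof -
      have "\<bar>t r\<bar> / real r \<le> \<bar>t r\<bar> / 1" using that by (intro divide_left_mono) auto
      then show ?thesis using t_le[OF that] by simp
    qed
    ultimately have "\<bar>(\<Sum>r=1..j. t r / real r) - \<tau>1\<bar> \<le> (A * \<eta>) * real j * real j * u"
      using truncated_sum_diff_le[OF N(1), of "\<lambda>r. t r / real r" "A * \<eta>"] A eta by (simp add: u_def)
    then show ?thesis unfolding norm_mult norm_of_real norm_ii by (simp add: mult_ac)
  qed
  have n3: "norm (of_real ((v - \<tau>2) / 2) :: complex) \<le> A ^ 2 * real j * real j * (\<eta> * u)"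
  proof -
    have "\<tau>2 = (\<Sum>r=1..N. if r \<in> {1..j} then t r ^ 2 / real r else 0)"
      unfolding \<tau>2_def by (intro sum.cong) (auto simp: tt_def)
    moreover have "\<bar>t r ^ 2 / real r\<bar> \<le> A ^ 2 * \<eta>" if "r \<in> {1..j}" for r
    proof -
      have "t r ^ 2 / real r \<le> t r ^ 2 / 1" using that by (intro divide_left_mono) auto
      also have "\<dots> \<le> A ^ 2 * \<eta> ^ 2" using t2[OF that] by simp
      also have "\<dots> \<le> A ^ 2 * \<eta>" using eta_powers by (intro mult_left_mono) auto
      finally show ?thesis by simp
    qed
    ultimately have "\<bar>v - \<tau>2\<bar> \<le> (A ^ 2 * \<eta>) * real j * real j * u"
      using truncated_sum_diff_le[OF N(1), of "\<lambda>r. t r ^ 2 / real r" "A ^ 2 * \<eta>"] eta by (simp add: u_def v_def)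
    then have "\<bar>v - \<tau>2\<bar> / 2 \<le> (A ^ 2 * \<eta>) * real j * real j * u" using abs_ge_zero[of "v - \<tau>2"] by argo
    then show ?thesis unfolding norm_of_real by (simp add: mult_ac)
  qed
  have n4: "norm (of_real (s ^ 2 * x / 2) :: complex) \<le> A ^ 2 * \<eta> ^ 3"
  proof -
    have sx: "\<bar>s\<bar> * x \<le> \<bar>s\<bar> * X" using x by (intro mult_left_mono) auto
    have "\<bar>s\<bar> * (\<bar>s\<bar> * x) \<le> (A * \<eta> ^ 3) * (A * \<eta>)"
      by (rule mult_mono) (use sx s_le sX_le A eta x in auto)
    also have "\<dots> = A ^ 2 * \<eta> ^ 4" by (simp add: power2_eq_square eval_nat_numeral)
    also have "\<dots> \<le> A ^ 2 * \<eta> ^ 3" using eta_powers by (intro mult_left_mono) auto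
    finally have "s ^ 2 * x \<le> A ^ 2 * \<eta> ^ 3" by (simp add: power2_eq_square mult.assoc[symmetric])
    moreover have "0 \<le> A ^ 2 * \<eta> ^ 3" using eta by simp
    ultimately show ?thesis using x by (simp only: norm_of_real) (simp add: abs_mult)
  qed
  have n5: "norm (of_real (s * \<tau>1) :: complex) \<le> A ^ 2 * real j * \<eta> ^ 3"
  proof -
    have "\<bar>\<tau>1\<bar> \<le> (A * \<eta>) * real j"
      unfolding \<tau>1_def using t_le A eta by (intro marked_sum_le[of _ t]) (auto simp: tt_def)
    then have "\<bar>s\<bar> * \<bar>\<tau>1\<bar> \<le> (A * \<eta> ^ 3) * ((A * \<eta>) * real j)"
      using s_le A eta by (intro mult_mono) auto
    also have "\<dots> = A ^ 2 * real j * \<eta> ^ 4" by (simp add: power2_eq_square eval_nat_numeral)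
    also have "\<dots> \<le> A ^ 2 * real j * \<eta> ^ 3" using eta_powers by (intro mult_left_mono) auto
    finally show ?thesis by (simp only: norm_of_real abs_mult)
  qed
  have n6: "norm (\<i> * p x * of_real (s * S)) \<le> 2 * A * B * \<eta> ^ 3"
  proof -
    have "norm (\<i> * p x * of_real (s * S)) \<le> (B * \<eta>) * ((A * \<eta> ^ 3) * 2)"
      unfolding norm_mult norm_of_real norm_ii abs_mult mult_1_left
      by (intro mult_mono p s_le S2) (use B_ge A eta in auto)
    also have "\<dots> = 2 * A * B * \<eta> ^ 4" by (simp add: eval_nat_numeral)
    also have "\<dots> \<le> 2 * A * B * \<eta> ^ 3" using eta_powers A B_ge by (intro mult_left_mono) auto
    finally show ?thesis .
  qed
  have n7: "norm (\<i> * p x * of_real \<mu>) \<le> A * B * real j * (real j + 1) * (\<eta> * u)"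
  proof -
    have "norm (\<i> * p x * of_real \<mu>) \<le> (B * \<eta>) * (A * \<eta> * real j * (real j + 1) * u)"
      unfolding norm_mult norm_of_real norm_ii mult_1_left \<mu>_def u_def
      by (intro mult_mono p marked_jump_le) (use B_ge A eta in auto)
    also have "\<dots> = A * B * real j * (real j + 1) * (\<eta> ^ 2 * u)" by (simp add: power2_eq_square)
    also have "\<dots> \<le> A * B * real j * (real j + 1) * (\<eta> * u)"
      using eta_powers A B_ge u by (intro mult_left_mono mult_right_mono) auto
    finally show ?thesis .
  qed
  have n8: "norm (p x ^ 2 * of_real (b - 2 * zeta 3) / 2) \<le> B ^ 2 * (\<eta> ^ 2 * \<bar>b - 2 * zeta 3\<bar>)"
  proof -
    have "norm (p x ^ 2 * of_real (b - 2 * zeta 3)) \<le> (B * \<eta>) ^ 2 * \<bar>b - 2 * zeta 3\<bar>"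
      unfolding norm_mult norm_power norm_of_real by (intro mult_right_mono power_mono p) auto
    also have "\<dots> = B ^ 2 * (\<eta> ^ 2 * \<bar>b - 2 * zeta 3\<bar>)" by (simp add: power_mult_distrib)
    finally have *: "norm (p x ^ 2 * of_real (b - 2 * zeta 3)) \<le> B ^ 2 * (\<eta> ^ 2 * \<bar>b - 2 * zeta 3\<bar>)" .
    have "norm (p x ^ 2 * of_real (b - 2 * zeta 3) / 2) \<le> norm (p x ^ 2 * of_real (b - 2 * zeta 3))"
      by (simp add: norm_divide)
    then show ?thesis using * by (rule order_trans)
  qed
  have n9: "norm (of_real (zeta 3) * (of_real (g x ^ 2) - 2 * \<i> * of_real ((q x * c) * g x)))
      \<le> 2 * (B ^ 2 + 4 * A * B) * \<eta> ^ 3"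
  proof -
    have gx: "0 \<le> g x" "g x \<le> B * \<eta> ^ 2" using g_le[OF x] g_le_B[OF x] by auto
    have "norm (of_real (g x ^ 2) - 2 * \<i> * of_real ((q x * c) * g x)) \<le>
        norm (of_real (g x ^ 2) :: complex) + norm (2 * \<i> * of_real ((q x * c) * g x))"
      by (rule norm_triangle_ineq4)
    also have "\<dots> = g x ^ 2 + 2 * (\<bar>q x * c\<bar> * g x)"
      unfolding norm_mult norm_of_real norm_ii abs_mult using gx by simp
    also have "\<dots> \<le> (B * \<eta> ^ 2) ^ 2 + 2 * ((2 * A * \<eta>) * (B * \<eta> ^ 2))"
      using gx qc_le[OF x] A eta by (intro add_mono mult_left_mono mult_mono power_mono) auto
    also have "\<dots> = B ^ 2 * \<eta> ^ 4 + 4 * A * B * \<eta> ^ 3" by (simp add: power_mult_distrib eval_nat_numeral)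
    also have "\<dots> \<le> B ^ 2 * \<eta> ^ 3 + 4 * A * B * \<eta> ^ 3"
      using eta_powers A B_ge by (intro add_mono mult_left_mono) auto
    finally have "norm (of_real (g x ^ 2) - 2 * \<i> * of_real ((q x * c) * g x)) \<le> (B ^ 2 + 4 * A * B) * \<eta> ^ 3"
      by (simp add: algebra_simps)
    then have "\<bar>zeta 3\<bar> * norm (of_real (g x ^ 2) - 2 * \<i> * of_real ((q x * c) * g x)) \<le> 2 * ((B ^ 2 + 4 * A * B) * \<eta> ^ 3)"
      using zeta_3_ge_0 zeta_3_le_2 by (intro mult_mono) auto
    then show ?thesis by (simp only: norm_mult norm_of_real mult.assoc)
  qed
  define W V Q where "W = \<eta> * u" and "V = \<eta> ^ 3" and "Q = \<eta> ^ 2 * \<bar>b - 2 * zeta 3\<bar>"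
  have pos: "0 \<le> W" "0 \<le> V" "0 \<le> Q" using eta u by (auto simp: W_def V_def Q_def)
  have main: "cjump_sum N (\<lambda>r. y r + y r ^ 2 / 2) + \<i> * of_real d =
    p x * of_real (zeta 2 - S) - \<i> * of_real ((\<Sum>r=1..j. t r / real r) - \<tau>1) + of_real ((v - \<tau>2) / 2)
    - of_real (s ^ 2 * x / 2) - of_real (s * \<tau>1) - \<i> * p x * of_real (s * S) - \<i> * p x * of_real \<mu>
    + p x ^ 2 * of_real (b - 2 * zeta 3) / 2
    + of_real (zeta 3) * (of_real (g x ^ 2) - 2 * \<i> * of_real ((q x * c) * g x))"
    unfolding x_def y_def S_def b_def \<tau>1_def \<tau>2_def \<mu>_def by (rule quadratic_expansion)
  have tri: "norm (a1 - a2 + a3 - a4 - a5 - a6 - a7 + a8 + a9) \<le>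
     norm a1 + norm a2 + norm a3 + norm a4 + norm a5 + norm a6 + norm a7 + norm a8 + norm a9"
    for a1 a2 a3 a4 a5 a6 a7 a8 a9 :: complex
    by (intro order_trans[OF norm_triangle_ineq] order_trans[OF norm_triangle_ineq4] add_mono order_refl)
  have "norm (cjump_sum N (\<lambda>r. y r + y r ^ 2 / 2) + \<i> * of_real d) \<le>
    2 * B * W + A * real j * real j * W + A ^ 2 * real j * real j * W + A ^ 2 * V + A ^ 2 * real j * V
    + 2 * A * B * V + A * B * real j * (real j + 1) * W + B ^ 2 * Q + 2 * (B ^ 2 + 4 * A * B) * V"
    unfolding main W_def V_def Q_def
    using n1 n2 n3 n4 n5 n6 n7 n8 n9
    by (intro order_trans[OF tri] add_mono) auto
  also have "\<dots> \<le> 2 * B * (V + Q + W) + A * real j * real j * (V + Q + W)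
    + A ^ 2 * real j * real j * (V + Q + W) + A ^ 2 * (V + Q + W) + A ^ 2 * real j * (V + Q + W)
    + 2 * A * B * (V + Q + W) + A * B * real j * (real j + 1) * (V + Q + W) + B ^ 2 * (V + Q + W)
    + 2 * (B ^ 2 + 4 * A * B) * (V + Q + W)"
    using pos A B_ge by (intro add_mono mult_left_mono) auto
  also have "\<dots> = (2 * B + A * real j * real j + A ^ 2 * real j * real j + A ^ 2 + A ^ 2 * real j + 2 * A * B
       + A * B * real j * (real j + 1) + B ^ 2 + 2 * (B ^ 2 + 4 * A * B)) * (V + Q + W)"
    by (simp only: distrib_right)
  finally show ?thesis unfolding V_def Q_def W_def .
qed

text \<open>
  The error committed by \<open>exp \<circ> \<Phi>\<close> in the recursion. Each summand is \<open>exp (\<Phi> x) exp (z r)\<close>; the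
  exponential is expanded to second order (remainder \<open>R1\<close>), then \<open>z\<close> is replaced by its linear
  part \<open>y\<close> (remainder \<open>R2\<close>), and the rest is the quadratic expansion.
\<close>
lemma residual_le:
  fixes N :: nat
  assumes N: "1 \<le> N" "harm N \<le> X"
  shows "norm (cjump_sum N (\<lambda>r. exp (\<i> * of_real (s + tt r)) * exp (\<Phi> (harm (N - r))))
      - (of_real (harm N) - \<i> * of_real d) * exp (\<Phi> (harm N)))
    \<le> err_const * (\<eta> ^ 3 + \<eta> ^ 2 * \<bar>euler_sum N - 2 * zeta 3\<bar>
         + \<eta> * (harm N / real (Suc N)))"
proof -
  define x where "x = (harm N :: real)"
  define D where "D r = (harm N - harm (N - r) :: real)" for r
  define y where "y r = \<i> * of_real (s + tt r) - p x * of_real (D r)" for r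
  define z where "z r = y r + rem x (D r)" for r
  have x: "0 \<le> x" "x \<le> X" using N by (auto simp: x_def harm_nonneg)
  have D: "0 \<le> D r" "D r \<le> x" for r
    by (auto simp: D_def x_def harm_mono harm_nonneg)
  have step: "exp (\<i> * of_real (s + tt r)) * exp (\<Phi> (harm (N - r))) = exp (\<Phi> x) * exp (z r)" for r
  proof -
    have "\<i> * of_real (s + tt r) + \<Phi> (x - D r) = \<Phi> x + z r"
      using increment[of x "D r"] by (simp add: z_def y_def algebra_simps)
    moreover have "x - D r = harm (N - r)" by (simp add: x_def D_def)
    ultimately show ?thesis by (simp add: exp_add[symmetric])
  qed
  define R1 where "R1 r = exp (\<Phi> x) * (exp (z r) - 1 - z r - z r ^ 2 / 2)" for r
  define R2 where "R2 r = rem x (D r) + (z r ^ 2 - y r ^ 2) / 2" for r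
  have cx: "of_real (harm N) = (\<Sum>r=1..N. of_real (1 / real r) :: complex)"
    by (simp only: of_real_sum[symmetric] sum_reciprocal)
  have "cjump_sum N (\<lambda>r. exp (\<i> * of_real (s + tt r)) * exp (\<Phi> (harm (N - r))))
      - (of_real (harm N) - \<i> * of_real d) * exp (\<Phi> (harm N)) =
    (\<Sum>r=1..N. of_real (1 / real r) * (exp (\<Phi> x) * exp (z r)) - of_real (1 / real r) * exp (\<Phi> x))
      + exp (\<Phi> x) * (\<i> * of_real d)"
    unfolding step cx sum_subtractf sum_distrib_right[symmetric] x_def by (simp only: ring_distribs mult_ac) simp
  also have "(\<Sum>r=1..N. of_real (1 / real r) * (exp (\<Phi> x) * exp (z r)) - of_real (1 / real r) * exp (\<Phi> x)) =
     (\<Sum>r=1..N. of_real (1 / real r) * R1 r + exp (\<Phi> x) * (of_real (1 / real r) * R2 r)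
        + exp (\<Phi> x) * (of_real (1 / real r) * (y r + y r ^ 2 / 2)))"
  proof (intro sum.cong refl)
    fix r
    have "exp (z r) - 1 = (exp (z r) - 1 - z r - z r ^ 2 / 2) + R2 r + (y r + y r ^ 2 / 2)"
      by (simp add: R2_def z_def diff_divide_distrib)
    then have "of_real (1 / real r) * exp (\<Phi> x) * (exp (z r) - 1) =
       of_real (1 / real r) * exp (\<Phi> x) * ((exp (z r) - 1 - z r - z r ^ 2 / 2) + R2 r + (y r + y r ^ 2 / 2))"
      by (rule arg_cong)
    then show "of_real (1 / real r) * (exp (\<Phi> x) * exp (z r)) - of_real (1 / real r) * exp (\<Phi> x) =
       of_real (1 / real r) * R1 r + exp (\<Phi> x) * (of_real (1 / real r) * R2 r)
        + exp (\<Phi> x) * (of_real (1 / real r) * (y r + y r ^ 2 / 2))"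
      unfolding R1_def by (simp only: ring_distribs mult_ac mult_1_left mult_1_right)
  qed
  also have "\<dots> + exp (\<Phi> x) * (\<i> * of_real d) = cjump_sum N (\<lambda>r. R1 r)
      + exp (\<Phi> x) * cjump_sum N (\<lambda>r. R2 r)
      + exp (\<Phi> x) * (cjump_sum N (\<lambda>r. y r + y r ^ 2 / 2) + \<i> * of_real d)"
    by (simp only: sum.distrib sum_distrib_left[symmetric] distrib_left add.assoc)
  finally have split: "cjump_sum N (\<lambda>r. exp (\<i> * of_real (s + tt r)) * exp (\<Phi> (harm (N - r))))
      - (of_real (harm N) - \<i> * of_real d) * exp (\<Phi> (harm N)) =
      cjump_sum N (\<lambda>r. R1 r) + exp (\<Phi> x) * cjump_sum N (\<lambda>r. R2 r)
      + exp (\<Phi> x) * (cjump_sum N (\<lambda>r. y r + y r ^ 2 / 2) + \<i> * of_real d)" .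
  have S3: "jump_sum N (\<lambda>r. D r ^ 3) \<le> 8" "jump_sum N (\<lambda>r. D r ^ 2) \<le> 3"
    unfolding D_def by (rule jump_third_moment_le jump_second_moment_le)+
  have b1: "norm (cjump_sum N (\<lambda>r. R1 r)) \<le> (8 * A ^ 3 * (1 + real j) + 128 * B ^ 3) * \<eta> ^ 3"
  proof -
    have "norm (of_real (1 / real r) * R1 r) \<le>
        (8 * \<bar>s\<bar> ^ 3) * (1 / real r) + 8 * ((1 / real r) * \<bar>tt r\<bar> ^ 3) + (16 * B ^ 3 * \<eta> ^ 3) * ((1 / real r) * D r ^ 3)"
      for r
    proof -
      have nn: "0 \<le> 2 * B * \<eta> * D r" using D(1)[of r] B_ge eta by simp
      have "norm (R1 r) \<le> (\<bar>s\<bar> + \<bar>tt r\<bar> + 2 * B * \<eta> * D r) ^ 3 / 2"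
        unfolding R1_def z_def y_def by (rule exp_expansion_le(1)[OF x D])
      also have "\<dots> \<le> 4 * ((\<bar>s\<bar> + \<bar>tt r\<bar>) ^ 3 + (2 * B * \<eta> * D r) ^ 3) / 2"
        using nn by (intro divide_right_mono power3_add_le) auto
      also have "\<dots> \<le> 4 * (4 * (\<bar>s\<bar> ^ 3 + \<bar>tt r\<bar> ^ 3) + (2 * B * \<eta> * D r) ^ 3) / 2"
        by (intro divide_right_mono mult_left_mono add_mono power3_add_le) auto
      also have "\<dots> = 8 * \<bar>s\<bar> ^ 3 + 8 * \<bar>tt r\<bar> ^ 3 + 16 * B ^ 3 * \<eta> ^ 3 * D r ^ 3"
        by (simp add: power_mult_distrib)
      finally have "(1 / real r) * norm (R1 r) \<le> (1 / real r) * (8 * \<bar>s\<bar> ^ 3 + 8 * \<bar>tt r\<bar> ^ 3 + 16 * B ^ 3 * \<eta> ^ 3 * D r ^ 3)"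
        by (intro mult_left_mono) auto
      then show ?thesis
        unfolding norm_mult norm_of_real by (simp add: algebra_simps add_divide_distrib)
    qed
    then have "norm (cjump_sum N (\<lambda>r. R1 r)) \<le>
       (\<Sum>r=1..N. (8 * \<bar>s\<bar> ^ 3) * (1 / real r) + 8 * ((1 / real r) * \<bar>tt r\<bar> ^ 3) + (16 * B ^ 3 * \<eta> ^ 3) * ((1 / real r) * D r ^ 3))"
      by (intro order_trans[OF norm_sum] sum_mono)
    also have "\<dots> = 8 * (\<bar>s\<bar> ^ 3 * x) + 8 * jump_sum N (\<lambda>r. \<bar>tt r\<bar> ^ 3)
        + (16 * B ^ 3 * \<eta> ^ 3) * jump_sum N (\<lambda>r. D r ^ 3)"
      by (simp only: sum.distrib sum_distrib_left[symmetric] sum_reciprocal x_def mult.assoc)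
    also have "\<dots> \<le> 8 * (A ^ 3 * \<eta> ^ 3) + 8 * (A ^ 3 * \<eta> ^ 3 * real j) + (16 * B ^ 3 * \<eta> ^ 3) * 8"
    proof (intro add_mono mult_left_mono S3)
      have sx: "\<bar>s\<bar> * x \<le> \<bar>s\<bar> * X" using x by (intro mult_left_mono) auto
      have "(\<bar>s\<bar> * x) * (\<bar>s\<bar> ^ 2) \<le> (A * \<eta>) * (A * \<eta>) ^ 2"
      proof (rule mult_mono)
        have "\<bar>s\<bar> \<le> A * \<eta>" using s_le eta_powers(2) A by (meson mult_left_mono order_trans zero_le_one)
        then show "\<bar>s\<bar> ^ 2 \<le> (A * \<eta>) ^ 2" by (intro power_mono) auto
      qed (use sx sX_le A eta x in auto)
      then show "\<bar>s\<bar> ^ 3 * x \<le> A ^ 3 * \<eta> ^ 3"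
        by (simp add: power3_eq_cube power2_eq_square mult_ac)
      have "\<bar>\<Sum>r=1..N. (1 / real r) * \<bar>tt r\<bar> ^ 3\<bar> \<le> A ^ 3 * \<eta> ^ 3 * real j"
      proof (rule marked_sum_le)
        show "\<bar>tt r\<bar> ^ 3 = (if r \<in> {1..j} then \<bar>tt r\<bar> ^ 3 else 0)" for r by (auto simp: tt_def)
        show "\<bar>\<bar>tt r\<bar> ^ 3\<bar> \<le> A ^ 3 * \<eta> ^ 3" for r
          using power_mono[OF tt_le[of r], of 3] by (simp add: power_mult_distrib)
      qed (use A eta in auto)
      then show "jump_sum N (\<lambda>r. \<bar>tt r\<bar> ^ 3) \<le> A ^ 3 * \<eta> ^ 3 * real j" by linarith
    qed (use B_ge eta in auto)
    finally show ?thesis by (simp add: algebra_simps)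
  qed
  have b2: "norm (cjump_sum N (\<lambda>r. R2 r)) \<le> (3 * B + B * (6 * A + 12 * B)) * \<eta> ^ 3"
  proof -
    have "norm (of_real (1 / real r) * R2 r) \<le>
        (B * \<eta> ^ 3 * (1 + 2 * A)) * ((1 / real r) * D r ^ 2) + (B * \<eta> ^ 3 * (3 * B / 2)) * ((1 / real r) * D r ^ 3)" for r
    proof -
      have "norm (R2 r) \<le> B * \<eta> ^ 3 * D r ^ 2 + B * \<eta> ^ 3 * D r ^ 2 * (4 * A + 3 * B * D r) / 2"
        unfolding R2_def z_def y_def by (rule exp_expansion_le(2)[OF x D])
      also have "\<dots> = (B * \<eta> ^ 3 * (1 + 2 * A)) * D r ^ 2 + (B * \<eta> ^ 3 * (3 * B / 2)) * D r ^ 3"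
        by (simp add: power2_eq_square power3_eq_cube field_simps)
      finally have "(1 / real r) * norm (R2 r) \<le> (1 / real r) * ((B * \<eta> ^ 3 * (1 + 2 * A)) * D r ^ 2 + (B * \<eta> ^ 3 * (3 * B / 2)) * D r ^ 3)"
        by (intro mult_left_mono) auto
      then show ?thesis
        unfolding norm_mult norm_of_real by (simp add: algebra_simps add_divide_distrib)
    qed
    then have "norm (cjump_sum N (\<lambda>r. R2 r)) \<le>
       (\<Sum>r=1..N. (B * \<eta> ^ 3 * (1 + 2 * A)) * ((1 / real r) * D r ^ 2) + (B * \<eta> ^ 3 * (3 * B / 2)) * ((1 / real r) * D r ^ 3))"
      by (intro order_trans[OF norm_sum] sum_mono)
    also have "\<dots> = (B * \<eta> ^ 3 * (1 + 2 * A)) * jump_sum N (\<lambda>r. D r ^ 2)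
       + (B * \<eta> ^ 3 * (3 * B / 2)) * jump_sum N (\<lambda>r. D r ^ 3)"
      by (simp only: sum.distrib sum_distrib_left[symmetric])
    also have "\<dots> \<le> (B * \<eta> ^ 3 * (1 + 2 * A)) * 3 + (B * \<eta> ^ 3 * (3 * B / 2)) * 8"
      using B_ge A eta by (intro add_mono mult_left_mono S3) auto
    finally show ?thesis by (simp add: algebra_simps)
  qed
  note b3 = quadratic_expansion_le[OF N, folded D_def, folded x_def, folded y_def]
  define E where "E = \<eta> ^ 3 + \<eta> ^ 2 * \<bar>euler_sum N - 2 * zeta 3\<bar> + \<eta> * (x / real (Suc N))"
  have E: "\<eta> ^ 3 \<le> E" using eta x by (simp add: E_def)
  have F: "norm (exp (\<Phi> x)) \<le> 1" using Re_\<Phi>_nonpos[OF x(1)] by simp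
  have F': "norm (exp (\<Phi> x) * w) \<le> norm w" for w
    unfolding norm_mult using F by (intro mult_left_le_one_le) auto
  have "norm (cjump_sum N (\<lambda>r. R1 r) + exp (\<Phi> x) * cjump_sum N (\<lambda>r. R2 r)
      + exp (\<Phi> x) * (cjump_sum N (\<lambda>r. y r + y r ^ 2 / 2) + \<i> * of_real d))
    \<le> norm (cjump_sum N (\<lambda>r. R1 r)) + norm (cjump_sum N (\<lambda>r. R2 r))
      + norm (cjump_sum N (\<lambda>r. y r + y r ^ 2 / 2) + \<i> * of_real d)"
    by (intro order_trans[OF norm_triangle_ineq] add_mono F' order_refl)
  also have "\<dots> \<le> (8 * A ^ 3 * (1 + real j) + 128 * B ^ 3) * E + (3 * B + B * (6 * A + 12 * B)) * E
     + (2 * B + A * real j * real j + A ^ 2 * real j * real j + A ^ 2 + A ^ 2 * real j + 2 * A * B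
       + A * B * real j * (real j + 1) + B ^ 2 + 2 * (B ^ 2 + 4 * A * B)) * E"
    using b3 A B_ge E unfolding E_def[symmetric]
    by (intro add_mono order_trans[OF b1] order_trans[OF b2] mult_left_mono) auto
  also have "\<dots> = err_const * E"
    by (simp only: err_const_def distrib_right)
  finally show ?thesis unfolding split E_def x_def .
qed

lemma err_const_nonneg: "0 \<le> err_const"
  unfolding err_const_def using A B_ge by (intro add_nonneg_nonneg mult_nonneg_nonneg) auto

text \<open>
  The comparison principle for the difference of the exact and the approximate solution: the factors
  \<open>exp (i (s + tt r))\<close> have modulus \<open>1\<close> and \<open>|h\<^bsub>N\<^esub> - i d| \<ge> h\<^bsub>N\<^esub>\<close>, so the recursion for the difference
  becomes an inequality with the plain jump rates.
\<close>
lemma deviation_le: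
  fixes G :: "nat \<Rightarrow> complex"
  assumes G0: "G 0 = 1"
    and G: "\<And>N. 1 \<le> N \<Longrightarrow> (of_real (harm N) - \<i> * of_real d) * G N =
      cjump_sum N (\<lambda>r. exp (\<i> * of_real (s + tt r)) * G (N - r))"
    and n: "harm n \<le> X"
    and K: "0 \<le> \<delta>" "0 \<le> K" "\<And>N. 1 \<le> N \<Longrightarrow>
      \<bar>euler_sum N - 2 * zeta 3\<bar> \<le> \<delta> + K * (harm N / real (Suc N))"
  shows "norm (G n - exp (\<Phi> (harm n))) \<le>
    err_const * (\<eta> ^ 3 + \<eta> ^ 2 * \<delta>) * harm n + err_const * (\<eta> + \<eta> ^ 2 * K)"
proof -
  note C = err_const_nonneg
  show ?thesis
  proof (rule jump_comparison[where e = "\<lambda>N. norm (G N - exp (\<Phi> (harm N)))"])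
    show "norm (G 0 - exp (\<Phi> (harm 0))) \<le> 0" by (simp add: G0 \<Phi>_0 harm_expand)
    show "0 \<le> err_const * (\<eta> ^ 3 + \<eta> ^ 2 * \<delta>)" "0 \<le> err_const * (\<eta> + \<eta> ^ 2 * K)"
      using C eta K by auto
    fix N assume N: "1 \<le> N" "N \<le> n"
    define F where "F N = exp (\<Phi> (harm N))" for N
    define u where "u = harm N / real (Suc N)"
    define R where "R = cjump_sum N (\<lambda>r. exp (\<i> * of_real (s + tt r)) * F (N - r))
      - (of_real (harm N) - \<i> * of_real d) * F N"
    have hN: "harm N \<le> X" using harm_mono[OF N(2), where ?'a=real] n by linarith
    have u: "0 \<le> u" by (simp add: u_def harm_nonneg)
    have "harm N = \<bar>Re (of_real (harm N) - \<i> * of_real d)\<bar>" by (simp add: harm_nonneg)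
    also have "\<dots> \<le> norm (of_real (harm N) - \<i> * of_real d)" by (rule abs_Re_le_cmod)
    finally have "harm N * norm (G N - F N) \<le> norm ((of_real (harm N) - \<i> * of_real d) * (G N - F N))"
      unfolding norm_mult by (intro mult_right_mono) auto
    also have "(of_real (harm N) - \<i> * of_real d) * (G N - F N) =
      cjump_sum N (\<lambda>r. exp (\<i> * of_real (s + tt r)) * (G (N - r) - F (N - r))) + R"
      unfolding right_diff_distrib G[OF N(1)] sum_subtractf R_def by simp
    also have "norm \<dots> \<le> (\<Sum>r=1..N. norm (of_real (1 / real r) * (exp (\<i> * of_real (s + tt r)) * (G (N - r) - F (N - r)))))
        + norm R"
      by (intro order_trans[OF norm_triangle_ineq] add_right_mono norm_sum)
    also have "(\<Sum>r=1..N. norm (of_real (1 / real r) * (exp (\<i> * of_real (s + tt r)) * (G (N - r) - F (N - r))))) =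
        jump_sum N (\<lambda>r. norm (G (N - r) - F (N - r)))"
      by (intro sum.cong refl) (simp add: norm_mult norm_divide)
    also have "norm R \<le> err_const * (\<eta> ^ 3 + \<eta> ^ 2 * (\<delta> + K * u) + \<eta> * u)"
      unfolding R_def F_def
      by (rule order_trans[OF residual_le[OF N(1) hN]])
         (use C eta K(3)[OF N(1)] in \<open>auto intro!: mult_left_mono simp: u_def simp del: of_nat_Suc\<close>)
    also have "\<dots> = err_const * (\<eta> ^ 3 + \<eta> ^ 2 * \<delta>) + err_const * (\<eta> + \<eta> ^ 2 * K) * u"
      by (simp add: algebra_simps)
    finally show "harm N * norm (G N - exp (\<Phi> (harm N))) \<le>
      jump_sum N (\<lambda>r. norm (G (N - r) - exp (\<Phi> (harm (N - r)))))
      + err_const * (\<eta> ^ 3 + \<eta> ^ 2 * \<delta>) + err_const * (\<eta> + \<eta> ^ 2 * K) * (harm N / real (Suc N))"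
      unfolding F_def u_def by (simp add: add.assoc)
  qed
qed

end

section \<open>The limit of the solution of the recursion\<close>

text \<open>
  Convergence of the second moment, put into the form in which the comparison principle uses it: the
  finitely many \<open>N\<close> where the error exceeds \<open>\<delta>\<close> are absorbed by the multiple of
  \<open>h\<^bsub>N\<^esub> / (N + 1)\<close>.
\<close>
lemma jump_variance_tail:
  assumes "0 < \<delta>"
  obtains K where "0 \<le> K" "\<And>N. 1 \<le> N \<Longrightarrow>
      \<bar>euler_sum N - 2 * zeta 3\<bar> \<le> \<delta> + K * (harm N / real (Suc N))"
proof -
  obtain M where M: "\<And>N. N \<ge> M \<Longrightarrow> \<bar>euler_sum N - 2 * zeta 3\<bar> < \<delta>"
    using euler_sum_limit assms unfolding LIMSEQ_def dist_real_def by blast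
  have K: "\<bar>euler_sum N - 2 * zeta 3\<bar> \<le> \<delta> + 7 * real (Suc M) * (harm N / real (Suc N))"
    if N: "1 \<le> N" for N
  proof (cases "N \<ge> M")
    case True
    have "0 \<le> 7 * real (Suc M) * (harm N / real (Suc N))" by (simp add: harm_nonneg)
    then show ?thesis using M[OF True] by linarith
  next
    case False
    have "harm N \<ge> (harm 1 :: real)" using N by (intro harm_mono) auto
    then have "real (Suc N) * 1 \<le> real (Suc M) * harm N"
      using False by (intro mult_mono) (auto simp: harm_expand)
    then have "1 \<le> real (Suc M) * (harm N / real (Suc N))" by (simp add: field_simps)
    moreover have "0 \<le> euler_sum N"
      by (intro sum_nonneg divide_nonneg_nonneg harm_nonneg) auto
    moreover have "euler_sum N \<le> 3"
      using jump_second_moment_le[of N] unfolding jump_second_moment .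
    ultimately show ?thesis using zeta_3_ge_0 zeta_3_le_2 assms by linarith
  qed
  show ?thesis by (rule that[OF _ K]) auto
qed

text \<open>
  The characteristic function of \<open>s\<close> times the number of jumps plus \<open>d\<close> times the duration plus the
  sum of \<open>t r\<close> over the jump sizes \<open>r\<close>, for the path started from \<open>N + 1\<close> elements: an exponential
  time of rate \<open>h = h\<^bsub>N\<^esub>\<close> contributes the factor \<open>h / (h - i d)\<close>, and \<open>h\<close> cancels with the
  normalisation of the jump law.
\<close>
function path_transform :: "real \<Rightarrow> real \<Rightarrow> (nat \<Rightarrow> real) \<Rightarrow> nat \<Rightarrow> complex" where
  "path_transform s d t N = (if N = 0 then 1 else
     (cjump_sum N (\<lambda>r. exp (\<i> * of_real (s + t r)) * path_transform s d t (N - r)))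
       / (of_real (harm N) - \<i> * of_real d))"
  by pat_completeness auto
termination by (relation "Wellfounded.measure (\<lambda>(s, d, t, N). N)") auto

declare path_transform.simps [simp del]

lemma path_transform_rec:
  assumes "1 \<le> N"
  shows "(of_real (harm N) - \<i> * of_real d) * path_transform s d t N =
     cjump_sum N (\<lambda>r. exp (\<i> * of_real (s + t r)) * path_transform s d t (N - r))"
proof -
  have "harm N \<noteq> (0::real)" using assms harm_pos[of N, where ?'a=real] by linarith
  then have "of_real (harm N) - \<i> * of_real d \<noteq> 0" unfolding complex_eq_iff by simp
  then show ?thesis using assms by (subst path_transform.simps) simp
qed

lemma path_transform_0: "path_transform s d t 0 = 1"
  by (simp add: path_transform.simps)

lemma harm_asymptotics:
  "(\<lambda>n. harm (n - 1) / ln (real n)) \<longlonglongrightarrow> (1::real)"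
  "(\<lambda>n. (harm (n - 1) - ln (real n)) / sqrt (ln (real n))) \<longlonglongrightarrow> (0::real)"
  "\<forall>\<^sub>F n in sequentially. harm (n - 1) \<le> 2 * ln (real n)"
proof -
  have diff: "(\<lambda>n. harm (n - 1) - ln (real n)) \<longlonglongrightarrow> (euler_mascheroni :: real)"
  proof (rule Lim_transform_eventually)
    show "(\<lambda>n. (harm n - ln (real n)) - 1 / real n) \<longlonglongrightarrow> (euler_mascheroni :: real)"
      using tendsto_diff[OF euler_mascheroni_LIMSEQ lim_1_over_n] by simp
    have "harm n - ln (real n) - 1 / real n = harm (n - 1) - ln (real n)" if "n \<ge> 1" for n
      using that harm_Suc[of "n - 1", where ?'a=real] by (simp add: inverse_eq_divide)
    then show "\<forall>\<^sub>F n in sequentially. harm n - ln (real n) - 1 / real n = harm (n - 1) - ln (real n)"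
      by (rule eventually_sequentiallyI)
  qed
  have "(\<lambda>n. 1 + (harm (n - 1) - ln (real n)) * (1 / ln (real n))) \<longlonglongrightarrow> 1 + euler_mascheroni * (0::real)"
    by (intro tendsto_intros diff) real_asymp
  moreover have "1 + (harm (n - 1) - ln (real n)) * (1 / ln (real n)) = harm (n - 1) / ln (real n)" if "n \<ge> 2" for n
    using that by (simp add: field_simps)
  ultimately show lim: "(\<lambda>n. harm (n - 1) / ln (real n)) \<longlonglongrightarrow> (1::real)"
    by (auto intro: Lim_transform_eventually eventually_sequentiallyI)
  have "(\<lambda>n. (harm (n - 1) - ln (real n)) * (1 / sqrt (ln (real n)))) \<longlonglongrightarrow> euler_mascheroni * (0::real)"
    by (intro tendsto_intros diff) real_asymp
  then show "(\<lambda>n. (harm (n - 1) - ln (real n)) / sqrt (ln (real n))) \<longlonglongrightarrow> (0::real)"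
    by simp
  have "\<forall>\<^sub>F n in sequentially. harm (n - 1) / ln (real n) < 2"
    using lim by (rule order_tendstoD) simp
  then show "\<forall>\<^sub>F n in sequentially. harm (n - 1) \<le> 2 * ln (real n)"
    using eventually_ge_at_top[of "2::nat"]
  proof eventually_elim
    case (elim n)
    then have "0 < ln (real n)" by simp
    with elim show ?case by (simp add: divide_less_eq)
  qed
qed

text \<open>
  By \<open>deviation_le\<close> the difference is at most a constant times
  \<open>(\<eta>\<^sup>3 + \<eta>\<^sup>2 \<delta>) h\<^bsub>n-1\<^esub> + \<eta> + \<eta>\<^sup>2 K\<close>. As \<open>h\<^bsub>n-1\<^esub>\<close> is of order \<open>\<eta>\<^sup>-\<^sup>2\<close>, this tends to a multiple
  of \<open>\<delta>\<close>, which is arbitrary.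
\<close>
lemma path_transform_deviation:
  fixes \<theta>1 \<theta>2 :: real and \<tau> :: "nat \<Rightarrow> real" and j :: nat
  defines "\<eta> \<equiv> \<lambda>n. 1 / sqrt (ln (real n))"
  defines "\<kappa>0 \<equiv> \<theta>2 + (\<Sum>r=1..j. \<tau> r / real r)" and "V \<equiv> \<Sum>r=1..j. \<tau> r ^ 2 / real r"
  shows "(\<lambda>n. path_transform (\<theta>1 * \<eta> n ^ 3) (\<theta>2 * \<eta> n) (\<lambda>r. if r \<in> {1..j} then \<tau> r * \<eta> n else 0) (n - 1)
      - exp (limit_exponent (\<theta>1 * \<eta> n ^ 3) (\<kappa>0 * \<eta> n) (V * \<eta> n ^ 2) (harm (n - 1)))) \<longlonglongrightarrow> 0"
    (is "?E \<longlonglongrightarrow> 0")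
proof -
  define A where "A = 1 + 2 * \<bar>\<theta>1\<bar> + \<bar>\<kappa>0\<bar> + (\<Sum>r=1..j. \<bar>\<tau> r\<bar>)"
  \<comment> \<open>the modulus makes \<open>C \<ge> 0\<close> available outside the locale\<close>
  define C where "C = \<bar>small_frequencies.err_const j A\<bar>"
  have sum_nn: "0 \<le> (\<Sum>r=1..j. \<bar>\<tau> r\<bar>)" by (intro sum_nonneg) auto
  have ln_ge: "1 \<le> ln (real n)" if "3 \<le> n" for n
  proof -
    have "exp 1 \<le> real n" using exp_le that by linarith
    then show ?thesis by (metis exp_gt_zero ln_exp ln_mono order_less_le_trans)
  qed
  have loc: "small_frequencies (\<theta>1 * \<eta> n ^ 3) (\<theta>2 * \<eta> n) (\<lambda>r. \<tau> r * \<eta> n) j A (\<eta> n) (harm (n - 1))"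
    if n: "3 \<le> n" "harm (n - 1) \<le> 2 * ln (real n)" for n
  proof
    have l: "1 \<le> ln (real n)" by (rule ln_ge[OF n(1)])
    have e: "0 < \<eta> n" "\<eta> n \<le> 1" "\<eta> n ^ 2 * ln (real n) = 1"
      using l by (auto simp: \<eta>_def power_divide)
    show "1 \<le> A" using sum_nn by (simp add: A_def)
    show "0 < \<eta> n" "\<eta> n \<le> 1" by (rule e)+
    have "\<bar>\<theta>1\<bar> \<le> A" using sum_nn by (simp add: A_def)
    then show "\<bar>\<theta>1 * \<eta> n ^ 3\<bar> \<le> A * \<eta> n ^ 3" using e by (simp add: abs_mult)
    have "\<bar>\<theta>1 * \<eta> n ^ 3\<bar> * harm (n - 1) \<le> \<bar>\<theta>1 * \<eta> n ^ 3\<bar> * (2 * ln (real n))"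
      using n by (intro mult_left_mono) auto
    also have "\<dots> = 2 * \<bar>\<theta>1\<bar> * \<eta> n * (\<eta> n ^ 2 * ln (real n))"
      using e(1) by (simp add: abs_mult power3_eq_cube power2_eq_square)
    also have "\<dots> \<le> A * \<eta> n" unfolding e(3) using e(1) sum_nn by (simp add: A_def)
    finally show "\<bar>\<theta>1 * \<eta> n ^ 3\<bar> * harm (n - 1) \<le> A * \<eta> n" .
    have k: "\<theta>2 * \<eta> n + (\<Sum>r=1..j. \<tau> r * \<eta> n / real r) = \<kappa>0 * \<eta> n"
      by (simp add: \<kappa>0_def sum_distrib_right distrib_right)
    have "\<bar>\<kappa>0\<bar> \<le> A" using sum_nn by (simp add: A_def)
    then show "\<bar>\<theta>2 * \<eta> n + (\<Sum>r=1..j. \<tau> r * \<eta> n / real r)\<bar> \<le> A * \<eta> n"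
      unfolding k using e by (simp add: abs_mult)
    fix r assume "r \<in> {1..j}"
    then have "\<bar>\<tau> r\<bar> \<le> (\<Sum>r=1..j. \<bar>\<tau> r\<bar>)" by (intro member_le_sum) auto
    then have "\<bar>\<tau> r\<bar> \<le> A" by (simp add: A_def)
    then show "\<bar>\<tau> r * \<eta> n\<bar> \<le> A * \<eta> n" using e by (simp add: abs_mult)
  qed
  have bound: "norm (?E n) \<le> 2 * C * \<eta> n + 2 * C * \<delta> + C * (\<eta> n + \<eta> n ^ 2 * K)"
    if n: "3 \<le> n" "harm (n - 1) \<le> 2 * ln (real n)" and K: "0 < \<delta>" "0 \<le> K"
      "\<And>N. 1 \<le> N \<Longrightarrow> \<bar>euler_sum N - 2 * zeta 3\<bar> \<le> \<delta> + K * (harm N / real (Suc N))"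
    for n \<delta> K
  proof -
    interpret small_frequencies "\<theta>1 * \<eta> n ^ 3" "\<theta>2 * \<eta> n" "\<lambda>r. \<tau> r * \<eta> n" j A "\<eta> n" "harm (n - 1)"
      "\<theta>2 * \<eta> n + (\<Sum>r=1..j. \<tau> r * \<eta> n / real r)" "\<Sum>r=1..j. (\<tau> r * \<eta> n) ^ 2 / real r"
      using loc[OF n] .
    have k: "\<theta>2 * \<eta> n + (\<Sum>r=1..j. \<tau> r * \<eta> n / real r) = \<kappa>0 * \<eta> n"
      by (simp add: \<kappa>0_def sum_distrib_right distrib_right)
    have v: "(\<Sum>r=1..j. (\<tau> r * \<eta> n) ^ 2 / real r) = V * \<eta> n ^ 2"
      by (simp add: V_def sum_distrib_right power_mult_distrib)
    have tt: "tt = (\<lambda>r. if r \<in> {1..j} then \<tau> r * \<eta> n else 0)"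
      by (auto simp: tt_def)
    have l: "1 \<le> ln (real n)" by (rule ln_ge[OF n(1)])
    have e: "0 < \<eta> n" "\<eta> n \<le> 1" "\<eta> n ^ 2 * ln (real n) = 1"
      using l by (auto simp: \<eta>_def power_divide)
    have C: "C = err_const" using err_const_nonneg by (simp add: C_def)
    have "norm (path_transform (\<theta>1 * \<eta> n ^ 3) (\<theta>2 * \<eta> n) tt (n - 1) -
        exp (limit_exponent (\<theta>1 * \<eta> n ^ 3) (\<kappa>0 * \<eta> n) (V * \<eta> n ^ 2) (harm (n - 1)))) \<le>
      C * (\<eta> n ^ 3 + \<eta> n ^ 2 * \<delta>) * harm (n - 1) + C * (\<eta> n + \<eta> n ^ 2 * K)"
      using deviation_le[of "path_transform (\<theta>1 * \<eta> n ^ 3) (\<theta>2 * \<eta> n) tt", unfolded k v,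
          OF path_transform_0 path_transform_rec order_refl _ K(2,3), folded C] K(1) by simp
    also have "C * (\<eta> n ^ 3 + \<eta> n ^ 2 * \<delta>) * harm (n - 1) \<le> C * (\<eta> n ^ 3 + \<eta> n ^ 2 * \<delta>) * (2 * ln (real n))"
      using e K n by (intro mult_left_mono) (auto simp: C_def)
    also have "\<dots> = 2 * C * (\<eta> n + \<delta>) * (\<eta> n ^ 2 * ln (real n))"
      by (simp add: power2_eq_square power3_eq_cube algebra_simps)
    finally show ?thesis unfolding tt e(3) by (simp add: algebra_simps)
  qed
  have eta0: "\<eta> \<longlonglongrightarrow> 0" unfolding \<eta>_def by real_asymp
  have "0 \<le> C" by (simp add: C_def)
  show ?thesis
  proof (rule tendstoI)
    fix \<epsilon> :: real assume "0 < \<epsilon>"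
    define \<delta> where "\<delta> = \<epsilon> / (4 * (C + 1))"
    have \<delta>: "0 < \<delta>" "2 * C * \<delta> < \<epsilon>"
    proof -
      show "0 < \<delta>" using \<open>0 < \<epsilon>\<close> \<open>0 \<le> C\<close> by (simp add: \<delta>_def)
      have "2 * C * \<epsilon> \<le> 2 * (C + 1) * \<epsilon>" using \<open>0 < \<epsilon>\<close> by simp
      also have "\<dots> < 4 * (C + 1) * \<epsilon>" using \<open>0 < \<epsilon>\<close> \<open>0 \<le> C\<close> by (intro mult_strict_right_mono) auto
      finally show "2 * C * \<delta> < \<epsilon>" using \<open>0 \<le> C\<close> by (simp add: \<delta>_def field_simps)
    qed
    obtain K where K: "0 \<le> K" "\<And>N. 1 \<le> N \<Longrightarrow>
      \<bar>euler_sum N - 2 * zeta 3\<bar> \<le> \<delta> + K * (harm N / real (Suc N))"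
      using jump_variance_tail[OF \<delta>(1)] by blast
    have "(\<lambda>n. 2 * C * \<eta> n + 2 * C * \<delta> + C * (\<eta> n + \<eta> n ^ 2 * K)) \<longlonglongrightarrow> 2 * C * 0 + 2 * C * \<delta> + C * (0 + 0 ^ 2 * K)"
      by (intro tendsto_intros eta0)
    then have "\<forall>\<^sub>F n in sequentially. 2 * C * \<eta> n + 2 * C * \<delta> + C * (\<eta> n + \<eta> n ^ 2 * K) < \<epsilon>"
      using \<delta>(2) by (auto dest: order_tendstoD)
    then show "\<forall>\<^sub>F n in sequentially. dist (?E n) 0 < \<epsilon>"
      using eventually_ge_at_top[of "3::nat"] harm_asymptotics(3)
    proof eventually_elim
      case (elim n)
      then show ?case using bound[of n \<delta> K] \<delta>(1) K by (simp add: dist_norm)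
    qed
  qed
qed

text \<open>
  The exponent at \<open>h\<^bsub>n-1\<^esub>\<close>, with the centering removed, depends on \<open>n\<close> only through
  \<open>\<rho> = h\<^bsub>n-1\<^esub> / log n\<close> and \<open>\<epsilon> = (h\<^bsub>n-1\<^esub> - log n) / (log n)\<^sup>1\<^sup>/\<^sup>2\<close>, which tend to \<open>1\<close> and \<open>0\<close>.
\<close>
lemma path_transform_limit:
  fixes \<theta>1 \<theta>2 :: real and \<tau> :: "nat \<Rightarrow> real" and j :: nat
  defines "\<eta> \<equiv> \<lambda>n. 1 / sqrt (ln (real n))"
  defines "\<kappa>0 \<equiv> \<theta>2 + (\<Sum>r=1..j. \<tau> r / real r)" and "V \<equiv> \<Sum>r=1..j. \<tau> r ^ 2 / real r"
  shows "(\<lambda>n. exp (- \<i> * of_real ((\<theta>1 * \<eta> n ^ 3 * ln (real n) ^ 2 / 2 + \<kappa>0 * \<eta> n * ln (real n)) / zeta 2)) *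
      path_transform (\<theta>1 * \<eta> n ^ 3) (\<theta>2 * \<eta> n) (\<lambda>r. if r \<in> {1..j} then \<tau> r * \<eta> n else 0) (n - 1))
    \<longlonglongrightarrow> exp (- of_real (V / (2 * zeta 2) + zeta 3 / zeta 2 ^ 3 * (\<theta>1 ^ 2 / 3 + \<theta>1 * \<kappa>0 + \<kappa>0 ^ 2)))"
proof -
  define c where "c n = - \<i> * complex_of_real ((\<theta>1 * \<eta> n ^ 3 * ln (real n) ^ 2 / 2 + \<kappa>0 * \<eta> n * ln (real n)) / zeta 2)" for n
  define P where "P n = path_transform (\<theta>1 * \<eta> n ^ 3) (\<theta>2 * \<eta> n) (\<lambda>r. if r \<in> {1..j} then \<tau> r * \<eta> n else 0) (n - 1)" for n
  define \<Phi> where "\<Phi> n = limit_exponent (\<theta>1 * \<eta> n ^ 3) (\<kappa>0 * \<eta> n) (V * \<eta> n ^ 2) (harm (n - 1))" for n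
  define \<rho> where "\<rho> n = (harm (n - 1) / ln (real n) :: real)" for n
  define \<epsilon> where "\<epsilon> n = ((harm (n - 1) - ln (real n)) / sqrt (ln (real n)) :: real)" for n
  have "norm (exp (c n)) = 1" for n by (simp add: c_def)
  then have "norm (exp (c n) * (P n - exp (\<Phi> n))) = norm (P n - exp (\<Phi> n))" for n
    by (simp add: norm_mult)
  moreover have "(\<lambda>n. P n - exp (\<Phi> n)) \<longlonglongrightarrow> 0"
    unfolding P_def \<Phi>_def \<eta>_def \<kappa>0_def V_def by (rule path_transform_deviation)
  ultimately have dev: "(\<lambda>n. exp (c n) * (P n - exp (\<Phi> n))) \<longlonglongrightarrow> 0"
    using tendsto_norm_zero[of "\<lambda>n. P n - exp (\<Phi> n)"] by (subst tendsto_norm_zero_iff[symmetric]) simp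
  have eq: "\<i> * of_real ((\<theta>1 * \<epsilon> n * (\<rho> n + 1) / 2 + \<kappa>0 * \<epsilon> n) / zeta 2)
      - of_real (V * \<rho> n / (2 * zeta 2) + zeta 3 / zeta 2 ^ 3 * (\<theta>1 ^ 2 * \<rho> n ^ 3 / 3 + \<theta>1 * \<kappa>0 * \<rho> n ^ 2 + \<kappa>0 ^ 2 * \<rho> n))
      = c n + \<Phi> n" if n: "2 \<le> n" for n
  proof -
    define h where "h = (harm (n - 1) :: real)"
    define w where "w = sqrt (ln (real n))"
    have w: "w > 0" "ln (real n) = w ^ 2" using n by (auto simp: w_def)
    have e: "\<eta> n = 1 / w" "\<rho> n = h / w ^ 2" "\<epsilon> n = (h - w ^ 2) / w"
      using w by (auto simp: \<eta>_def \<rho>_def \<epsilon>_def h_def w_def[symmetric])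
    have 1: "\<theta>1 * \<epsilon> n * (\<rho> n + 1) / 2 + \<kappa>0 * \<epsilon> n =
       (\<theta>1 * \<eta> n ^ 3 * h ^ 2 / 2 + \<kappa>0 * \<eta> n * h) - (\<theta>1 * \<eta> n ^ 3 * ln (real n) ^ 2 / 2 + \<kappa>0 * \<eta> n * ln (real n))"
      unfolding e w(2) using w(1) by (simp add: field_simps power3_eq_cube power2_eq_square)
    have 2: "V * \<rho> n = V * \<eta> n ^ 2 * h" "\<theta>1 ^ 2 * \<rho> n ^ 3 = (\<theta>1 * \<eta> n ^ 3) ^ 2 * h ^ 3"
      "\<theta>1 * \<kappa>0 * \<rho> n ^ 2 = \<theta>1 * \<eta> n ^ 3 * (\<kappa>0 * \<eta> n) * h ^ 2" "\<kappa>0 ^ 2 * \<rho> n = (\<kappa>0 * \<eta> n) ^ 2 * h"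
      unfolding e using w(1) by (simp_all add: field_simps power3_eq_cube power2_eq_square)
    show ?thesis
      unfolding 1 2 c_def \<Phi>_def limit_exponent_def h_def[symmetric]
      by (simp add: diff_divide_distrib add_divide_distrib algebra_simps)
  qed
  have "(\<lambda>n. \<i> * of_real ((\<theta>1 * \<epsilon> n * (\<rho> n + 1) / 2 + \<kappa>0 * \<epsilon> n) / zeta 2)
      - of_real (V * \<rho> n / (2 * zeta 2) + zeta 3 / zeta 2 ^ 3 * (\<theta>1 ^ 2 * \<rho> n ^ 3 / 3 + \<theta>1 * \<kappa>0 * \<rho> n ^ 2 + \<kappa>0 ^ 2 * \<rho> n)))
     \<longlonglongrightarrow> \<i> * of_real ((\<theta>1 * 0 * (1 + 1) / 2 + \<kappa>0 * 0) / zeta 2)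
      - complex_of_real (V * 1 / (2 * zeta 2) + zeta 3 / zeta 2 ^ 3 * (\<theta>1 ^ 2 * 1 ^ 3 / 3 + \<theta>1 * \<kappa>0 * 1 ^ 2 + \<kappa>0 ^ 2 * 1))"
    unfolding \<rho>_def \<epsilon>_def using zeta_2_ge_1
    by (intro tendsto_intros harm_asymptotics) auto
  then have "(\<lambda>n. c n + \<Phi> n) \<longlonglongrightarrow> - complex_of_real (V / (2 * zeta 2) + zeta 3 / zeta 2 ^ 3 * (\<theta>1 ^ 2 / 3 + \<theta>1 * \<kappa>0 + \<kappa>0 ^ 2))"
    using eq by (auto elim!: Lim_transform_eventually intro: eventually_sequentiallyI)
  then have "(\<lambda>n. exp (c n + \<Phi> n) + exp (c n) * (P n - exp (\<Phi> n))) \<longlonglongrightarrow>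
      exp (- complex_of_real (V / (2 * zeta 2) + zeta 3 / zeta 2 ^ 3 * (\<theta>1 ^ 2 / 3 + \<theta>1 * \<kappa>0 + \<kappa>0 ^ 2))) + 0"
    by (intro tendsto_add tendsto_exp dev)
  then show ?thesis
    unfolding c_def[symmetric] P_def[symmetric] by (simp add: exp_add algebra_simps)
qed

section \<open>The path to a uniform leaf of the splitting tree\<close>
instance split_tree :: countable
  by countable_datatype

text \<open>
  The conditional characteristic function of one step which removes \<open>r\<close> elements from a set of \<open>m\<close>
  elements; \<open>path_weight\<close> multiplies these factors along the list of the sizes on a path.
\<close>
definition step_weight :: "real \<Rightarrow> real \<Rightarrow> (nat \<Rightarrow> real) \<Rightarrow> nat \<Rightarrow> nat \<Rightarrow> complex" where
  "step_weight s d t m r =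
     exp (\<i> * of_real (s + t r)) * (of_real (harm (m - 1)) / (of_real (harm (m - 1)) - \<i> * of_real d))"

fun path_weight :: "real \<Rightarrow> real \<Rightarrow> (nat \<Rightarrow> real) \<Rightarrow> nat list \<Rightarrow> complex" where
  "path_weight s d t (m # m' # ms) = step_weight s d t m (m - m') * path_weight s d t (m' # ms)"
| "path_weight s d t _ = 1"

lemma path_sets_hd: "\<exists>xs. path_sets k T = elems T # xs"
  by (cases T) auto

lemma finite_set_split_pmf: "2 \<le> m \<Longrightarrow> set_pmf (split_pmf m) \<subseteq> {1..m - 1}"
  using set_split_pmf by fastforce

lemma split_consecutive_eq:
  "2 \<le> m \<Longrightarrow> split_consecutive a m = bind_pmf (split_pmf m) (\<lambda>G.
     map_pmf (\<lambda>(l, r). Node l r) (pair_pmf (split_consecutive a G) (split_consecutive (a + G) (m - G))))"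
  by (subst split_consecutive.simps)
     (simp add: pair_pmf_def map_bind_pmf)

lemma finite_set_split_consecutive: "finite (set_pmf (split_consecutive a m))"
proof (induction m arbitrary: a rule: less_induct)
  case (less m)
  show ?case
  proof (cases "m < 2")
    case True
    then show ?thesis by (subst split_consecutive.simps) simp
  next
    case False
    have "finite (set_pmf (split_pmf m))"
      using finite_set_split_pmf[of m] False finite_subset by fastforce
    moreover have "G < m \<and> m - G < m" if "G \<in> set_pmf (split_pmf m)" for G
      using set_split_pmf[of m G] that False by auto
    ultimately show ?thesis
      using False less.IH by (subst split_consecutive_eq) auto
  qed
qed

lemma elems_split_consecutive:
  "1 \<le> m \<Longrightarrow> T \<in> set_pmf (split_consecutive a m) \<Longrightarrow> elems T = {a..<a + m}"
proof (induction m arbitrary: a T rule: less_induct)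
  case (less m)
  show ?case
  proof (cases "m < 2")
    case True
    then have "T = Leaf a" using less.prems by (subst (asm) split_consecutive.simps) simp
    then show ?thesis using True less.prems by auto
  next
    case False
    then obtain G l r where G: "G \<in> set_pmf (split_pmf m)" and T: "T = Node l r"
      and l: "l \<in> set_pmf (split_consecutive a G)" and r: "r \<in> set_pmf (split_consecutive (a + G) (m - G))"
      using less.prems(2) by (subst (asm) split_consecutive_eq) auto
    have "1 \<le> G" "G < m" using set_split_pmf[OF _ G] False by auto
    then have "elems l = {a..<a + G}" "elems r = {a + G..<a + G + (m - G)}"
      by (intro less.IH[OF _ _ l] less.IH[OF _ _ r]; simp)+
    then show ?thesis
      using T \<open>1 \<le> G\<close> \<open>G < m\<close> by auto
  qed
qed

lemma path_weight_Node:
  assumes l: "elems l = {a..<a + G}" and r: "elems r = {a + G..<a + m}" and G: "1 \<le> G" "G < m" and k: "k \<in> {a..<a + m}"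
  shows "path_weight s d t (path_sizes k (Node l r)) =
    (if k < a + G then step_weight s d t m (m - G) * path_weight s d t (path_sizes k l)
     else step_weight s d t m G * path_weight s d t (path_sizes k r))"
proof -
  obtain xs ys where xs: "path_sets k l = elems l # xs" and ys: "path_sets k r = elems r # ys"
    using path_sets_hd by meson
  have "{a..<a + G} \<union> {a + G..<a + m} = {a..<a + m}" using G by auto
  then show ?thesis
    using G k by (auto simp: path_sizes_def xs ys l r)
qed

text \<open>
  The sum over all leaves, instead of the mean, satisfies a recursion without size bias: it splits
  into the leaves of the left and of the right subset. The split law is symmetric, and
  \<open>2 q(m, r) (m - r) = m / (h\<^bsub>m-1\<^esub> r)\<close> gives the jump rates \<open>1 / r\<close>.
\<close>
lemma uniform_leaf_transform:
  assumes "1 \<le> m"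
  shows "(\<Sum>k=a..<a+m. measure_pmf.expectation (split_consecutive a m) (\<lambda>T. path_weight s d t (path_sizes k T)))
    = of_nat m * path_transform s d t (m - 1)"
  using assms
proof (induction m arbitrary: a rule: less_induct)
  case (less m)
  define E where "E a m k = measure_pmf.expectation (split_consecutive a m) (\<lambda>T. path_weight s d t (path_sizes k T))" for a m k
  define P where "P m = path_transform s d t m" for m
  show ?case
  proof (cases "m = 1")
    case True
    have "split_consecutive a 1 = return_pmf (Leaf a)" by (subst split_consecutive.simps) simp
    then show ?thesis using True by (simp add: path_sizes_def path_transform_0)
  next
    case False
    with less.prems have m: "2 \<le> m" by simp
    define h where "h = (harm (m - 1) :: real)"
    have h: "h > 0" unfolding h_def using m by (intro harm_pos) auto
    have hd0: "of_real h - \<i> * of_real d \<noteq> 0" using h unfolding complex_eq_iff by simp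
    define w where "w r = step_weight s d t m r" for r
    define qq where "qq G = split_weight m G" for G
    have node: "measure_pmf.expectation (map_pmf (\<lambda>(l, r). Node l r)
          (pair_pmf (split_consecutive a G) (split_consecutive (a + G) (m - G))))
        (\<lambda>T. path_weight s d t (path_sizes k T)) =
      (if k < a + G then w (m - G) * E a G k else w G * E (a + G) (m - G) k)"
      if G: "1 \<le> G" "G < m" and k: "k \<in> {a..<a + m}" for G k
    proof -
      define A B where "A = split_consecutive a G" and "B = split_consecutive (a + G) (m - G)"
      have el: "elems l = {a..<a + G}" if "l \<in> set_pmf A" for l
        using elems_split_consecutive that G by (simp add: A_def)
      have er: "elems r = {a + G..<a + m}" if "r \<in> set_pmf B" for r
        using elems_split_consecutive[of "m - G" r "a + G"] that G by (simp add: B_def)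
      have pw: "path_weight s d t (path_sizes k (Node l r)) =
          (if k < a + G then w (m - G) * path_weight s d t (path_sizes k l) else w G * path_weight s d t (path_sizes k r))"
        if "l \<in> set_pmf A" "r \<in> set_pmf B" for l r
        unfolding w_def by (rule path_weight_Node[OF el[OF that(1)] er[OF that(2)] G k])
      show ?thesis
      proof (cases "k < a + G")
        case True
        have "measure_pmf.expectation (pair_pmf A B) (\<lambda>x. path_weight s d t (path_sizes k (case_prod Node x))) =
          measure_pmf.expectation (pair_pmf A B) (\<lambda>x. w (m - G) * path_weight s d t (path_sizes k (fst x)))"
          using True pw by (intro integral_cong_AE) (auto simp: AE_measure_pmf_iff)
        also have "\<dots> = measure_pmf.expectation (map_pmf fst (pair_pmf A B)) (\<lambda>l. w (m - G) * path_weight s d t (path_sizes k l))"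
          by (simp only: integral_map_pmf)
        also have "\<dots> = w (m - G) * E a G k"
          by (simp only: map_fst_pair_pmf E_def A_def integral_mult_right_zero)
        finally show ?thesis using True by (simp add: A_def B_def)
      next
        case False
        have "measure_pmf.expectation (pair_pmf A B) (\<lambda>x. path_weight s d t (path_sizes k (case_prod Node x))) =
          measure_pmf.expectation (pair_pmf A B) (\<lambda>x. w G * path_weight s d t (path_sizes k (snd x)))"
          using False pw by (intro integral_cong_AE) (auto simp: AE_measure_pmf_iff)
        also have "\<dots> = measure_pmf.expectation (map_pmf snd (pair_pmf A B)) (\<lambda>l. w G * path_weight s d t (path_sizes k l))"
          by (simp only: integral_map_pmf)
        also have "\<dots> = w G * E (a + G) (m - G) k"
          by (simp only: map_snd_pair_pmf E_def B_def integral_mult_right_zero)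
        finally show ?thesis using False by (simp add: A_def B_def)
      qed
    qed
    have exp_k: "E a m k = (\<Sum>G=1..m - 1. of_real (qq G) *
        (if k < a + G then w (m - G) * E a G k else w G * E (a + G) (m - G) k))"
      if k: "k \<in> {a..<a + m}" for k
    proof -
      have "E a m k = (\<Sum>G=1..m - 1. pmf (split_pmf m) G *\<^sub>R measure_pmf.expectation (map_pmf (\<lambda>(l, r). Node l r)
          (pair_pmf (split_consecutive a G) (split_consecutive (a + G) (m - G)))) (\<lambda>T. path_weight s d t (path_sizes k T)))"
        unfolding E_def split_consecutive_eq[OF m]
        by (rule pmf_expectation_bind) (use finite_set_split_pmf[OF m] finite_set_split_consecutive in auto)
      also have "\<dots> = (\<Sum>G=1..m - 1. of_real (qq G) *
        (if k < a + G then w (m - G) * E a G k else w G * E (a + G) (m - G) k))"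
        using m k by (intro sum.cong refl) (subst node, auto simp: pmf_split_pmf[OF m] qq_def scaleR_conv_of_real)
      finally show ?thesis .
    qed
    have "(\<Sum>k=a..<a+m. E a m k) = (\<Sum>G=1..m - 1. of_real (qq G) * (\<Sum>k=a..<a+m.
        (if k < a + G then w (m - G) * E a G k else w G * E (a + G) (m - G) k)))"
      by (simp only: sum.cong[OF refl exp_k] sum_distrib_left) (rule sum.swap)
    also have "\<dots> = (\<Sum>G=1..m - 1. of_real (qq G) * (w (m - G) * (of_nat G * P (G - 1))
        + w G * (of_nat (m - G) * P (m - G - 1))))"
    proof (intro sum.cong refl arg_cong2[where f = "(*)"])
      fix G assume "G \<in> {1..m - 1}"
      then have G: "1 \<le> G" "G < m" using m by auto
      have "{a..<a + m} = {a..<a + G} \<union> {a + G..<a + m}" using G by auto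
      then have "(\<Sum>k=a..<a+m. (if k < a + G then w (m - G) * E a G k else w G * E (a + G) (m - G) k)) =
        (\<Sum>k=a..<a+G. w (m - G) * E a G k) + (\<Sum>k=a+G..<a+m. w G * E (a + G) (m - G) k)"
        by (simp add: sum.union_disjoint)
      also have "\<dots> = w (m - G) * (\<Sum>k=a..<a+G. E a G k) + w G * (\<Sum>k=a+G..<a+G+(m-G). E (a + G) (m - G) k)"
        using G by (simp add: sum_distrib_left)
      also have "\<dots> = w (m - G) * (of_nat G * P (G - 1)) + w G * (of_nat (m - G) * P (m - G - 1))"
        using less.IH[of G a] less.IH[of "m - G" "a + G"] G unfolding E_def P_def by simp
      finally show "(\<Sum>k=a..<a+m. (if k < a + G then w (m - G) * E a G k else w G * E (a + G) (m - G) k)) =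
        w (m - G) * (of_nat G * P (G - 1)) + w G * (of_nat (m - G) * P (m - G - 1))" .
    qed
    also have "\<dots> = (\<Sum>G=1..m - 1. of_real (qq G) * (w (m - G) * (of_nat G * P (G - 1))))
        + (\<Sum>G=1..m - 1. of_real (qq G) * (w G * (of_nat (m - G) * P (m - G - 1))))"
      by (simp only: distrib_left sum.distrib)
    also have "(\<Sum>G=1..m - 1. of_real (qq G) * (w (m - G) * (of_nat G * P (G - 1)))) =
        (\<Sum>G=1..m - 1. of_real (qq G) * (w G * (of_nat (m - G) * P (m - G - 1))))"
      by (rule sum.reindex_bij_witness[of _ "\<lambda>G. m - G" "\<lambda>G. m - G"])
         (auto simp: qq_def split_weight_def mult.commute)
    also have "\<dots> + \<dots> = (\<Sum>G=1..m - 1. 2 * (of_real (qq G) * (w G * (of_nat (m - G) * P (m - G - 1)))))"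
      by (simp only: sum.distrib[symmetric] mult_2)
    also have "\<dots> = (\<Sum>G=1..m - 1. (of_nat m / (of_real h - \<i> * of_real d)) *
        (of_real (1 / real G) * (exp (\<i> * of_real (s + t G)) * P (m - 1 - G))))"
    proof (intro sum.cong refl)
      fix G assume "G \<in> {1..m - 1}"
      then have G: "1 \<le> G" "G < m" using m by auto
      have "qq G = real m / (2 * h) * (1 / (real G * real (m - G)))"
        using G by (auto simp: qq_def split_weight_def h_def)
      moreover have "real (m - G) \<noteq> 0" "real G \<noteq> 0" using G by auto
      ultimately have "2 * qq G * real (m - G) = real m / (h * real G)"
        using h by (simp del: of_nat_diff)
      from arg_cong[OF this, of complex_of_real]
      have q2: "2 * of_real (qq G) * of_nat (m - G) = (of_nat m / (of_real h * of_nat G) :: complex)"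
        by (simp only: of_real_mult of_real_divide of_real_numeral of_real_of_nat_eq)
      have "2 * (of_real (qq G) * (w G * (of_nat (m - G) * P (m - G - 1)))) =
         (2 * of_real (qq G) * of_nat (m - G)) * (w G * P (m - 1 - G))"
        by (simp add: mult_ac diff_commute)
      also have "\<dots> = (of_nat m / (of_real h - \<i> * of_real d)) *
        (of_real (1 / real G) * (exp (\<i> * of_real (s + t G)) * P (m - 1 - G)))"
        unfolding q2 w_def step_weight_def h_def[symmetric] using h hd0 G by (simp add: field_simps)
      finally show "2 * (of_real (qq G) * (w G * (of_nat (m - G) * P (m - G - 1)))) = \<dots>" .
    qed
    also have "\<dots> = (of_nat m / (of_real h - \<i> * of_real d)) * ((of_real h - \<i> * of_real d) * P (m - 1))"
      unfolding sum_distrib_left[symmetric] P_def h_def using m by (subst path_transform_rec) auto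
    also have "\<dots> = of_nat m * P (m - 1)" using h by simp
    finally show ?thesis unfolding E_def P_def .
  qed
qed

section \<open>The transform of the heights\<close>
lemma char_exponential:
  assumes "0 \<le> l"
  shows "char (density lborel (exponential_density l)) u = of_real l / (of_real l - \<i> * of_real u)"
proof (cases "l = 0")
  case True
  have "density lborel (exponential_density 0) = null_measure lborel"
    by (intro measure_eqI) (auto simp: emeasure_density exponential_density_def cong: if_cong)
  then show ?thesis using True by (simp add: char_def)
next
  case False
  then have l: "0 < l" using assms by simp
  define c where "c = of_real l - \<i> * complex_of_real u"
  have Re_c: "Re c = l" by (simp add: c_def)
  then have c0: "c \<noteq> 0" using l by auto
  define f where "f x = of_real l * exp (- c * complex_of_real x)" for x
  define F where "F z = - (of_real l / c) * exp (- c * z)" for z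
  interpret prob_space "density lborel (exponential_density l)"
    using l by (rule prob_space_exponential_density)
  have eq: "AE x in lborel. exponential_density l x *\<^sub>R iexp (u * x) = indicator (einterval 0 \<infinity>) x *\<^sub>R f x"
    using AE_lborel_singleton[of "0::real"]
  proof eventually_elim
    case (elim x)
    show ?case
    proof (cases "x < 0")
      case False
      with elim have "x > 0" by simp
      have "exp (- c * of_real x) = exp (of_real (- l * x)) * iexp (u * x)"
        by (simp add: c_def exp_add[symmetric] algebra_simps)
      then have "exp (- c * of_real x) = of_real (exp (- l * x)) * iexp (u * x)"
        by (simp only: exp_of_real)
      then show ?thesis using \<open>x > 0\<close>
        by (simp add: exponential_density_def f_def einterval_def scaleR_conv_of_real mult_ac)
    qed (simp add: exponential_density_def einterval_def)
  qed
  have nn: "0 \<le> exponential_density l x" for x using l by simp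
  have "integrable (density lborel (exponential_density l)) (\<lambda>x. iexp (u * x))"
    by (rule integrable_iexp) auto
  then have "integrable lborel (\<lambda>x. exponential_density l x *\<^sub>R iexp (u * x))"
    by (subst (asm) integrable_density) (auto simp: nn)
  then have int: "set_integrable lborel (einterval 0 \<infinity>) f"
    unfolding set_integrable_def
    by (subst (asm) integrable_cong_AE[OF _ _ eq]) (auto simp: f_def)
  have "char (density lborel (exponential_density l)) u = (CLINT x|lborel. exponential_density l x *\<^sub>R iexp (u * x))"
    unfolding char_def by (subst integral_density) (auto simp: nn)
  also have "\<dots> = (CLINT x|lborel. indicator (einterval 0 \<infinity>) x *\<^sub>R f x)"
    by (rule integral_cong_AE[OF _ _ eq]) (auto simp: f_def)
  also have "\<dots> = (LBINT x=0..\<infinity>. f x)"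
    by (simp add: interval_lebesgue_integral_def set_lebesgue_integral_def)
  also have "\<dots> = 0 - F 0"
  proof (rule interval_integral_FTC_integrable[where F = "\<lambda>x. F (of_real x)"])
    have "(F has_field_derivative (of_real l * exp (- c * z))) (at z)" for z
      unfolding F_def using c0 by (auto intro!: derivative_eq_intros)
    then show "((\<lambda>x. F (of_real x)) has_vector_derivative f x) (at x)" for x
      unfolding f_def by (intro has_vector_derivative_real_field)
    show "isCont f x" for x unfolding f_def by (intro continuous_intros)
    have "isCont (\<lambda>x. F (complex_of_real x)) 0" unfolding F_def by (intro continuous_intros)
    then have "((\<lambda>x. F (complex_of_real x)) \<longlongrightarrow> F 0) (at_right 0)"
      by (simp add: isCont_def filterlim_at_split)
    then show "(((\<lambda>x. F (complex_of_real x)) \<circ> real_of_ereal) \<longlongrightarrow> F 0) (at_right 0)"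
      by (simp add: zero_ereal_def ereal_tendsto_simps1)
    have "((\<lambda>x. norm (of_real l / c) * exp (- l * x)) \<longlongrightarrow> 0) at_top"
      using l by real_asymp
    moreover have "norm (F (complex_of_real x)) = norm (of_real l / c) * exp (- l * x)" for x
      by (simp add: F_def norm_mult norm_divide Re_c)
    ultimately have "((\<lambda>x. norm (F (complex_of_real x))) \<longlongrightarrow> 0) at_top" by simp
    then have "((\<lambda>x. F (complex_of_real x)) \<longlongrightarrow> 0) at_top" by (rule tendsto_norm_zero_cancel)
    then show "(((\<lambda>x. F (complex_of_real x)) \<circ> real_of_ereal) \<longlongrightarrow> 0) (at_left \<infinity>)"
      by (simp add: ereal_tendsto_simps1)
  qed (use int in auto)
  also have "\<dots> = of_real l / c" by (simp add: F_def)
  finally show ?thesis by (simp add: c_def)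
qed

text \<open>Conditional expectations given an event, as integrals over the event.\<close>
lemma (in prob_space) integral_uniform_measure:
  fixes f :: "'a \<Rightarrow> complex"
  assumes A: "A \<in> events" "prob A > 0" and f: "f \<in> borel_measurable M"
  shows "(\<integral>\<omega>. indicator A \<omega> *\<^sub>R f \<omega> \<partial>M) = prob A *\<^sub>R (\<integral>\<omega>. f \<omega> \<partial>uniform_measure M A)"
proof -
  have "uniform_measure M A = density M (\<lambda>x. ennreal (indicator A x / prob A))"
    unfolding uniform_measure_def emeasure_eq_measure using A(2)
    by (intro arg_cong[where f = "density M"] ext) (auto simp: divide_ennreal[symmetric] indicator_def)
  then have "(\<integral>\<omega>. f \<omega> \<partial>uniform_measure M A) = (\<integral>\<omega>. (indicator A \<omega> / prob A) *\<^sub>R f \<omega> \<partial>M)"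
    using A f by (simp add: integral_density)
  also have "\<dots> = (\<integral>\<omega>. (1 / prob A) *\<^sub>R (indicator A \<omega> *\<^sub>R f \<omega>) \<partial>M)" by simp
  also have "\<dots> = (1 / prob A) *\<^sub>R (\<integral>\<omega>. indicator A \<omega> *\<^sub>R f \<omega> \<partial>M)" by (rule integral_scaleR_right)
  finally show ?thesis using A(2) by simp
qed

lemma length_path_edges: "length (path_edges k T) = length (path_sizes k T) - 1"
  by (simp add: path_edges_def path_sizes_def)

lemma path_edges_nth:
  assumes "i < length (path_sizes k T) - 1"
  shows "card (fst (path_edges k T ! i)) = path_sizes k T ! i" "card (snd (path_edges k T ! i)) = path_sizes k T ! Suc i"
  using assms by (auto simp: path_edges_def path_sizes_def nth_tl)

lemma leaf_height_sum:
  "leaf_height l k T = (\<Sum>i<length (path_sizes k T) - 1. l (path_edges k T ! i))"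
  unfolding leaf_height_def
  by (simp add: sum_list_sum_nth length_path_edges atLeast0LessThan)

lemma path_weight_prod:
  "path_weight s d t ms = (\<Prod>i<length ms - 1. step_weight s d t (ms ! i) (ms ! i - ms ! Suc i))"
  by (induction s d t ms rule: path_weight.induct)
     (auto simp: prod.lessThan_Suc_shift simp del: prod.lessThan_Suc)

lemma leaf_decrements_sum:
  "(\<Sum>r=1..j. t r * real (leaf_decrements r k T)) =
    (\<Sum>i<length (path_sizes k T) - 1. (\<lambda>r. if r \<in> {1..j} then t r else 0) (path_sizes k T ! i - path_sizes k T ! Suc i))"
proof -
  have "(\<Sum>r=1..j. t r * real (length (filter (\<lambda>(a, b). card a - card b = r) es))) =
      (\<Sum>(a, b)\<leftarrow>es. if card a - card b \<in> {1..j} then t (card a - card b) else (0::real))" for es :: "edge list"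
  proof (induction es)
    case (Cons x es)
    obtain a b where x: "x = (a, b)" by (cases x)
    have "(\<Sum>r=1..j. t r * real (length (filter (\<lambda>(a, b). card a - card b = r) (x # es)))) =
       (\<Sum>r=1..j. t r * real (length (filter (\<lambda>(a, b). card a - card b = r) es)) + (if card a - card b = r then t r else 0))"
      by (intro sum.cong refl) (simp add: x algebra_simps)
    also have "\<dots> = (\<Sum>r=1..j. t r * real (length (filter (\<lambda>(a, b). card a - card b = r) es)))
        + (if card a - card b \<in> {1..j} then t (card a - card b) else 0)"
      unfolding sum.distrib by (simp add: sum.delta)
    finally show ?case unfolding Cons.IH by (simp add: x)
  qed simp
  note * = this[of "path_edges k T"]
  show ?thesis
    unfolding leaf_decrements_def *
    by (auto simp: sum_list_sum_nth length_path_edges atLeast0LessThan case_prod_beta path_edges_nth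
          intro!: sum.cong)
qed

text \<open>
  Independence of two random elements is given through the \<open>\<sigma>\<close>-algebras which they generate. It
  passes to all random variables measurable with respect to these, whatever their value spaces are.
\<close>
lemma (in prob_space) indep_var_of_indep_set:
  assumes indep: "indep_set (sets V1) (sets V2)" and V: "space V1 = space M" "space V2 = space M"
    and X: "X \<in> V1 \<rightarrow>\<^sub>M N1" and Y: "Y \<in> V2 \<rightarrow>\<^sub>M N2"
  shows "indep_var N1 X N2 Y"
proof -
  have ev: "sets V1 \<subseteq> events" "sets V2 \<subseteq> events"
    using indep_setD_ev1[OF indep] indep_setD_ev2[OF indep] by auto
  have rv: "X \<in> M \<rightarrow>\<^sub>M N1" "Y \<in> M \<rightarrow>\<^sub>M N2"
    using X Y V ev by (auto simp: measurable_def)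
  have X': "sigma_sets (space M) {X -` A \<inter> space M | A. A \<in> sets N1} \<subseteq> sets V1"
    unfolding V(1)[symmetric] by (rule sets.sigma_sets_subset) (use X in \<open>auto simp: measurable_def\<close>)
  have Y': "sigma_sets (space M) {Y -` A \<inter> space M | A. A \<in> sets N2} \<subseteq> sets V2"
    unfolding V(2)[symmetric] by (rule sets.sigma_sets_subset) (use Y in \<open>auto simp: measurable_def\<close>)
  have "indep_set (sigma_sets (space M) {X -` A \<inter> space M | A. A \<in> sets N1})
      (sigma_sets (space M) {Y -` A \<inter> space M | A. A \<in> sets N2})"
    unfolding indep_set_def
  proof (rule indep_sets_mono_sets[OF indep[unfolded indep_set_def]])
    fix b :: bool
    show "case_bool (sigma_sets (space M) {X -` A \<inter> space M | A. A \<in> sets N1})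
       (sigma_sets (space M) {Y -` A \<inter> space M | A. A \<in> sets N2}) b \<subseteq> case_bool (sets V1) (sets V2) b"
      using X' Y' by (cases b) (simp_all only: bool.case)
  qed
  then show ?thesis unfolding indep_var_eq using rv by simp
qed

context beta_splitting_model
begin

lemma sizes_event: "{\<omega> \<in> space M. path_sizes k (T \<omega>) = ms} \<in> events"
  using T_measurable by measurable

lemma path_length_measurable: "(\<lambda>\<omega>. leaf_height (len \<omega>) k (T \<omega>)) \<in> borel_measurable M"
proof (rule measurable_compose_countable[OF _ T_measurable])
  fix T'
  show "(\<lambda>\<omega>. leaf_height (len \<omega>) k T') \<in> borel_measurable M"
    unfolding leaf_height_sum using len_measurable by measurable
qed

lemma heights_measurable:
  "edge_height T U \<in> borel_measurable M" "time_height T len U \<in> borel_measurable M"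
  "decrement_count T U r \<in> borel_measurable M"
proof -
  have *: "(\<lambda>\<omega>. g (U \<omega>) (T \<omega>)) \<in> borel_measurable M" for g :: "nat \<Rightarrow> split_tree \<Rightarrow> real"
    by (rule measurable_compose_countable[OF _ U_measurable])
       (rule measurable_compose_countable[OF _ T_measurable], simp)
  show "edge_height T U \<in> borel_measurable M" "decrement_count T U r \<in> borel_measurable M"
    unfolding edge_height_def[abs_def] decrement_count_def[abs_def] by (rule *)+
  show "time_height T len U \<in> borel_measurable M"
    unfolding time_height_def[abs_def]
    by (rule measurable_compose_countable[OF _ U_measurable]) (rule path_length_measurable)
qed

text \<open>
  Given the sizes on the path, the length is a sum of independent exponential variables. The case of
  a null event has to be treated separately, as nothing is known about the edge lengths there.
\<close>
lemma char_path_length: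
  assumes k: "k \<in> {1..n}"
  defines "A \<equiv> \<lambda>ms. {\<omega> \<in> space M. path_sizes k (T \<omega>) = ms}"
  shows "(\<integral>\<omega>. indicator (A ms) \<omega> *\<^sub>R iexp (d * leaf_height (len \<omega>) k (T \<omega>)) \<partial>M) =
    prob (A ms) *\<^sub>R (\<Prod>i<length ms - 1. of_real (harm (ms ! i - 1)) / (of_real (harm (ms ! i - 1)) - \<i> * of_real d))"
proof (cases "prob (A ms) > 0")
  case False
  then have "prob (A ms) = 0" using zero_less_measure_iff by blast
  then have "AE \<omega> in M. \<omega> \<notin> A ms"
    by (intro AE_not_in) (simp add: null_sets_def A_def sizes_event emeasure_eq_measure)
  then have "(\<integral>\<omega>. indicator (A ms) \<omega> *\<^sub>R iexp (d * leaf_height (len \<omega>) k (T \<omega>)) \<partial>M) = (\<integral>\<omega>. 0 \<partial>M)"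
    using path_length_measurable sizes_event
    by (intro integral_cong_AE) (auto simp: A_def indicator_def elim!: eventually_mono)
  then show ?thesis using \<open>prob (A ms) = 0\<close> by simp
next
  case True
  define P where "P = uniform_measure M (A ms)"
  define X where "X i \<omega> = len \<omega> (path_edges k (T \<omega>) ! i)" for i \<omega>
  have A: "A ms \<in> events" unfolding A_def by (rule sizes_event)
  interpret P: prob_space P
    unfolding P_def using True by (intro prob_space_uniform_measure) (auto simp: emeasure_eq_measure)
  have indep: "P.indep_vars (\<lambda>_. borel) X {..<length ms - 1}"
    and distr: "\<And>i. i < length ms - 1 \<Longrightarrow> distributed P lborel (X i) (exponential_density (harm (ms ! i - 1)))"
    using len_path[OF k refl True[unfolded A_def]] unfolding P_def A_def X_def by auto
  have "(\<integral>\<omega>. indicator (A ms) \<omega> *\<^sub>R iexp (d * leaf_height (len \<omega>) k (T \<omega>)) \<partial>M) =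
     (\<integral>\<omega>. indicator (A ms) \<omega> *\<^sub>R iexp (d * (\<Sum>i<length ms - 1. X i \<omega>)) \<partial>M)"
    by (intro Bochner_Integration.integral_cong refl) (auto simp: A_def leaf_height_sum X_def indicator_def)
  also have "\<dots> = prob (A ms) *\<^sub>R (\<integral>\<omega>. iexp (d * (\<Sum>i<length ms - 1. X i \<omega>)) \<partial>P)"
    unfolding P_def
  proof (rule integral_uniform_measure[OF A True])
    have "X i \<in> borel_measurable M" if "i < length ms - 1" for i
    proof -
      have "X i \<in> P \<rightarrow>\<^sub>M borel" using indep that unfolding P.indep_vars_def by simp
      moreover have "measurable P borel = (measurable M borel :: ('a \<Rightarrow> real) set)"
        by (intro measurable_cong_sets) (simp_all add: P_def)
      ultimately show ?thesis by simp
    qed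
    then show "(\<lambda>\<omega>. iexp (d * (\<Sum>i<length ms - 1. X i \<omega>))) \<in> borel_measurable M"
      by measurable
  qed
  also have "(\<integral>\<omega>. iexp (d * (\<Sum>i<length ms - 1. X i \<omega>)) \<partial>P) = char (distr P borel (\<lambda>\<omega>. \<Sum>i<length ms - 1. X i \<omega>)) d"
    unfolding char_def using indep
    by (subst integral_distr) (auto simp: P.indep_vars_def intro!: borel_measurable_sum)
  also have "\<dots> = (\<Prod>i<length ms - 1. char (distr P borel (X i)) d)"
    by (rule P.char_distr_sum[OF indep])
  also have "\<dots> = (\<Prod>i<length ms - 1. of_real (harm (ms ! i - 1)) / (of_real (harm (ms ! i - 1)) - \<i> * of_real d))"
  proof (intro prod.cong refl)
    fix i assume "i \<in> {..<length ms - 1}"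
    then have D: "distributed P lborel (X i) (exponential_density (harm (ms ! i - 1)))" using distr by simp
    have "distr P borel (X i) = distr P lborel (X i)" by (intro distr_cong) auto
    also have "\<dots> = density lborel (exponential_density (harm (ms ! i - 1)))"
      by (rule distributed_distr_eq_density[OF D])
    finally have *: "distr P borel (X i) = density lborel (exponential_density (harm (ms ! i - 1)))" .
    show "char (distr P borel (X i)) d = of_real (harm (ms ! i - 1)) / (of_real (harm (ms ! i - 1)) - \<i> * of_real d)"
      unfolding * by (intro char_exponential harm_nonneg)
  qed
  finally show ?thesis .
qed

text \<open>
  The expectation is decomposed according to the chosen leaf \<open>k\<close> and the sizes \<open>ms\<close> on the path to
  it. The two finite sums carry the law of \<open>(U, T)\<close>; on each piece the counts are
  constant and only the length of the path is random.
\<close>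
lemma joint_transform:
  assumes n: "1 \<le> n"
  shows "(\<integral>\<omega>. iexp (s * edge_height T U \<omega> + d * time_height T len U \<omega>
      + (\<Sum>r=1..j. t r * decrement_count T U r \<omega>)) \<partial>M) =
    path_transform s d (\<lambda>r. if r \<in> {1..j} then t r else 0) (n - 1)"
proof -
  define t' where "t' r = (if r \<in> {1..j} then t r else 0)" for r
  define C where "C = critical_beta_splitting n"
  define S where "S k = path_sizes k ` set_pmf C" for k
  define A where "A k ms = {\<omega> \<in> space M. path_sizes k (T \<omega>) = ms}" for k ms
  define B where "B k = {\<omega> \<in> space M. U \<omega> = k}" for k
  define E where "E k ms \<omega> = indicator (A k ms) \<omega> *\<^sub>R iexp (d * leaf_height (len \<omega>) k (T \<omega>))" for k ms \<omega>
  define H where "H \<omega> = iexp (s * edge_height T U \<omega> + d * time_height T len U \<omega>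
      + (\<Sum>r=1..j. t r * decrement_count T U r \<omega>))" for \<omega>
  define c where "c ms = (\<Prod>i<length ms - 1. iexp (s + t' (ms ! i - ms ! Suc i)))" for ms
  define w where "w ms = path_weight s d t' ms" for ms
  have finC: "finite (set_pmf C)" unfolding C_def critical_beta_splitting_def by (rule finite_set_split_consecutive)
  have AB: "A k ms \<in> events" "B k \<in> events" for k ms
    unfolding A_def B_def using U_measurable sizes_event by auto
  have H_split: "H \<omega> = c ms * iexp (d * leaf_height (len \<omega>) k (T \<omega>))" if "\<omega> \<in> A k ms" "\<omega> \<in> B k" for \<omega> k ms
  proof -
    have U: "U \<omega> = k" and ms: "path_sizes k (T \<omega>) = ms" using that by (auto simp: A_def B_def)
    have 1: "edge_height T U \<omega> = real (length ms - 1)"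
      unfolding edge_height_def U leaf_height_sum ms by simp
    have 2: "(\<Sum>r=1..j. t r * decrement_count T U r \<omega>) = (\<Sum>i<length ms - 1. t' (ms ! i - ms ! Suc i))"
      unfolding decrement_count_def U leaf_decrements_sum ms t'_def ..
    have "c ms = exp (\<Sum>i<length ms - 1. \<i> * of_real (s + t' (ms ! i - ms ! Suc i)))"
      unfolding c_def by (rule exp_sum[symmetric]) simp
    also have "(\<Sum>i<length ms - 1. \<i> * of_real (s + t' (ms ! i - ms ! Suc i))) =
        \<i> * of_real (\<Sum>i<length ms - 1. s + t' (ms ! i - ms ! Suc i))"
      by (simp only: sum_distrib_left of_real_sum)
    also have "(\<Sum>i<length ms - 1. s + t' (ms ! i - ms ! Suc i)) =
        s * real (length ms - 1) + (\<Sum>i<length ms - 1. t' (ms ! i - ms ! Suc i))"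
      by (simp add: sum.distrib)
    finally show ?thesis
      unfolding H_def 1 2 time_height_def U
      by (simp only: exp_add[symmetric] distrib_left[symmetric] of_real_add[symmetric] add_ac)
  qed
  have "AE \<omega> in distr M (count_space UNIV) U. \<omega> \<in> {1..n}"
    unfolding U_distr using n by (auto simp: AE_measure_pmf_iff)
  then have U_AE: "AE \<omega> in M. U \<omega> \<in> {1..n}" using U_measurable by (subst (asm) AE_distr_iff) auto
  have "AE T' in distr M (count_space UNIV) T. T' \<in> set_pmf C"
    unfolding T_distr C_def by (auto simp: AE_measure_pmf_iff)
  then have T_AE: "AE \<omega> in M. T \<omega> \<in> set_pmf C" using T_measurable by (subst (asm) AE_distr_iff) auto
  have Bprob: "prob (B k) = 1 / real n" if "k \<in> {1..n}" for k
  proof -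
    have "prob (B k) = measure (distr M (count_space UNIV) U) {k}"
      using U_measurable by (subst measure_distr) (auto simp: B_def intro!: arg_cong[where f = prob])
    also have "\<dots> = pmf (pmf_of_set {1..n}) k" unfolding U_distr by (simp add: pmf.rep_eq)
    finally show ?thesis using that by simp
  qed
  have Aprob: "prob (A k ms) = pmf (map_pmf (path_sizes k) C) ms" for k ms
  proof -
    have "prob (A k ms) = measure (distr M (count_space UNIV) T) (path_sizes k -` {ms})"
      using T_measurable by (subst measure_distr) (auto simp: A_def intro!: arg_cong[where f = prob])
    then show ?thesis unfolding T_distr C_def by (simp add: pmf_map)
  qed
  have meas_len: "(\<lambda>\<omega>. (T \<omega>, len \<omega>)) \<in> M \<rightarrow>\<^sub>M count_space UNIV \<Otimes>\<^sub>M PiM UNIV (\<lambda>_. borel)"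
    using T_measurable len_measurable by (intro measurable_Pair measurable_PiM_single') auto
  \<comment> \<open>the chosen leaf is independent of the tree with its edge lengths\<close>
  have piece: "(\<integral>\<omega>. indicator (B k) \<omega> *\<^sub>R E k ms \<omega> \<partial>M) =
      prob (B k) *\<^sub>R (\<integral>\<omega>. E k ms \<omega> \<partial>M)" for k ms
  proof -
    define g1 where "g1 u = (indicator {k} u :: complex)" for u
    define g2 where "g2 = (\<lambda>(T', l). indicator {T'. path_sizes k T' = ms} T' *\<^sub>R iexp (d * leaf_height l k T'))"
    have g2: "g2 \<in> borel_measurable (count_space UNIV \<Otimes>\<^sub>M PiM UNIV (\<lambda>_. borel))"
    proof (rule measurable_pair_measure_countable1)
      fix T'
      have "(\<lambda>l. leaf_height l k T') \<in> borel_measurable (PiM UNIV (\<lambda>_. borel))"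
        unfolding leaf_height_sum by measurable
      then show "(\<lambda>y. g2 (T', y)) \<in> borel_measurable (PiM UNIV (\<lambda>_. borel))"
        unfolding g2_def by simp
    qed simp
    have ind: "indep_var borel (g1 \<circ> U) borel (g2 \<circ> (\<lambda>\<omega>. (T \<omega>, len \<omega>)))"
      by (rule indep_var_of_indep_set[OF U_indep])
         (auto intro!: measurable_comp[OF measurable_vimage_algebra1] g2 simp: space_pair_measure space_PiM)
    have g1B: "(g1 \<circ> U) \<omega> = complex_of_real (indicator (B k) \<omega>)" if "\<omega> \<in> space M" for \<omega>
      using that by (simp add: g1_def B_def indicator_def)
    have g2A: "(g2 \<circ> (\<lambda>\<omega>. (T \<omega>, len \<omega>))) \<omega> = E k ms \<omega>"
      if "\<omega> \<in> space M" for \<omega>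
      using that by (simp add: E_def g2_def A_def indicator_def)
    have "integrable M (g1 \<circ> U)"
      by (rule integrable_const_bound[where B = 1])
         (use U_measurable in \<open>auto simp: g1_def indicator_def o_def intro!: measurable_compose[OF U_measurable]\<close>)
    moreover have "integrable M (g2 \<circ> (\<lambda>\<omega>. (T \<omega>, len \<omega>)))"
      by (rule integrable_const_bound[where B = 1])
         (use measurable_compose[OF meas_len g2] in \<open>auto simp: g2_def indicator_def o_def\<close>)
    ultimately have "(\<integral>\<omega>. (g1 \<circ> U) \<omega> * (g2 \<circ> (\<lambda>\<omega>. (T \<omega>, len \<omega>))) \<omega> \<partial>M) =
        (\<integral>\<omega>. (g1 \<circ> U) \<omega> \<partial>M) * (\<integral>\<omega>. (g2 \<circ> (\<lambda>\<omega>. (T \<omega>, len \<omega>))) \<omega> \<partial>M)"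
      by (intro indep_var_lebesgue_integral ind)
    also have "(\<integral>\<omega>. (g1 \<circ> U) \<omega> \<partial>M) = (\<integral>\<omega>. complex_of_real (indicator (B k) \<omega>) \<partial>M)"
      using g1B by (rule Bochner_Integration.integral_cong[OF refl])
    also have "\<dots> = of_real (prob (B k))"
      using AB(2)[of k] by (subst integral_of_real) (auto simp: emeasure_eq_measure)
    also have "(\<integral>\<omega>. (g2 \<circ> (\<lambda>\<omega>. (T \<omega>, len \<omega>))) \<omega> \<partial>M) =
        (\<integral>\<omega>. E k ms \<omega> \<partial>M)"
      using g2A by (rule Bochner_Integration.integral_cong[OF refl])
    also have "(\<integral>\<omega>. (g1 \<circ> U) \<omega> * (g2 \<circ> (\<lambda>\<omega>. (T \<omega>, len \<omega>))) \<omega> \<partial>M) =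
        (\<integral>\<omega>. indicator (B k) \<omega> *\<^sub>R E k ms \<omega> \<partial>M)"
      by (rule Bochner_Integration.integral_cong[OF refl])
         (simp only: g1B g2A scaleR_conv_of_real)
    finally show ?thesis by (simp add: scaleR_conv_of_real)
  qed
  have piece_int: "integrable M (\<lambda>\<omega>. indicator (B k) \<omega> *\<^sub>R E k ms \<omega>)" for k ms
    by (rule integrable_const_bound[where B = 1])
       (use AB path_length_measurable in \<open>auto simp: E_def indicator_def\<close>)
  have wc: "c ms * (\<Prod>i<length ms - 1. of_real (harm (ms ! i - 1)) / (of_real (harm (ms ! i - 1)) - \<i> * of_real d)) = w ms" for ms
    unfolding w_def path_weight_prod c_def step_weight_def by (rule prod.distrib[symmetric])
  have H_meas: "H \<in> borel_measurable M"
    unfolding H_def using heights_measurable by measurable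
  have "(\<integral>\<omega>. H \<omega> \<partial>M) = (\<integral>\<omega>. (\<Sum>k\<in>{1..n}. \<Sum>ms\<in>S k. c ms * (indicator (B k) \<omega> *\<^sub>R E k ms \<omega>)) \<partial>M)"
  proof (rule integral_cong_AE[OF H_meas])
    show "(\<lambda>\<omega>. (\<Sum>k\<in>{1..n}. \<Sum>ms\<in>S k. c ms * (indicator (B k) \<omega> *\<^sub>R E k ms \<omega>))) \<in> borel_measurable M"
      using piece_int by (intro borel_measurable_sum borel_measurable_times) auto
    show "AE \<omega> in M. H \<omega> = (\<Sum>k\<in>{1..n}. \<Sum>ms\<in>S k. c ms * (indicator (B k) \<omega> *\<^sub>R E k ms \<omega>))"
      using U_AE T_AE AE_space
    proof eventually_elim
      case (elim \<omega>)
      define k0 ms0 where "k0 = U \<omega>" and "ms0 = path_sizes (U \<omega>) (T \<omega>)"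
      have in0: "\<omega> \<in> A k0 ms0" "\<omega> \<in> B k0" using elim by (auto simp: A_def B_def k0_def ms0_def)
      have "(\<Sum>k\<in>{1..n}. \<Sum>ms\<in>S k. c ms * (indicator (B k) \<omega> *\<^sub>R E k ms \<omega>)) =
        (\<Sum>k\<in>{k0}. \<Sum>ms\<in>S k. c ms * (indicator (B k) \<omega> *\<^sub>R E k ms \<omega>))"
        using elim by (intro sum.mono_neutral_right) (auto simp: k0_def B_def)
      also have "\<dots> = (\<Sum>ms\<in>{ms0}. c ms * (indicator (B k0) \<omega> *\<^sub>R E k0 ms \<omega>))"
      proof -
        have *: "(\<Sum>ms\<in>S k0. g ms) = (\<Sum>ms\<in>{ms0}. g ms)" if "\<And>ms. ms \<noteq> ms0 \<Longrightarrow> g ms = 0" for g :: "nat list \<Rightarrow> complex"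
          using elim finC that by (intro sum.mono_neutral_right) (auto simp: S_def k0_def ms0_def)
        have "E k0 ms \<omega> = 0" if "ms \<noteq> ms0" for ms
          using that by (simp add: E_def A_def k0_def ms0_def)
        then have "(\<Sum>ms\<in>S k0. c ms * (indicator (B k0) \<omega> *\<^sub>R E k0 ms \<omega>)) =
          (\<Sum>ms\<in>{ms0}. c ms * (indicator (B k0) \<omega> *\<^sub>R E k0 ms \<omega>))"
          by (intro *) simp
        then show ?thesis by simp
      qed
      also have "\<dots> = H \<omega>"
        using H_split[OF in0] in0 by (simp add: E_def[of k0 ms0])
      finally show ?case ..
    qed
  qed
  also have "\<dots> = (\<Sum>k\<in>{1..n}. \<Sum>ms\<in>S k. c ms * (prob (B k) *\<^sub>R
      (\<integral>\<omega>. E k ms \<omega> \<partial>M)))"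
  proof -
    have int: "integrable M (\<lambda>\<omega>. c ms * (indicator (B k) \<omega> *\<^sub>R E k ms \<omega>))" for k ms
      by (intro integrable_mult_right piece_int)
    show ?thesis
      by (subst Bochner_Integration.integral_sum, intro Bochner_Integration.integrable_sum int)
         (simp only: Bochner_Integration.integral_sum[OF int] integral_mult_right_zero piece)
  qed
  also have "\<dots> = (\<Sum>k\<in>{1..n}. \<Sum>ms\<in>S k. (1 / real n) *\<^sub>R (pmf (map_pmf (path_sizes k) C) ms *\<^sub>R w ms))"
  proof (intro sum.cong refl)
    fix k ms assume k: "k \<in> {1..n}"
    show "c ms * (prob (B k) *\<^sub>R (\<integral>\<omega>. E k ms \<omega> \<partial>M)) =
        (1 / real n) *\<^sub>R (pmf (map_pmf (path_sizes k) C) ms *\<^sub>R w ms)"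
      unfolding E_def[abs_def] using char_path_length[OF k, folded A_def, of ms d] Bprob[OF k] Aprob[of k ms] wc[of ms, symmetric]
      by simp
  qed
  also have "\<dots> = (\<Sum>k\<in>{1..n}. (1 / real n) *\<^sub>R measure_pmf.expectation (map_pmf (path_sizes k) C) w)"
    unfolding scaleR_sum_right[symmetric] using finC
    by (intro sum.cong refl arg_cong2[where f = scaleR] integral_measure_pmf[symmetric]) (auto simp: S_def)
  also have "\<dots> = (1 / real n) *\<^sub>R (\<Sum>k=1..<1+n. measure_pmf.expectation C (\<lambda>T. w (path_sizes k T)))"
    unfolding scaleR_sum_right by (intro sum.cong) auto
  also have "\<dots> = path_transform s d t' (n - 1)"
    unfolding C_def critical_beta_splitting_def w_def uniform_leaf_transform[OF n]
    using n by (simp add: scaleR_conv_of_real)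
  finally show ?thesis unfolding H_def t'_def .
qed

end

section \<open>Characteristic functions of Brownian functionals\<close>
lemma Riemann_sum_tendsto_integral:
  fixes f :: "real \<Rightarrow> real"
  assumes f: "continuous_on {0..1} f"
  shows "(\<lambda>n. (1 / real (Suc n)) * (\<Sum>i=1..Suc n. f (real i / real (Suc n)))) \<longlonglongrightarrow> integral {0..1} f"
proof (rule tendstoI)
  fix \<epsilon> :: real assume eps: "0 < \<epsilon>"
  have "uniformly_continuous_on {0..1} f"
    using compact_uniformly_continuous[OF f] by simp
  then obtain \<delta> where \<delta>: "0 < \<delta>" "\<And>x y. x \<in> {0..1} \<Longrightarrow> y \<in> {0..1} \<Longrightarrow> dist y x < \<delta> \<Longrightarrow> dist (f y) (f x) < \<epsilon> / 2"
    using eps unfolding uniformly_continuous_on_def by (metis half_gt_zero)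
  have "(\<lambda>n. 1 / real (Suc n)) \<longlonglongrightarrow> 0" by (rule LIMSEQ_Suc[OF lim_1_over_n])
  then have "\<forall>\<^sub>F n in sequentially. 1 / real (Suc n) < \<delta>" using \<delta>(1) by (rule order_tendstoD)
  then show "\<forall>\<^sub>F n in sequentially. dist ((1 / real (Suc n)) * (\<Sum>i=1..Suc n. f (real i / real (Suc n)))) (integral {0..1} f) < \<epsilon>"
  proof eventually_elim
    case (elim n)
    define k where "k = Suc n"
    have k: "0 < real k" "1 / real k < \<delta>" using elim by (auto simp: k_def)
    have "\<bar>integral {0..real m / real k} f - (1 / real k) * (\<Sum>i=1..m. f (real i / real k))\<bar> \<le> real m / real k * (\<epsilon> / 2)"
      if "m \<le> k" for m
      using that
    proof (induction m)
      case (Suc m)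
      define x y where "x = real m / real k" and "y = real (Suc m) / real k"
      have xy: "0 \<le> x" "x \<le> y" "y \<le> 1" "y - x = 1 / real k"
        using Suc.prems k by (auto simp: x_def y_def divide_simps)
      have int: "f integrable_on {0..y}" "f integrable_on {x..y}"
        using xy by (auto intro!: integrable_continuous_interval continuous_on_subset[OF f])
      have "integral {x..y} f - (1 / real k) * f y = integral {x..y} (\<lambda>u. f u - f y)"
        using int xy by (subst Henstock_Kurzweil_Integration.integral_diff) auto
      also have "norm \<dots> \<le> \<epsilon> / 2 * (y - x)"
      proof (rule integral_bound[OF xy(2)])
        show "continuous_on {x..y} (\<lambda>u. f u - f y)"
          using xy by (intro continuous_intros continuous_on_subset[OF f]) auto
        show "norm (f u - f y) \<le> \<epsilon> / 2" if "u \<in> {x..y}" for u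
          using \<delta>(2)[of y u] xy k that by (auto simp: dist_real_def)
      qed
      finally have 1: "\<bar>integral {x..y} f - (1 / real k) * f y\<bar> \<le> \<epsilon> / 2 * (1 / real k)" using xy by simp
      have 2: "integral {0..y} f = integral {0..x} f + integral {x..y} f"
        using Henstock_Kurzweil_Integration.integral_combine[OF xy(1,2) int(1)] by simp
      have 3: "(1 / real k) * (\<Sum>i=1..Suc m. f (real i / real k)) = (1 / real k) * (\<Sum>i=1..m. f (real i / real k)) + (1 / real k) * f y"
        by (simp add: y_def distrib_left del: of_nat_Suc)
      have 4: "real (Suc m) / real k * (\<epsilon> / 2) = real m / real k * (\<epsilon> / 2) + \<epsilon> / 2 * (1 / real k)"
        by (simp add: add_divide_distrib algebra_simps)
      have IH: "\<bar>integral {0..x} f - (1 / real k) * (\<Sum>i=1..m. f (real i / real k))\<bar> \<le> real m / real k * (\<epsilon> / 2)"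
        using Suc unfolding x_def by simp
      show ?case unfolding 3 4 unfolding y_def[symmetric] 2 using IH 1 by linarith
    qed simp
    from this[of k] have "\<bar>integral {0..1} f - (1 / real k) * (\<Sum>i=1..k. f (real i / real k))\<bar> \<le> \<epsilon> / 2"
      using k by simp
    then show ?case using eps unfolding k_def dist_real_def by linarith
  qed
qed

lemma (in prob_space) char_normal:
  assumes X: "distributed M lborel X (normal_density 0 \<sigma>)" and \<sigma>: "0 < \<sigma>"
  shows "char (distr M borel (\<lambda>\<omega>. c * X \<omega>)) 1 = exp (- of_real ((c * \<sigma>) ^ 2 / 2))"
proof -
  have D: "distributed M lborel (\<lambda>\<omega>. X \<omega> / \<sigma>) std_normal_density"
    using X normal_standard_normal_convert[OF \<sigma>, of X 0] by simp
  have m: "X \<in> borel_measurable M" using X by (simp add: distributed_def)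
  have "char (distr M borel (\<lambda>\<omega>. c * X \<omega>)) 1 = (\<integral>\<omega>. iexp (c * X \<omega>) \<partial>M)"
    unfolding char_def using m by (subst integral_distr) auto
  also have "\<dots> = (\<integral>\<omega>. iexp (c * \<sigma> * (X \<omega> / \<sigma>)) \<partial>M)" using \<sigma> by simp
  also have "\<dots> = char (distr M lborel (\<lambda>\<omega>. X \<omega> / \<sigma>)) (c * \<sigma>)"
    unfolding char_def using m by (subst integral_distr) auto
  also have "\<dots> = char std_normal_distribution (c * \<sigma>)"
    unfolding distributed_distr_eq_density[OF D] ..
  also have "\<dots> = exp (- of_real ((c * \<sigma>) ^ 2 / 2))"
    unfolding char_std_normal_distribution by (simp add: exp_of_real[symmetric])
  finally show ?thesis .
qed

lemma sum_linear_squares: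
  "(\<Sum>l<k. (a * (real (k - l) / real k) + b) ^ 2) = (\<Sum>m=1..k. (a * (real m / real k) + b) ^ 2 :: real)"
  by (rule sum.reindex_bij_witness[of _ "\<lambda>m. k - m" "\<lambda>l. k - l"]) auto

lemma variance_limit:
  fixes a b :: real
  shows "(\<lambda>n. (\<Sum>m=1..Suc n. (a * (real m / real (Suc n)) + b) ^ 2) / real (Suc n)) \<longlonglongrightarrow> a ^ 2 / 3 + a * b + b ^ 2"
proof -
  have "continuous_on {0..1} (\<lambda>u::real. (a * u + b) ^ 2)" by (intro continuous_intros)
  from Riemann_sum_tendsto_integral[OF this]
  have "(\<lambda>n. (\<Sum>m=1..Suc n. (a * (real m / real (Suc n)) + b) ^ 2) / real (Suc n)) \<longlonglongrightarrow> integral {0..1} (\<lambda>u. (a * u + b) ^ 2)"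
    by simp
  moreover have "((\<lambda>u. (a * u + b) ^ 2) has_integral (a ^ 2 * 1 ^ 3 / 3 + a * b * 1 ^ 2 + b ^ 2 * 1) - (a ^ 2 * 0 ^ 3 / 3 + a * b * 0 ^ 2 + b ^ 2 * 0)) {0..1::real}"
    by (rule fundamental_theorem_of_calculus)
       (auto intro!: derivative_eq_intros simp: has_real_derivative_iff_has_vector_derivative[symmetric]
          power2_eq_square algebra_simps)
  ultimately show ?thesis by (simp add: integral_unique)
qed

context std_brownian_motion
begin

lemma integral_W_limit:
  assumes "\<omega> \<in> space N"
  shows "(\<lambda>n. (1 / real (Suc n)) * (\<Sum>i=1..Suc n. W (real i / real (Suc n)) \<omega>)) \<longlonglongrightarrow> integral {0..1} (\<lambda>u. W u \<omega>)"
  by (rule Riemann_sum_tendsto_integral[OF W_continuous[OF assms]])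

text \<open>
  Stated for an arbitrary \<open>\<sigma>\<close>-algebra, in order to apply it to the one generated by the Brownian
  motion.
\<close>
lemma integral_W_measurable:
  assumes "space R = space N" "\<And>u. u \<in> {0..1} \<Longrightarrow> W u \<in> borel_measurable R"
  shows "(\<lambda>\<omega>. integral {0..1} (\<lambda>u. W u \<omega>)) \<in> borel_measurable R"
proof (rule borel_measurable_LIMSEQ_real)
  show "(\<lambda>n. (1 / real (Suc n)) * (\<Sum>i=1..Suc n. W (real i / real (Suc n)) \<omega>)) \<longlonglongrightarrow> integral {0..1} (\<lambda>u. W u \<omega>)"
    if "\<omega> \<in> space R" for \<omega>
    using that assms(1) by (intro integral_W_limit) simp
  show "(\<lambda>\<omega>. (1 / real (Suc n)) * (\<Sum>i=1..Suc n. W (real i / real (Suc n)) \<omega>)) \<in> borel_measurable R" for n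
    by (intro borel_measurable_times borel_measurable_sum assms(2)) (auto simp: divide_simps)
qed

text \<open>
  Summation by parts writes the Riemann sum in terms of the independent increments, with weights
  \<open>a (k - l) / k + b\<close>.
\<close>
lemma char_Riemann_sum:
  "(\<integral>\<omega>. iexp (a * ((1 / real (Suc n)) * (\<Sum>i=1..Suc n. W (real i / real (Suc n)) \<omega>)) + b * W 1 \<omega>) \<partial>N) =
    exp (- of_real ((\<Sum>m=1..Suc n. (a * (real m / real (Suc n)) + b) ^ 2) / real (Suc n) / 2))"
proof -
  define k where "k = Suc n"
  have k: "0 < real k" by (simp add: k_def)
  define t where "t i = real i / real k" for i
  define \<xi> where "\<xi> l \<omega> = W (t (Suc l)) \<omega> - W (t l) \<omega>" for l \<omega>
  define c where "c l = a * (real (k - l) / real k) + b" for l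
  have t: "0 \<le> t i" "t i < t (Suc i)" "i \<le> k \<Longrightarrow> t i \<le> 1" "t 0 = 0" "t k = 1" for i
    using k by (auto simp: t_def divide_strict_right_mono)
  have indep: "indep_vars (\<lambda>_. borel) \<xi> {..<k}"
    unfolding \<xi>_def[abs_def] by (rule W_indep_increments) (use t in auto)
  have \<xi>_distr: "distributed N lborel (\<xi> l) (normal_density 0 (sqrt (1 / real k)))" if "l < k" for l
  proof -
    have "t (Suc l) - t l = 1 / real k" using k by (simp add: t_def field_simps)
    then show ?thesis using W_normal_increments[of "t l" "t (Suc l)"] t(1)[of l] t(2)[of l] t(3)[of "Suc l"] that
      by (simp add: \<xi>_def[abs_def])
  qed
  have \<xi>_m: "\<xi> l \<in> borel_measurable N" if "l < k" for l
    using \<xi>_distr[OF that] by (simp add: distributed_def)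
  have W_m: "W (t i) \<in> borel_measurable N" if "i \<le> k" for i
    using t(1)[of i] t(3)[of i] that by (intro W_measurable) auto
  have "AE \<omega> in N. a * ((1 / real k) * (\<Sum>i=1..k. W (t i) \<omega>)) + b * W 1 \<omega> = (\<Sum>l<k. c l * \<xi> l \<omega>)"
    using W_zero
  proof eventually_elim
    case (elim \<omega>)
    have W: "W (t i) \<omega> = (\<Sum>l<i. \<xi> l \<omega>)" for i
      by (induction i) (auto simp: \<xi>_def elim t)
    have "(\<Sum>i=1..m. \<Sum>l<i. \<xi> l \<omega>) = (\<Sum>l<m. real (m - l) * \<xi> l \<omega>)" for m
    proof (induction m)
      case (Suc m)
      have "(\<Sum>l<Suc m. real (Suc m - l) * \<xi> l \<omega>) = (\<Sum>l<Suc m. real (m - l) * \<xi> l \<omega> + \<xi> l \<omega>)"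
        by (intro sum.cong refl) (auto simp: Suc_diff_le algebra_simps)
      also have "\<dots> = (\<Sum>l<m. real (m - l) * \<xi> l \<omega>) + (\<Sum>l<Suc m. \<xi> l \<omega>)"
        by (simp add: sum.distrib)
      finally show ?case using Suc by simp
    qed simp
    then have "(\<Sum>i=1..k. W (t i) \<omega>) = (\<Sum>l<k. real (k - l) * \<xi> l \<omega>)" unfolding W .
    moreover have "W 1 \<omega> = (\<Sum>l<k. \<xi> l \<omega>)" using W[of k] t by simp
    ultimately have "a * ((1 / real k) * (\<Sum>i=1..k. W (t i) \<omega>)) + b * W 1 \<omega> =
        (\<Sum>l<k. a * ((1 / real k) * (real (k - l) * \<xi> l \<omega>)) + b * \<xi> l \<omega>)"
      by (simp only: sum.distrib sum_distrib_left)
    also have "\<dots> = (\<Sum>l<k. c l * \<xi> l \<omega>)"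
      by (intro sum.cong refl) (simp add: c_def distrib_left distrib_right mult_ac del: of_nat_diff)
    finally show ?case .
  qed
  then have AE_eq: "AE \<omega> in N. iexp (a * ((1 / real k) * (\<Sum>i=1..k. W (t i) \<omega>)) + b * W 1 \<omega>) = iexp (\<Sum>l<k. c l * \<xi> l \<omega>)"
    by eventually_elim (simp only:)
  have "(\<integral>\<omega>. iexp (a * ((1 / real k) * (\<Sum>i=1..k. W (t i) \<omega>)) + b * W 1 \<omega>) \<partial>N) = (\<integral>\<omega>. iexp (\<Sum>l<k. c l * \<xi> l \<omega>) \<partial>N)"
  proof (rule integral_cong_AE[OF _ _ AE_eq])
    have "(\<lambda>\<omega>. a * ((1 / real k) * (\<Sum>i=1..k. W (t i) \<omega>)) + b * W 1 \<omega>) \<in> borel_measurable N"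
      using W_m W_measurable[of 1] by (intro borel_measurable_add borel_measurable_times borel_measurable_sum) auto
    then show "(\<lambda>\<omega>. iexp (a * ((1 / real k) * (\<Sum>i=1..k. W (t i) \<omega>)) + b * W 1 \<omega>)) \<in> borel_measurable N"
      by measurable
    have "(\<lambda>\<omega>. \<Sum>l<k. c l * \<xi> l \<omega>) \<in> borel_measurable N"
      using \<xi>_m by (intro borel_measurable_times borel_measurable_sum) auto
    then show "(\<lambda>\<omega>. iexp (\<Sum>l<k. c l * \<xi> l \<omega>)) \<in> borel_measurable N" by measurable
  qed
  also have "\<dots> = char (distr N borel (\<lambda>\<omega>. \<Sum>l<k. c l * \<xi> l \<omega>)) 1"
    unfolding char_def using \<xi>_m by (subst integral_distr) (auto intro!: borel_measurable_sum borel_measurable_times)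
  also have "\<dots> = (\<Prod>l<k. char (distr N borel (\<lambda>\<omega>. c l * \<xi> l \<omega>)) 1)"
    by (rule char_distr_sum) (rule indep_vars_compose2[OF indep], simp)
  also have "\<dots> = (\<Prod>l<k. exp (- of_real ((c l) ^ 2 / real k / 2)))"
    using k by (intro prod.cong refl) (subst char_normal[OF \<xi>_distr], auto simp: power_mult_distrib power_divide)
  also have "\<dots> = exp (\<Sum>l<k. - of_real ((c l) ^ 2 / real k / 2))" by (rule exp_sum[symmetric]) simp
  also have "(\<Sum>l<k. - complex_of_real ((c l) ^ 2 / real k / 2)) = - of_real ((\<Sum>l<k. c l ^ 2) / real k / 2)"
    by (simp only: sum_negf of_real_sum[symmetric] sum_divide_distrib)
  finally show ?thesis unfolding c_def sum_linear_squares t_def k_def .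
qed

lemma char_integral_and_endpoint:
  "(\<integral>\<omega>. iexp (a * integral {0..1} (\<lambda>u. W u \<omega>) + b * W 1 \<omega>) \<partial>N) = exp (- of_real ((a ^ 2 / 3 + a * b + b ^ 2) / 2))"
proof (rule LIMSEQ_unique)
  let ?R = "\<lambda>n \<omega>. (1 / real (Suc n)) * (\<Sum>i=1..Suc n. W (real i / real (Suc n)) \<omega>)"
  have W1: "W 1 \<in> borel_measurable N" by (rule W_measurable) simp
  have R: "?R n \<in> borel_measurable N" for n
    by (intro borel_measurable_times borel_measurable_sum W_measurable) (auto simp: divide_simps)
  show "(\<lambda>n. \<integral>\<omega>. iexp (a * ?R n \<omega> + b * W 1 \<omega>) \<partial>N) \<longlonglongrightarrow>
      (\<integral>\<omega>. iexp (a * integral {0..1} (\<lambda>u. W u \<omega>) + b * W 1 \<omega>) \<partial>N)"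
  proof (rule integral_dominated_convergence[where w = "\<lambda>_. 1"])
    have "(\<lambda>\<omega>. integral {0..1} (\<lambda>u. W u \<omega>)) \<in> borel_measurable N"
      by (rule integral_W_measurable[OF refl W_measurable])
    then show "(\<lambda>\<omega>. iexp (a * integral {0..1} (\<lambda>u. W u \<omega>) + b * W 1 \<omega>)) \<in> borel_measurable N"
      using W1 by measurable
    show "(\<lambda>\<omega>. iexp (a * ?R n \<omega> + b * W 1 \<omega>)) \<in> borel_measurable N" for n
      using W1 R[of n] by measurable
    show "AE \<omega> in N. (\<lambda>n. iexp (a * ?R n \<omega> + b * W 1 \<omega>)) \<longlonglongrightarrow> iexp (a * integral {0..1} (\<lambda>u. W u \<omega>) + b * W 1 \<omega>)"
      by (intro AE_I2 tendsto_intros integral_W_limit)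
  qed auto
  show "(\<lambda>n. \<integral>\<omega>. iexp (a * ?R n \<omega> + b * W 1 \<omega>) \<partial>N) \<longlonglongrightarrow> exp (- of_real ((a ^ 2 / 3 + a * b + b ^ 2) / 2))"
    unfolding char_Riemann_sum by (intro tendsto_intros variance_limit) auto
qed

lemma char_limit:
  fixes Y :: "nat \<Rightarrow> 'a \<Rightarrow> real" and j :: nat
  assumes Y_normal: "\<And>r. r \<in> {1..j} \<Longrightarrow> distributed N lborel (Y r) std_normal_density"
    and Y_indep: "indep_vars (\<lambda>_. borel) Y {1..j}"
    and Y_W_indep: "indep_set
         (sets (vimage_algebra (space N) (\<lambda>\<omega>. \<lambda>r\<in>{1..j}. Y r \<omega>) (PiM {1..j} (\<lambda>_. borel))))
         (sets (vimage_algebra (space N) (\<lambda>\<omega>. \<lambda>u\<in>{0..1::real}. W u \<omega>) (PiM {0..1} (\<lambda>_. borel))))"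
  shows "(\<integral>\<omega>. iexp (a * integral {0..1} (\<lambda>u. W u \<omega>) + b * W 1 \<omega> + (\<Sum>r=1..j. y r * Y r \<omega>)) \<partial>N) =
    exp (- of_real ((a ^ 2 / 3 + a * b + b ^ 2) / 2 + (\<Sum>r=1..j. y r ^ 2) / 2))"
proof -
  define VY where "VY = vimage_algebra (space N) (\<lambda>\<omega>. \<lambda>r\<in>{1..j}. Y r \<omega>) (PiM {1..j} (\<lambda>_. borel :: real measure))"
  define VW where "VW = vimage_algebra (space N) (\<lambda>\<omega>. \<lambda>u\<in>{0..1::real}. W u \<omega>) (PiM {0..1} (\<lambda>_. borel :: real measure))"
  define SY where "SY \<omega> = (\<Sum>r=1..j. y r * Y r \<omega>)" for \<omega>
  define SW where "SW \<omega> = a * integral {0..1} (\<lambda>u. W u \<omega>) + b * W 1 \<omega>" for \<omega>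
  have Ym: "Y r \<in> borel_measurable VY" if "r \<in> {1..j}" for r
  proof -
    have "(\<lambda>\<omega>. \<lambda>r\<in>{1..j}. Y r \<omega>) \<in> VY \<rightarrow>\<^sub>M PiM {1..j} (\<lambda>_. borel)"
      unfolding VY_def by (rule measurable_vimage_algebra1) (auto simp: space_PiM)
    from measurable_compose[OF this measurable_component_singleton[OF that]] show ?thesis using that by simp
  qed
  have Wm: "W u \<in> borel_measurable VW" if "u \<in> {0..1}" for u
  proof -
    have "(\<lambda>\<omega>. \<lambda>u\<in>{0..1}. W u \<omega>) \<in> VW \<rightarrow>\<^sub>M PiM {0..1} (\<lambda>_. borel)"
      unfolding VW_def by (rule measurable_vimage_algebra1) (auto simp: space_PiM)
    from measurable_compose[OF this measurable_component_singleton[OF that]] show ?thesis using that by simp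
  qed
  have SYm: "(\<lambda>\<omega>. iexp (SY \<omega>)) \<in> borel_measurable VY"
  proof -
    have "SY \<in> borel_measurable VY"
      unfolding SY_def by (intro borel_measurable_sum borel_measurable_times Ym) auto
    then show ?thesis by measurable
  qed
  have SWm: "(\<lambda>\<omega>. iexp (SW \<omega>)) \<in> borel_measurable VW"
  proof -
    have "(\<lambda>\<omega>. integral {0..1} (\<lambda>u. W u \<omega>)) \<in> borel_measurable VW"
      by (rule integral_W_measurable[OF _ Wm]) (simp add: VW_def)
    then have "SW \<in> borel_measurable VW"
      unfolding SW_def using Wm[of 1] by (intro borel_measurable_add borel_measurable_times) auto
    then show ?thesis by measurable
  qed
  have ind: "indep_var borel (\<lambda>\<omega>. iexp (SY \<omega>)) borel (\<lambda>\<omega>. iexp (SW \<omega>))"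
    by (rule indep_var_of_indep_set[OF Y_W_indep[folded VY_def VW_def] _ _ SYm SWm])
       (simp_all add: VY_def VW_def)
  have Ymeas: "Y r \<in> borel_measurable N" if "r \<in> {1..j}" for r
    using Y_normal[OF that] by (simp add: distributed_def)
  have "(\<integral>\<omega>. iexp (SY \<omega>) * iexp (SW \<omega>) \<partial>N) = (\<integral>\<omega>. iexp (SY \<omega>) \<partial>N) * (\<integral>\<omega>. iexp (SW \<omega>) \<partial>N)"
  proof (rule indep_var_lebesgue_integral[OF ind])
    show "integrable N (\<lambda>\<omega>. iexp (SY \<omega>))" "integrable N (\<lambda>\<omega>. iexp (SW \<omega>))"
      using indep_var_rv1[OF ind] indep_var_rv2[OF ind] by (auto intro!: integrable_const_bound[where B = 1])
  qed
  also have "(\<integral>\<omega>. iexp (SY \<omega>) \<partial>N) = char (distr N borel (\<lambda>\<omega>. \<Sum>r=1..j. y r * Y r \<omega>)) 1"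
    unfolding char_def SY_def using Ymeas
    by (subst integral_distr) (auto intro!: borel_measurable_sum borel_measurable_times)
  also have "\<dots> = (\<Prod>r=1..j. char (distr N borel (\<lambda>\<omega>. y r * Y r \<omega>)) 1)"
    by (rule char_distr_sum) (rule indep_vars_compose2[OF Y_indep], simp)
  also have "\<dots> = (\<Prod>r=1..j. exp (- of_real (y r ^ 2 / 2)))"
    by (intro prod.cong refl) (subst char_normal[OF Y_normal], auto)
  also have "\<dots> = exp (\<Sum>r=1..j. - of_real (y r ^ 2 / 2))" by (rule exp_sum[symmetric]) (rule finite_atLeastAtMost)
  also have "(\<Sum>r=1..j. - complex_of_real (y r ^ 2 / 2)) = - of_real ((\<Sum>r=1..j. y r ^ 2) / 2)"
    by (simp only: sum_negf of_real_sum[symmetric] sum_divide_distrib)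
  also have "(\<integral>\<omega>. iexp (SW \<omega>) \<partial>N) = exp (- of_real ((a ^ 2 / 3 + a * b + b ^ 2) / 2))"
    unfolding SW_def by (rule char_integral_and_endpoint)
  finally show ?thesis
    unfolding SW_def SY_def exp_add[symmetric]
    by (simp only: distrib_left[symmetric] of_real_add[symmetric] minus_add_distrib[symmetric] add_ac)
qed

end

section \<open>A continuity theorem in Euclidean space\<close>
inductive trig_poly :: "('c::euclidean_space \<Rightarrow> complex) \<Rightarrow> bool" where
  char: "trig_poly (\<lambda>x. iexp (u \<bullet> x))"
| scale: "trig_poly f \<Longrightarrow> trig_poly (\<lambda>x. c * f x)"
| add: "trig_poly f \<Longrightarrow> trig_poly g \<Longrightarrow> trig_poly (\<lambda>x. f x + g x)"

lemma trig_poly_mult: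
  assumes "trig_poly f" "trig_poly g"
  shows "trig_poly (\<lambda>x. f x * g x)"
  using assms(1)
proof (induction f)
  case (char u)
  from assms(2) show ?case
  proof (induction g)
    case (char u')
    have "(\<lambda>x. iexp (u \<bullet> x) * iexp (u' \<bullet> x)) = (\<lambda>x. iexp ((u + u') \<bullet> x))"
      by (simp add: exp_add[symmetric] inner_add_left distrib_left)
    then show ?case using trig_poly.char[of "u + u'"] by simp
  next
    case (scale f c)
    from trig_poly.scale[OF scale.IH, of c] show ?case by (simp add: mult_ac)
  next
    case (add f g)
    from trig_poly.add[OF add.IH] show ?case by (simp add: distrib_left)
  qed
next
  case (scale f c)
  from trig_poly.scale[OF scale.IH, of c] show ?case by (simp add: mult_ac)
next
  case (add f g)
  from trig_poly.add[OF add.IH] show ?case by (simp add: distrib_right)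
qed

lemma trig_poly_const: "trig_poly (\<lambda>x. c)"
  using trig_poly.scale[OF trig_poly.char[of 0], of c] by simp

lemma trig_poly_sum: "finite A \<Longrightarrow> (\<And>a. a \<in> A \<Longrightarrow> trig_poly (f a)) \<Longrightarrow> trig_poly (\<lambda>x. \<Sum>a\<in>A. f a x)"
  by (induction A rule: finite_induct) (auto intro: trig_poly_const trig_poly.add)

lemma trig_poly_sin: "trig_poly (\<lambda>x. of_real (sin (u \<bullet> x)))"
proof -
  have "trig_poly (\<lambda>x. 1 / (2 * \<i>) * iexp (u \<bullet> x) + (- 1 / (2 * \<i>)) * iexp ((- u) \<bullet> x))"
    by (intro trig_poly.intros)
  moreover have "1 / (2 * \<i>) * iexp (u \<bullet> x) + (- 1 / (2 * \<i>)) * iexp ((- u) \<bullet> x) = of_real (sin (u \<bullet> x))" for x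
    unfolding sin_of_real[symmetric] sin_exp_eq by (simp add: field_simps)
  ultimately show ?thesis by simp
qed

text \<open>
  For \<open>0 < c \<le> \<pi> / (2 K)\<close> the cube of half side \<open>K\<close> is mapped homeomorphically onto its image, and
  the coordinates of the image point are trigonometric polynomials.
\<close>
definition sin_map :: "real \<Rightarrow> 'c::euclidean_space \<Rightarrow> 'c" where
  "sin_map c x = (\<Sum>b\<in>Basis. sin (c * (x \<bullet> b)) *\<^sub>R b)"

lemma trig_poly_polynomial:
  assumes "real_polynomial_function p"
  shows "trig_poly (\<lambda>x. of_real (p (sin_map c x)))"
  using assms
proof (induction p)
  case (linear f)
  interpret bounded_linear f by fact
  have "f (sin_map c x) = (\<Sum>b\<in>Basis. f b * sin ((c *\<^sub>R b) \<bullet> x))" for x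
    by (simp add: sin_map_def sum scaleR inner_commute mult.commute)
  then have eq: "complex_of_real (f (sin_map c x)) = (\<Sum>b\<in>Basis. of_real (f b) * of_real (sin ((c *\<^sub>R b) \<bullet> x)))" for x
    by (simp only: of_real_sum of_real_mult)
  show ?case unfolding eq by (intro trig_poly_sum trig_poly.scale trig_poly_sin) auto
next
  case (const c)
  then show ?case by (rule trig_poly_const)
next
  case (add f g)
  from trig_poly.add[OF add.IH] show ?case by simp
next
  case (mult f g)
  from trig_poly_mult[OF mult.IH] show ?case by simp
qed

lemma trig_poly_bounded_measurable:
  fixes f :: "'c::euclidean_space \<Rightarrow> complex"
  assumes "trig_poly f"
  shows "f \<in> borel_measurable borel \<and> (\<exists>B. \<forall>x. norm (f x) \<le> B)"
  using assms
proof (induction f)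
  case (char u)
  have "norm (iexp (u \<bullet> x)) \<le> 1" for x :: 'c by simp
  then show ?case by (intro conjI exI[of _ 1]) auto
next
  case (scale f c)
  then obtain B where "\<And>x. norm (f x) \<le> B" by auto
  then have "norm (c * f x) \<le> norm c * B" for x by (simp add: norm_mult mult_left_mono)
  then show ?case using scale by auto
next
  case (add f g)
  then obtain B C where "\<And>x. norm (f x) \<le> B" "\<And>x. norm (g x) \<le> C" by auto
  then have "norm (f x + g x) \<le> B + C" for x by (meson add_mono norm_triangle_ineq order_trans)
  then show ?case using add by auto
qed

lemma (in prob_space) integrable_bounded:
  fixes f :: "'c \<Rightarrow> 'd::{banach, second_countable_topology}"
  assumes "f \<in> borel_measurable N" "X \<in> M \<rightarrow>\<^sub>M N" "\<And>x. norm (f x) \<le> B"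
  shows "integrable M (\<lambda>\<omega>. f (X \<omega>))"
  using assms by (intro integrable_const_bound[where B = B]) auto

locale char_convergence = N: prob_space N
  for M :: "nat \<Rightarrow> 'a measure" and X :: "nat \<Rightarrow> 'a \<Rightarrow> 'c::euclidean_space"
    and N :: "'b measure" and Z :: "'b \<Rightarrow> 'c" +
  assumes prob: "\<And>n. prob_space (M n)"
    and X: "\<And>n. X n \<in> borel_measurable (M n)" and Z: "Z \<in> borel_measurable N"
    and char_conv: "\<And>u. (\<lambda>n. \<integral>\<omega>. iexp (u \<bullet> X n \<omega>) \<partial>M n) \<longlonglongrightarrow> (\<integral>\<omega>. iexp (u \<bullet> Z \<omega>) \<partial>N)"
begin

lemma trig_poly_conv:
  assumes "trig_poly f"
  shows "(\<lambda>n. \<integral>\<omega>. f (X n \<omega>) \<partial>M n) \<longlonglongrightarrow> (\<integral>\<omega>. f (Z \<omega>) \<partial>N)"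
  using assms
proof (induction f)
  case (char u)
  show ?case by (rule char_conv)
next
  case (scale f c)
  then show ?case by (simp add: tendsto_mult_left)
next
  case (add f g)
  obtain B C where B: "\<And>x. norm (f x) \<le> B" "\<And>x. norm (g x) \<le> C"
    using trig_poly_bounded_measurable[OF add.hyps(1)] trig_poly_bounded_measurable[OF add.hyps(2)] by auto
  have m: "f \<in> borel_measurable borel" "g \<in> borel_measurable borel"
    using trig_poly_bounded_measurable[OF add.hyps(1)] trig_poly_bounded_measurable[OF add.hyps(2)] by auto
  have "integrable (M n) (\<lambda>\<omega>. f (X n \<omega>))" "integrable (M n) (\<lambda>\<omega>. g (X n \<omega>))" for n
    using prob_space.integrable_bounded[OF prob _ X] m B by blast+
  moreover have "integrable N (\<lambda>\<omega>. f (Z \<omega>))" "integrable N (\<lambda>\<omega>. g (Z \<omega>))"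
    using N.integrable_bounded[OF _ Z] m B by blast+
  ultimately show ?case using tendsto_add[OF add.IH] by simp
qed

text \<open>Levy's continuity theorem for the coordinates.\<close>
lemma marginal_conv:
  fixes h :: "real \<Rightarrow> real"
  assumes h: "continuous_on UNIV h" "\<And>x. \<bar>h x\<bar> \<le> B"
  shows "(\<lambda>n. \<integral>\<omega>. h (X n \<omega> \<bullet> b) \<partial>M n) \<longlonglongrightarrow> (\<integral>\<omega>. h (Z \<omega> \<bullet> b) \<partial>N)"
proof -
  define \<mu> where "\<mu> n = distr (M n) borel (\<lambda>\<omega>. X n \<omega> \<bullet> b)" for n
  define \<nu> where "\<nu> = distr N borel (\<lambda>\<omega>. Z \<omega> \<bullet> b)"
  have Xb: "(\<lambda>\<omega>. X n \<omega> \<bullet> b) \<in> borel_measurable (M n)" for n using X by measurable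
  have Zb: "(\<lambda>\<omega>. Z \<omega> \<bullet> b) \<in> borel_measurable N" using Z by measurable
  have rd: "real_distribution (\<mu> n)" for n
    unfolding \<mu>_def real_distribution_def real_distribution_axioms_def
    using prob_space.prob_space_distr[OF prob Xb] by simp
  have rdN: "real_distribution \<nu>"
    unfolding \<nu>_def real_distribution_def real_distribution_axioms_def
    using N.prob_space_distr[OF Zb] by simp
  have "weak_conv_m \<mu> \<nu>"
  proof (rule levy_continuity[OF rd rdN])
    fix t
    have 1: "char (\<mu> n) t = (\<integral>\<omega>. iexp ((t *\<^sub>R b) \<bullet> X n \<omega>) \<partial>M n)" for n
      unfolding char_def \<mu>_def using Xb by (subst integral_distr) (auto simp: inner_commute)
    have 2: "char \<nu> t = (\<integral>\<omega>. iexp ((t *\<^sub>R b) \<bullet> Z \<omega>) \<partial>N)"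
      unfolding char_def \<nu>_def using Zb by (subst integral_distr) (auto simp: inner_commute)
    show "(\<lambda>n. char (\<mu> n) t) \<longlonglongrightarrow> char \<nu> t" unfolding 1 2 by (rule char_conv)
  qed
  moreover have "isCont h x" for x
    using h(1) by (simp add: continuous_on_eq_continuous_at)
  ultimately have "(\<lambda>n. integral\<^sup>L (\<mu> n) h) \<longlonglongrightarrow> integral\<^sup>L \<nu> h"
    using weak_conv_imp_integral_bdd_continuous_conv[OF rd rdN, where f = h and B = B] h(2) by simp
  moreover have "h \<in> borel_measurable borel" using h(1) by (rule borel_measurable_continuous_onI)
  ultimately show ?thesis
    unfolding \<mu>_def \<nu>_def using Xb Zb by (simp add: integral_distr)
qed

text \<open>
  A continuous majorant of the indicator function of \<open>|x| \<ge> K + 1\<close>, which vanishes for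
  \<open>|x| \<le> K\<close>.
\<close>
definition ramp :: "real \<Rightarrow> real \<Rightarrow> real" where
  "ramp K x = min 1 (max 0 (\<bar>x\<bar> - K))"

lemma ramp: "0 \<le> ramp K x" "ramp K x \<le> 1" "\<bar>ramp K x\<bar> \<le> 1" "K + 1 \<le> \<bar>x\<bar> \<Longrightarrow> ramp K x = 1" "continuous_on UNIV (ramp K)"
  unfolding ramp_def by (auto intro!: continuous_intros)

lemma ramp_integral_small:
  assumes "0 < \<epsilon>"
  obtains K where "0 \<le> K" "(\<integral>\<omega>. (\<Sum>b\<in>Basis. ramp K (Z \<omega> \<bullet> b)) \<partial>N) < \<epsilon>"
proof -
  have "(\<lambda>K. \<integral>\<omega>. (\<Sum>b\<in>Basis. ramp (real K) (Z \<omega> \<bullet> b)) \<partial>N) \<longlonglongrightarrow> (\<integral>\<omega>. 0 \<partial>N)"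
  proof (rule integral_dominated_convergence[where w = "\<lambda>_. real DIM('c)"])
    have "(\<lambda>x. ramp K x) \<in> borel_measurable borel" for K
      by (rule borel_measurable_continuous_onI) (rule ramp)
    then show "(\<lambda>\<omega>. \<Sum>b\<in>Basis. ramp (real K) (Z \<omega> \<bullet> b)) \<in> borel_measurable N" for K
      using Z by measurable
    have "(\<lambda>K. ramp (real K) x) \<longlonglongrightarrow> 0" for x
    proof (rule tendsto_eventually)
      obtain k :: nat where "\<bar>x\<bar> \<le> real k" using real_arch_simple by blast
      then have "ramp (real K) x = 0" if "K \<ge> k" for K using that by (simp add: ramp_def)
      then show "\<forall>\<^sub>F K in sequentially. ramp (real K) x = 0" by (rule eventually_sequentiallyI)
    qed
    then have "(\<lambda>K. \<Sum>b\<in>Basis. ramp (real K) (Z \<omega> \<bullet> b)) \<longlonglongrightarrow> (\<Sum>b\<in>(Basis::'c set). 0)" for \<omega>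
      by (intro tendsto_sum)
    then show "AE \<omega> in N. (\<lambda>K. \<Sum>b\<in>Basis. ramp (real K) (Z \<omega> \<bullet> b)) \<longlonglongrightarrow> 0" by simp
    have "norm (\<Sum>b\<in>Basis. ramp (real K) (Z \<omega> \<bullet> b)) \<le> (\<Sum>b\<in>(Basis::'c set). 1)" for K \<omega>
      by (intro order_trans[OF norm_sum] sum_mono) (simp add: ramp)
    then show "AE \<omega> in N. norm (\<Sum>b\<in>Basis. ramp (real K) (Z \<omega> \<bullet> b)) \<le> real DIM('c)" for K by simp
  qed auto
  then have "\<forall>\<^sub>F K in sequentially. (\<integral>\<omega>. (\<Sum>b\<in>Basis. ramp (real K) (Z \<omega> \<bullet> b)) \<partial>N) < \<epsilon>"
    using assms by (auto dest: order_tendstoD)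
  then obtain K :: nat where "(\<integral>\<omega>. (\<Sum>b\<in>Basis. ramp (real K) (Z \<omega> \<bullet> b)) \<partial>N) < \<epsilon>"
    by (auto simp: eventually_sequentially)
  then show ?thesis by (intro that[of "real K"]) auto
qed

text \<open>
  Composed with \<open>arc\<close>, the function \<open>f\<close> becomes a continuous function on the cube \<open>Q\<close>; let \<open>p\<close> be a
  polynomial close to it. Then \<open>P = p \<circ> sin_map c\<close> is a trigonometric polynomial which is close to
  \<open>f\<close> where all coordinates are at most \<open>K + 1\<close>. Outside, \<open>P\<close> is still bounded by the bound of
  \<open>f\<close>, because \<open>arc (sin_map c x)\<close> folds the whole space periodically into this cube; this is why
  polynomials in sines are used. The error outside is controlled by the ramps.
\<close>
lemma bounded_continuous_conv:
  fixes f :: "'c \<Rightarrow> real"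
  assumes f: "continuous_on UNIV f" and B: "\<And>x. \<bar>f x\<bar> \<le> B"
  shows "(\<lambda>n. \<integral>\<omega>. f (X n \<omega>) \<partial>M n) \<longlonglongrightarrow> (\<integral>\<omega>. f (Z \<omega>) \<partial>N)"
proof (rule tendstoI)
  fix \<delta> :: real assume "0 < \<delta>"
  have B0: "0 \<le> B" using B[of 0] by linarith
  define \<epsilon> where "\<epsilon> = \<delta> / (3 * (1 + 2 * B))"
  have eps3: "\<epsilon> * (3 * (1 + 2 * B)) = \<delta>" using B0 by (simp add: \<epsilon>_def)
  have eps: "0 < \<epsilon>" "(\<epsilon> + 2 * B * \<epsilon>) * 3 = \<delta>"
    using \<open>0 < \<delta>\<close> B0 by (simp add: \<epsilon>_def) (simp add: eps3[symmetric] algebra_simps)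
  obtain K where K: "0 \<le> K" "(\<integral>\<omega>. (\<Sum>b\<in>Basis. ramp K (Z \<omega> \<bullet> b)) \<partial>N) < \<epsilon>"
    using ramp_integral_small[OF eps(1)] .
  \<comment> \<open>the largest \<open>c\<close> for which \<open>sin (c x)\<close> is injective on \<open>[- (K + 1), K + 1]\<close>\<close>
  define c where "c = pi / 2 / (K + 1)"
  have "K + 1 \<noteq> 0" using K by auto
  then have c: "0 < c" "c * (K + 1) = pi / 2"
    using K(1) nonzero_eq_divide_eq[of "K + 1" c "pi / 2"] c_def by (simp add: c_def, blast)
  define arc where "arc s = (\<Sum>b\<in>Basis. ((1 / c) * arcsin (s \<bullet> b)) *\<^sub>R b)" for s :: 'c
  define Q where "Q = cbox (- One) (One :: 'c)"
  have Q: "s \<in> Q \<longleftrightarrow> (\<forall>b\<in>Basis. -1 \<le> s \<bullet> b \<and> s \<bullet> b \<le> 1)" for s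
    by (auto simp: Q_def mem_box)
  have sinQ: "sin_map c x \<in> Q" for x by (auto simp: Q sin_map_def)
  have "continuous_on Q arc"
    unfolding arc_def by (intro continuous_intros) (auto simp: Q)
  then have "continuous_on Q (\<lambda>s. f (arc s))"
    by (rule continuous_on_compose2[OF f]) auto
  then obtain p where p: "real_polynomial_function p" "\<And>s. s \<in> Q \<Longrightarrow> \<bar>f (arc s) - p s\<bar> < \<epsilon>"
    using Stone_Weierstrass_real_polynomial_function[of Q "\<lambda>s. f (arc s)" \<epsilon>] eps(1) compact_cbox
    unfolding Q_def by blast
  define P where "P x = p (sin_map c x)" for x
  define H where "H x = (\<Sum>b\<in>Basis. ramp K (x \<bullet> b))" for x :: 'c
  have H0: "0 \<le> H x" for x unfolding H_def by (intro sum_nonneg ramp)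
  have approx: "\<bar>f x - P x\<bar> \<le> \<epsilon> + 2 * B * H x" for x
  proof (cases "\<forall>b\<in>Basis. \<bar>x \<bullet> b\<bar> \<le> K + 1")
    case True
    have "arcsin (sin (c * (x \<bullet> b))) = c * (x \<bullet> b)" if "b \<in> Basis" for b
    proof -
      have "\<bar>c * (x \<bullet> b)\<bar> \<le> c * (K + 1)"
        using True that c(1) by (simp add: abs_mult)
      then show ?thesis unfolding c(2) by (intro arcsin_sin) auto
    qed
    then have "arc (sin_map c x) = (\<Sum>b\<in>Basis. (x \<bullet> b) *\<^sub>R b)"
      unfolding arc_def using c(1) by (intro sum.cong) (auto simp: sin_map_def)
    then have "arc (sin_map c x) = x" by (simp add: euclidean_representation)
    then have "\<bar>f x - P x\<bar> < \<epsilon>" using p(2)[OF sinQ, of x] by (simp add: P_def)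
    then show ?thesis using H0[of x] B0 by (meson add_increasing2 less_imp_le mult_nonneg_nonneg zero_le_numeral)
  next
    case False
    then obtain b where b: "b \<in> Basis" "K + 1 < \<bar>x \<bullet> b\<bar>" by force
    then have "1 = ramp K (x \<bullet> b)" by (simp add: ramp)
    also have "\<dots> \<le> H x" unfolding H_def using b(1) by (intro member_le_sum) (auto simp: ramp)
    finally have "2 * B * 1 \<le> 2 * B * H x" using B0 by (intro mult_left_mono) auto
    moreover have "\<bar>f (arc (sin_map c x)) - P x\<bar> < \<epsilon>" using p(2)[OF sinQ, of x] by (simp add: P_def)
    ultimately show ?thesis using B[of x] B[of "arc (sin_map c x)"] by linarith
  qed
  have tp: "trig_poly (\<lambda>x. of_real (P x))" unfolding P_def by (rule trig_poly_polynomial[OF p(1)])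
  obtain C where C: "\<And>x. \<bar>P x\<bar> \<le> C"
    using trig_poly_bounded_measurable[OF tp] by auto
  have meas: "f \<in> borel_measurable borel" "P \<in> borel_measurable borel" "H \<in> borel_measurable borel"
  proof -
    show "f \<in> borel_measurable borel" using f by (rule borel_measurable_continuous_onI)
    have "(\<lambda>x. complex_of_real (P x)) \<in> borel_measurable borel"
      using trig_poly_bounded_measurable[OF tp] by blast
    moreover have "Re \<in> borel_measurable borel"
      by (intro borel_measurable_continuous_onI continuous_intros)
    ultimately have "(\<lambda>x. Re (of_real (P x))) \<in> borel_measurable borel"
      by (rule measurable_compose)
    then show "P \<in> borel_measurable borel" by simp
    have "continuous_on UNIV (\<lambda>x. ramp K (x \<bullet> b))" for b :: 'c
      by (rule continuous_on_compose2[OF ramp(5)]) (auto intro!: continuous_intros)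
    then show "H \<in> borel_measurable borel"
      unfolding H_def by (intro borel_measurable_sum borel_measurable_continuous_onI)
  qed
  have HB: "norm (H x) \<le> real DIM('c)" for x
  proof -
    have "norm (H x) \<le> (\<Sum>b\<in>(Basis::'c set). 1)"
      unfolding H_def by (intro order_trans[OF norm_sum] sum_mono) (simp add: ramp)
    then show ?thesis by simp
  qed
  have compare: "\<bar>(\<integral>\<omega>. f (V \<omega>) \<partial>R) - (\<integral>\<omega>. P (V \<omega>) \<partial>R)\<bar> \<le> \<epsilon> + 2 * B * (\<integral>\<omega>. H (V \<omega>) \<partial>R)"
    if "prob_space R" and V: "V \<in> borel_measurable R" for R :: "'e measure" and V
  proof -
    interpret R: prob_space R by fact
    have i: "integrable R (\<lambda>\<omega>. f (V \<omega>))" "integrable R (\<lambda>\<omega>. P (V \<omega>))" "integrable R (\<lambda>\<omega>. H (V \<omega>))"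
      using R.integrable_bounded[OF meas(1) V, of B] R.integrable_bounded[OF meas(2) V, of C]
        R.integrable_bounded[OF meas(3) V HB] B C by auto
    have "\<bar>(\<integral>\<omega>. f (V \<omega>) \<partial>R) - (\<integral>\<omega>. P (V \<omega>) \<partial>R)\<bar> = \<bar>\<integral>\<omega>. f (V \<omega>) - P (V \<omega>) \<partial>R\<bar>"
      using i by simp
    also have "\<dots> \<le> (\<integral>\<omega>. \<bar>f (V \<omega>) - P (V \<omega>)\<bar> \<partial>R)" by (rule integral_abs_bound)
    also have "\<dots> \<le> (\<integral>\<omega>. \<epsilon> + 2 * B * H (V \<omega>) \<partial>R)"
      using i by (intro integral_mono approx) auto
    also have "\<dots> = \<epsilon> + 2 * B * (\<integral>\<omega>. H (V \<omega>) \<partial>R)"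
      using i by (simp add: R.prob_space)
    finally show ?thesis .
  qed
  have P_conv: "(\<lambda>n. \<integral>\<omega>. P (X n \<omega>) \<partial>M n) \<longlonglongrightarrow> (\<integral>\<omega>. P (Z \<omega>) \<partial>N)"
    using tendsto_Re[OF trig_poly_conv[OF tp]] by simp
  have H_conv: "(\<lambda>n. \<integral>\<omega>. H (X n \<omega>) \<partial>M n) \<longlonglongrightarrow> (\<integral>\<omega>. H (Z \<omega>) \<partial>N)"
  proof -
    have rm: "ramp K \<in> borel_measurable borel" by (rule borel_measurable_continuous_onI) (rule ramp)
    have "integrable (M n) (\<lambda>\<omega>. ramp K (X n \<omega> \<bullet> b))" for n b
      by (rule prob_space.integrable_bounded[OF prob rm, where B = 1]) (use X in \<open>auto simp: ramp\<close>)
    moreover have "integrable N (\<lambda>\<omega>. ramp K (Z \<omega> \<bullet> b))" for b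
      by (rule N.integrable_bounded[OF rm, where B = 1]) (use Z in \<open>auto simp: ramp\<close>)
    ultimately show ?thesis
      unfolding H_def by (simp add: marginal_conv[OF ramp(5) ramp(3)] tendsto_sum)
  qed
  have "\<forall>\<^sub>F n in sequentially. (\<integral>\<omega>. H (X n \<omega>) \<partial>M n) < \<epsilon>"
    using H_conv K(2) unfolding H_def by (rule order_tendstoD)
  moreover have "\<forall>\<^sub>F n in sequentially. dist (\<integral>\<omega>. P (X n \<omega>) \<partial>M n) (\<integral>\<omega>. P (Z \<omega>) \<partial>N) < \<epsilon>"
    using P_conv eps(1) by (rule tendstoD)
  ultimately show "\<forall>\<^sub>F n in sequentially. dist (\<integral>\<omega>. f (X n \<omega>) \<partial>M n) (\<integral>\<omega>. f (Z \<omega>) \<partial>N) < \<delta>"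
  proof eventually_elim
    case (elim n)
    have "2 * B * (\<integral>\<omega>. H (X n \<omega>) \<partial>M n) \<le> 2 * B * \<epsilon>" "2 * B * (\<integral>\<omega>. H (Z \<omega>) \<partial>N) \<le> 2 * B * \<epsilon>"
      using elim(1) K(2) B0 unfolding H_def by (auto intro!: mult_left_mono)
    moreover have "0 \<le> 2 * B * \<epsilon>" using B0 eps by simp
    ultimately show ?case
      using compare[OF prob X, of n] compare[OF N.prob_space_axioms Z] elim(2) eps unfolding dist_real_def by argo
  qed
qed

end

section \<open>Joint convergence of the heights\<close>
lemma converges_in_distribution_Suc:
  assumes "converges_in_distribution (\<lambda>n. M (Suc n)) (\<lambda>n. X (Suc n)) N Z"
  shows "converges_in_distribution M X N Z"
  using assms unfolding converges_in_distribution_def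
  by (simp add: eventually_sequentially_Suc[of "\<lambda>n. X n \<in> borel_measurable (M n)"]
        filterlim_sequentially_Suc[of "\<lambda>n. \<integral>\<omega>. _ (X n \<omega>) \<partial>M n"])

lemma converges_in_distribution_continuous:
  assumes conv: "converges_in_distribution M X N Z" and h: "continuous_on UNIV h"
  shows "converges_in_distribution M (\<lambda>n \<omega>. h (X n \<omega>)) N (\<lambda>\<omega>. h (Z \<omega>))"
  unfolding converges_in_distribution_def
proof (intro conjI allI impI)
  have hm: "h \<in> borel_measurable borel" using h by (rule borel_measurable_continuous_onI)
  show "\<forall>\<^sub>F n in sequentially. (\<lambda>\<omega>. h (X n \<omega>)) \<in> borel_measurable (M n)"
    using conv unfolding converges_in_distribution_def
    by (auto elim!: eventually_mono intro: measurable_compose[OF _ hm])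
  show "(\<lambda>\<omega>. h (Z \<omega>)) \<in> borel_measurable N"
    using conv unfolding converges_in_distribution_def by (auto intro: measurable_compose[OF _ hm])
  fix f :: "'d \<Rightarrow> real" assume f: "continuous_on UNIV f \<and> bounded (range f)"
  then have "continuous_on UNIV (\<lambda>x. f (h x))"
    using h by (auto intro: continuous_on_compose2)
  moreover have "bounded (range (\<lambda>x. f (h x)))"
    using f by (auto intro: bounded_subset)
  ultimately show "(\<lambda>n. \<integral>\<omega>. f (h (X n \<omega>)) \<partial>M n) \<longlonglongrightarrow> (\<integral>\<omega>. f (h (Z \<omega>)) \<partial>N)"
    using conv unfolding converges_in_distribution_def by blast
qed

lemma (in char_convergence) convergence_in_distribution: "converges_in_distribution M X N Z"
  unfolding converges_in_distribution_def
proof (intro conjI allI impI)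
  fix f :: "'c \<Rightarrow> real" assume f: "continuous_on UNIV f \<and> bounded (range f)"
  then obtain B where "\<And>x. norm (f x) \<le> B" by (auto simp: bounded_iff)
  then show "(\<lambda>n. \<integral>\<omega>. f (X n \<omega>) \<partial>M n) \<longlonglongrightarrow> (\<integral>\<omega>. f (Z \<omega>) \<partial>N)"
    using f by (intro bounded_continuous_conv[of f B]) auto
qed (use X Z in auto)

lemma borel_measurable_vec_lambda:
  fixes f :: "'d::finite \<Rightarrow> 'a \<Rightarrow> real"
  assumes "\<And>i. f i \<in> borel_measurable M"
  shows "(\<lambda>\<omega>. \<chi> i. f i \<omega>) \<in> borel_measurable M"
  unfolding borel_measurable_euclidean_space[of "\<lambda>\<omega>. \<chi> i. f i \<omega>"]
  using assms by (auto simp: Basis_vec_def inner_axis)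

text \<open>
  The normalisation turns the frequencies \<open>u1\<close>, \<open>u2\<close>, \<open>\<tau> r\<close> into frequencies of order \<open>\<eta>\<^sup>3\<close>, \<open>\<eta>\<close>,
  \<open>\<eta>\<close>. The centering depends on \<open>u2\<close> and on the \<open>\<tau> r\<close> only through \<open>\<kappa>0\<close>.
\<close>
lemma (in beta_splitting_model) normalized_transform:
  fixes u1 u2 \<sigma> :: real and \<tau> :: "nat \<Rightarrow> real" and j :: nat
  defines "l \<equiv> ln (real n)" and "\<eta> \<equiv> 1 / sqrt (ln (real n))"
    and "\<kappa>0 \<equiv> u2 / \<sigma> + (\<Sum>r=1..j. \<tau> r / real r)"
  assumes n: "2 \<le> n" and \<sigma>: "\<sigma> = sqrt (2 * zeta 3 / zeta 2 ^ 3)"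
  shows "(\<integral>\<omega>. iexp (u1 * ((edge_height T U \<omega> - 1 / (2 * zeta 2) * l ^ 2) / sqrt (2 * zeta 3 / zeta 2 ^ 3 * l ^ 3))
      + u2 * ((time_height T len U \<omega> - 1 / zeta 2 * l) / sqrt (2 * zeta 3 / zeta 2 ^ 3 * l))
      + (\<Sum>r=1..j. \<tau> r * ((decrement_count T U r \<omega> - 1 / (zeta 2 * real r) * l) / sqrt l))) \<partial>M) =
    exp (- \<i> * of_real ((u1 / \<sigma> * \<eta> ^ 3 * l ^ 2 / 2 + \<kappa>0 * \<eta> * l) / zeta 2)) *
      path_transform (u1 / \<sigma> * \<eta> ^ 3) (u2 / \<sigma> * \<eta>) (\<lambda>r. if r \<in> {1..j} then \<tau> r * \<eta> else 0) (n - 1)"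
proof -
  define w where "w = sqrt l"
  have l: "0 < l" using n by (simp add: l_def)
  then have w: "0 < w" "l = w ^ 2" "\<eta> = 1 / w" by (auto simp: w_def \<eta>_def l_def)
  have \<sigma>0: "0 < \<sigma>" unfolding \<sigma> using zeta_3_ge_1 zeta_2_ge_1 by simp
  have s3: "sqrt (2 * zeta 3 / zeta 2 ^ 3 * l ^ 3) = \<sigma> * w ^ 3"
    unfolding real_sqrt_mult \<sigma>[symmetric] by (simp add: real_sqrt_power w_def)
  have s1: "sqrt (2 * zeta 3 / zeta 2 ^ 3 * l) = \<sigma> * w"
    unfolding real_sqrt_mult \<sigma>[symmetric] w_def ..
  have z2: "zeta 2 \<noteq> 0" using zeta_2_ge_1 by auto
  define C where "C = (u1 / \<sigma> * \<eta> ^ 3 * l ^ 2 / 2 + \<kappa>0 * \<eta> * l) / zeta 2"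
  have split: "u1 * ((a - 1 / (2 * zeta 2) * l ^ 2) / sqrt (2 * zeta 3 / zeta 2 ^ 3 * l ^ 3))
      + u2 * ((b - 1 / zeta 2 * l) / sqrt (2 * zeta 3 / zeta 2 ^ 3 * l))
      + (\<Sum>r=1..j. \<tau> r * ((f r - 1 / (zeta 2 * real r) * l) / sqrt l)) =
     (u1 / \<sigma> * \<eta> ^ 3) * a + (u2 / \<sigma> * \<eta>) * b + (\<Sum>r=1..j. (\<tau> r * \<eta>) * f r) - C" for a b f
  proof -
    have 1: "u1 * ((a - 1 / (2 * zeta 2) * l ^ 2) / (\<sigma> * w ^ 3)) =
        (u1 / \<sigma> * \<eta> ^ 3) * a - u1 / \<sigma> * \<eta> ^ 3 * l ^ 2 / 2 / zeta 2"
      unfolding w(3) using \<sigma>0 w(1) z2 by (simp add: power_divide diff_divide_distrib right_diff_distrib)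
    have 2: "u2 * ((b - 1 / zeta 2 * l) / (\<sigma> * w)) = (u2 / \<sigma> * \<eta>) * b - u2 / \<sigma> * \<eta> * l / zeta 2"
      unfolding w(3) using \<sigma>0 w(1) z2 by (simp add: diff_divide_distrib right_diff_distrib)
    have "(\<Sum>r=1..j. \<tau> r * ((f r - 1 / (zeta 2 * real r) * l) / w)) =
        (\<Sum>r=1..j. (\<tau> r * \<eta>) * f r - \<tau> r / real r * (\<eta> * l / zeta 2))"
      unfolding w(3) by (intro sum.cong refl) (simp add: diff_divide_distrib right_diff_distrib mult_ac)
    then have 3: "(\<Sum>r=1..j. \<tau> r * ((f r - 1 / (zeta 2 * real r) * l) / w)) =
        (\<Sum>r=1..j. (\<tau> r * \<eta>) * f r) - (\<Sum>r=1..j. \<tau> r / real r) * (\<eta> * l / zeta 2)"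
      by (simp only: sum_subtractf sum_distrib_right)
    show ?thesis
      unfolding s3 s1 w_def[symmetric] 1 2 3 C_def \<kappa>0_def by (simp add: add_divide_distrib algebra_simps)
  qed
  have "(\<integral>\<omega>. iexp ((u1 / \<sigma> * \<eta> ^ 3) * edge_height T U \<omega> + (u2 / \<sigma> * \<eta>) * time_height T len U \<omega>
      + (\<Sum>r=1..j. (\<tau> r * \<eta>) * decrement_count T U r \<omega>) - C) \<partial>M) =
    (\<integral>\<omega>. exp (- \<i> * of_real C) * iexp ((u1 / \<sigma> * \<eta> ^ 3) * edge_height T U \<omega> + (u2 / \<sigma> * \<eta>) * time_height T len U \<omega>
      + (\<Sum>r=1..j. (\<tau> r * \<eta>) * decrement_count T U r \<omega>)) \<partial>M)"
    by (intro Bochner_Integration.integral_cong refl) (simp only: exp_add[symmetric], simp add: right_diff_distrib)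
  also have "\<dots> = exp (- \<i> * of_real C) * path_transform (u1 / \<sigma> * \<eta> ^ 3) (u2 / \<sigma> * \<eta>) (\<lambda>r. if r \<in> {1..j} then \<tau> r * \<eta> else 0) (n - 1)"
    using n by (subst integral_mult_right_zero, subst joint_transform) auto
  finally show ?thesis unfolding split C_def .
qed

theorem theorem1p2:
  fixes M :: "nat \<Rightarrow> 'a measure"
    and T :: "nat \<Rightarrow> 'a \<Rightarrow> split_tree"
    and len :: "nat \<Rightarrow> 'a \<Rightarrow> edge \<Rightarrow> real"
    and U :: "nat \<Rightarrow> 'a \<Rightarrow> nat"
    and N :: "'b measure"
    and W :: "real \<Rightarrow> 'b \<Rightarrow> real"
    and Y :: "nat \<Rightarrow> 'b \<Rightarrow> real"
    and j :: nat
    and idx :: "'d::finite \<Rightarrow> nat"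
  assumes model: "\<And>n. n \<ge> 1 \<Longrightarrow> beta_splitting_model (M n) n (T n) (len n) (U n)"
    and W: "std_brownian_motion N W"
    and idx: "bij_betw idx (UNIV :: 'd set) {1..j}"
    and Y_normal: "\<And>r. r \<in> {1..j} \<Longrightarrow> distributed N lborel (Y r) std_normal_density"
    and Y_indep: "prob_space.indep_vars N (\<lambda>_. borel) Y {1..j}"
    and Y_W_indep:
      "prob_space.indep_set N
         (sets (vimage_algebra (space N) (\<lambda>\<omega>. \<lambda>r\<in>{1..j}. Y r \<omega>) (PiM {1..j} (\<lambda>_. borel))))
         (sets (vimage_algebra (space N) (\<lambda>\<omega>. \<lambda>u\<in>{0..1::real}. W u \<omega>) (PiM {0..1} (\<lambda>_. borel))))"
  shows
    "let L = (\<lambda>n. edge_height (T n) (U n));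
         D = (\<lambda>n. time_height (T n) (len n) (U n));
         Lr = (\<lambda>n r. decrement_count (T n) (U n) r);
         X1 = (\<lambda>n \<omega>. (L n \<omega> - 1 / (2 * zeta 2) * (ln (real n))^2)
                      / sqrt (2 * zeta 3 / zeta 2 ^ 3 * (ln (real n))^3));
         X2 = (\<lambda>n \<omega>. (D n \<omega> - 1 / zeta 2 * ln (real n))
                      / sqrt (2 * zeta 3 / zeta 2 ^ 3 * ln (real n)));
         X3 = (\<lambda>n \<omega>. (\<chi> i. (Lr n (idx i) \<omega> - 1 / (zeta 2 * real (idx i)) * ln (real n))
                           / sqrt (ln (real n))) :: real ^ 'd);
         Z1 = (\<lambda>\<omega>. integral {0..1} (\<lambda>u. W u \<omega>));
         Z2 = (\<lambda>\<omega>. W 1 \<omega>);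
         Z3 = (\<lambda>\<omega>. (\<chi> i. sqrt (2 * zeta 3 / zeta 2 ^ 3) * (1 / real (idx i)) * W 1 \<omega>
                         + 1 / sqrt (real (idx i) * zeta 2) * Y (idx i) \<omega>) :: real ^ 'd)
     in converges_in_distribution M (\<lambda>n \<omega>. (X1 n \<omega>, X2 n \<omega>)) N (\<lambda>\<omega>. (Z1 \<omega>, Z2 \<omega>)) \<and>
        converges_in_distribution M X3 N Z3 \<and>
        converges_in_distribution M (\<lambda>n \<omega>. (X1 n \<omega>, X2 n \<omega>, X3 n \<omega>)) N
          (\<lambda>\<omega>. (Z1 \<omega>, Z2 \<omega>, Z3 \<omega>))"
proof -
  interpret W: std_brownian_motion N W by (rule W)
  define \<sigma> where "\<sigma> = sqrt (2 * zeta 3 / zeta 2 ^ 3)"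
  define X1 where "X1 n \<omega> = (edge_height (T n) (U n) \<omega> - 1 / (2 * zeta 2) * (ln (real n))^2)
     / sqrt (2 * zeta 3 / zeta 2 ^ 3 * (ln (real n))^3)" for n \<omega>
  define X2 where "X2 n \<omega> = (time_height (T n) (len n) (U n) \<omega> - 1 / zeta 2 * ln (real n))
     / sqrt (2 * zeta 3 / zeta 2 ^ 3 * ln (real n))" for n \<omega>
  define R where "R n r \<omega> = (decrement_count (T n) (U n) r \<omega> - 1 / (zeta 2 * real r) * ln (real n)) / sqrt (ln (real n))" for n r \<omega>
  define X3 where "X3 n \<omega> = (\<chi> i. R n (idx i) \<omega> :: real ^ 'd)" for n \<omega>
  define Z1 where "Z1 \<omega> = integral {0..1} (\<lambda>u. W u \<omega>)" for \<omega>
  define V where "V r \<omega> = \<sigma> * (1 / real r) * W 1 \<omega> + 1 / sqrt (real r * zeta 2) * Y r \<omega>" for r \<omega>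
  define Z3 where "Z3 \<omega> = (\<chi> i. V (idx i) \<omega> :: real ^ 'd)" for \<omega>
  have \<sigma>: "0 < \<sigma>" "\<sigma> ^ 2 = 2 * zeta 3 / zeta 2 ^ 3"
    using zeta_3_ge_1 zeta_2_ge_1 by (auto simp: \<sigma>_def)
  have z2: "0 < zeta 2" using zeta_2_ge_1 by simp
  have idx1: "idx i \<in> {1..j}" for i using idx by (auto simp: bij_betw_def)
  have Ym: "Y r \<in> borel_measurable N" if "r \<in> {1..j}" for r
    using Y_normal[OF that] by (simp add: distributed_def)
  have joint: "converges_in_distribution M (\<lambda>n \<omega>. (X1 n \<omega>, X2 n \<omega>, X3 n \<omega>)) N (\<lambda>\<omega>. (Z1 \<omega>, W 1 \<omega>, Z3 \<omega>))"
  proof (rule converges_in_distribution_Suc,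
      rule char_convergence.convergence_in_distribution[OF
        char_convergence.intro[OF W.prob_space_axioms char_convergence_axioms.intro]])
    fix n
    interpret m: beta_splitting_model "M (Suc n)" "Suc n" "T (Suc n)" "len (Suc n)" "U (Suc n)"
      by (rule model) simp
    show "prob_space (M (Suc n))" by (rule m.prob_space_axioms)
    have "X1 (Suc n) \<in> borel_measurable (M (Suc n))" "X2 (Suc n) \<in> borel_measurable (M (Suc n))"
      "R (Suc n) r \<in> borel_measurable (M (Suc n))" for r
      unfolding X1_def X2_def R_def using m.heights_measurable by measurable
    then show "(\<lambda>\<omega>. (X1 (Suc n) \<omega>, X2 (Suc n) \<omega>, X3 (Suc n) \<omega>)) \<in> borel_measurable (M (Suc n))"
      unfolding X3_def by (intro borel_measurable_Pair borel_measurable_vec_lambda)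
  next
    have W1: "W 1 \<in> borel_measurable N" by (rule W.W_measurable) simp
    have "V (idx i) \<in> borel_measurable N" for i
      unfolding V_def using W1 Ym[OF idx1] by (intro borel_measurable_add borel_measurable_times) auto
    moreover have "Z1 \<in> borel_measurable N"
      unfolding Z1_def by (rule W.integral_W_measurable[OF refl W.W_measurable])
    ultimately show "(\<lambda>\<omega>. (Z1 \<omega>, W 1 \<omega>, Z3 \<omega>)) \<in> borel_measurable N"
      unfolding Z3_def using W1 by (intro borel_measurable_Pair borel_measurable_vec_lambda)
  next
    fix u :: "real \<times> real \<times> (real ^ 'd)"
    obtain u1 u2 u3 where u: "u = (u1, u2, u3)" by (cases u) auto
    define \<tau> where "\<tau> r = u3 $ (inv_into UNIV idx r)" for r
    have \<tau>: "\<tau> (idx i) = u3 $ i" for i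
      using idx by (simp add: \<tau>_def bij_betw_def inv_into_f_f)
    have reindex: "(\<Sum>i\<in>UNIV. u3 $ i * f (idx i)) = (\<Sum>r=1..j. \<tau> r * f r)" for f :: "nat \<Rightarrow> real"
      using sum.reindex_bij_betw[OF idx, of "\<lambda>r. \<tau> r * f r"] by (simp add: \<tau>)
    have X_inner: "u \<bullet> (X1 n \<omega>, X2 n \<omega>, X3 n \<omega>) = u1 * X1 n \<omega> + u2 * X2 n \<omega> + (\<Sum>r=1..j. \<tau> r * R n r \<omega>)" for n \<omega>
      by (simp add: u X3_def inner_vec_def reindex[of "\<lambda>r. R n r \<omega>", simplified])
    define \<kappa>0 where "\<kappa>0 = u2 / \<sigma> + (\<Sum>r=1..j. \<tau> r / real r)"
    define \<eta> where "\<eta> n = 1 / sqrt (ln (real n))" for n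
    have Z_inner: "u \<bullet> (Z1 \<omega>, W 1 \<omega>, Z3 \<omega>) = u1 * Z1 \<omega> + (\<sigma> * \<kappa>0) * W 1 \<omega>
        + (\<Sum>r=1..j. (\<tau> r / sqrt (real r * zeta 2)) * Y r \<omega>)" for \<omega>
    proof -
      have "u \<bullet> (Z1 \<omega>, W 1 \<omega>, Z3 \<omega>) = u1 * Z1 \<omega> + u2 * W 1 \<omega> + (\<Sum>r=1..j. \<tau> r * V r \<omega>)"
        by (simp add: u Z3_def inner_vec_def reindex[of "\<lambda>r. V r \<omega>", simplified])
      also have "(\<Sum>r=1..j. \<tau> r * V r \<omega>) = (\<Sum>r=1..j. \<tau> r / real r * (\<sigma> * W 1 \<omega>) + (\<tau> r / sqrt (real r * zeta 2)) * Y r \<omega>)"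
        by (intro sum.cong refl) (simp add: V_def algebra_simps)
      also have "\<dots> = (\<Sum>r=1..j. \<tau> r / real r) * (\<sigma> * W 1 \<omega>) + (\<Sum>r=1..j. (\<tau> r / sqrt (real r * zeta 2)) * Y r \<omega>)"
        by (simp only: sum.distrib sum_distrib_right)
      also have "u1 * Z1 \<omega> + u2 * W 1 \<omega> + \<dots> = u1 * Z1 \<omega> + (\<sigma> * \<kappa>0) * W 1 \<omega>
        + (\<Sum>r=1..j. (\<tau> r / sqrt (real r * zeta 2)) * Y r \<omega>)"
        using \<sigma>(1) by (simp add: \<kappa>0_def algebra_simps)
      finally show ?thesis .
    qed
    have "(\<integral>\<omega>. iexp (u \<bullet> (Z1 \<omega>, W 1 \<omega>, Z3 \<omega>)) \<partial>N) =
      exp (- of_real ((u1 ^ 2 / 3 + u1 * (\<sigma> * \<kappa>0) + (\<sigma> * \<kappa>0) ^ 2) / 2 + (\<Sum>r=1..j. (\<tau> r / sqrt (real r * zeta 2)) ^ 2) / 2))"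
      unfolding Z_inner unfolding Z1_def by (rule W.char_limit[OF Y_normal Y_indep Y_W_indep])
    also have "(u1 ^ 2 / 3 + u1 * (\<sigma> * \<kappa>0) + (\<sigma> * \<kappa>0) ^ 2) / 2 =
        zeta 3 / zeta 2 ^ 3 * ((u1 / \<sigma>) ^ 2 / 3 + (u1 / \<sigma>) * \<kappa>0 + \<kappa>0 ^ 2)"
    proof -
      have eq: "zeta 3 / zeta 2 ^ 3 = \<sigma> ^ 2 / 2" using \<sigma>(2) by simp
      show ?thesis unfolding eq using \<sigma>(1) by (simp add: field_simps power2_eq_square)
    qed
    also have "(\<Sum>r=1..j. (\<tau> r / sqrt (real r * zeta 2)) ^ 2) / 2 = (\<Sum>r=1..j. \<tau> r ^ 2 / real r) / (2 * zeta 2)"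
      unfolding sum_divide_distrib using z2
      by (intro sum.cong refl) (simp add: power_divide)
    \<comment> \<open>the quadratic form of the limit, in the shape in which \<open>path_transform_limit\<close> produces it\<close>
    finally have Z_char: "(\<integral>\<omega>. iexp (u \<bullet> (Z1 \<omega>, W 1 \<omega>, Z3 \<omega>)) \<partial>N) =
      exp (- of_real ((\<Sum>r=1..j. \<tau> r ^ 2 / real r) / (2 * zeta 2)
         + zeta 3 / zeta 2 ^ 3 * ((u1 / \<sigma>) ^ 2 / 3 + (u1 / \<sigma>) * \<kappa>0 + \<kappa>0 ^ 2)))"
      by (simp only: add.commute)
    have X_char: "(\<integral>\<omega>. iexp (u \<bullet> (X1 n \<omega>, X2 n \<omega>, X3 n \<omega>)) \<partial>M n) =
      exp (- \<i> * of_real ((u1 / \<sigma> * \<eta> n ^ 3 * ln (real n) ^ 2 / 2 + \<kappa>0 * \<eta> n * ln (real n)) / zeta 2)) *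
      path_transform (u1 / \<sigma> * \<eta> n ^ 3) (u2 / \<sigma> * \<eta> n) (\<lambda>r. if r \<in> {1..j} then \<tau> r * \<eta> n else 0) (n - 1)"
      if "2 \<le> n" for n
      unfolding X_inner unfolding X1_def X2_def R_def \<eta>_def \<kappa>0_def
      by (rule beta_splitting_model.normalized_transform[OF model that \<sigma>_def]) (use that in simp)
    have "(\<lambda>n. \<integral>\<omega>. iexp (u \<bullet> (X1 n \<omega>, X2 n \<omega>, X3 n \<omega>)) \<partial>M n) \<longlonglongrightarrow> (\<integral>\<omega>. iexp (u \<bullet> (Z1 \<omega>, W 1 \<omega>, Z3 \<omega>)) \<partial>N)"
    proof (rule Lim_transform_eventually)
      show "\<forall>\<^sub>F n in sequentially. exp (- \<i> * of_real ((u1 / \<sigma> * \<eta> n ^ 3 * ln (real n) ^ 2 / 2 + \<kappa>0 * \<eta> n * ln (real n)) / zeta 2)) *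
        path_transform (u1 / \<sigma> * \<eta> n ^ 3) (u2 / \<sigma> * \<eta> n) (\<lambda>r. if r \<in> {1..j} then \<tau> r * \<eta> n else 0) (n - 1)
        = (\<integral>\<omega>. iexp (u \<bullet> (X1 n \<omega>, X2 n \<omega>, X3 n \<omega>)) \<partial>M n)"
        by (rule eventually_sequentiallyI[of 2]) (rule X_char[symmetric])
    next
      show "(\<lambda>n. exp (- \<i> * of_real ((u1 / \<sigma> * \<eta> n ^ 3 * ln (real n) ^ 2 / 2 + \<kappa>0 * \<eta> n * ln (real n)) / zeta 2)) *
        path_transform (u1 / \<sigma> * \<eta> n ^ 3) (u2 / \<sigma> * \<eta> n) (\<lambda>r. if r \<in> {1..j} then \<tau> r * \<eta> n else 0) (n - 1))
        \<longlonglongrightarrow> (\<integral>\<omega>. iexp (u \<bullet> (Z1 \<omega>, W 1 \<omega>, Z3 \<omega>)) \<partial>N)"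
        unfolding Z_char \<eta>_def \<kappa>0_def by (rule path_transform_limit)
    qed
    then show "(\<lambda>n. \<integral>\<omega>. iexp (u \<bullet> (X1 (Suc n) \<omega>, X2 (Suc n) \<omega>, X3 (Suc n) \<omega>)) \<partial>M (Suc n)) \<longlonglongrightarrow>
        (\<integral>\<omega>. iexp (u \<bullet> (Z1 \<omega>, W 1 \<omega>, Z3 \<omega>)) \<partial>N)"
      by (rule LIMSEQ_Suc)
  qed
  have pair: "converges_in_distribution M (\<lambda>n \<omega>. (X1 n \<omega>, X2 n \<omega>)) N (\<lambda>\<omega>. (Z1 \<omega>, W 1 \<omega>))"
    using converges_in_distribution_continuous[OF joint, of "\<lambda>x. (fst x, fst (snd x))"]
    by (simp add: continuous_intros)
  have third: "converges_in_distribution M X3 N Z3"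
    using converges_in_distribution_continuous[OF joint, of "\<lambda>x. snd (snd x)"]
    by (simp add: continuous_intros)
  show ?thesis
    using joint pair third
    unfolding Let_def X1_def[abs_def] X2_def[abs_def] X3_def[abs_def] R_def Z1_def[abs_def] Z3_def[abs_def] V_def \<sigma>_def
    by blast
qed

end
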